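(* Let $K$ be a non-archimedean locally compact field, $d\ge1$, $X$ the Bruhat-Tits building of $\mathrm{PGL}_{d+1}/K$, $R$ a commutative ring, and $\mathcal{A}\subset\mathbb{P}(K^{d+1})$ a non-empty (possibly infinite) subset. The cohomological coefficient systems $\widetilde{A}$ and $A$ on $X$ attached to $\mathcal{A}$ (with coefficient ring $R$) are acyclic in positive degrees: for any $k\ge1$ we have $H^k(X,A)=0$ and $H^k(X,\widetilde{A})=0$.
   Context: Notation. $\mathcal{O}_K$ is the ring of integers of $K$, $\pi\in\mathcal{O}_K$ a fixed prime element. A lattice is a free $\mathcal{O}_K$-submodule of $K^{d+1}$ of rank $d+1$; $[L]$ is the homothety class of $L$ (under $K^\times$). The building $X$. Vertices of $X$ are the homothety classes of lattices in $K^{d+1}$; the $k$-simplices are the sets $\{[L_0],\ldots,[L_k]\}$ arising from lattice chains $\pi L_k\subsetneq L_0\subsetneq L_1\subsetneq\cdots\subsetneq L_k$. $X^j$ is the set of $j$-simplices, identified with their vertex sets. The coefficient systems. View $\mathcal{A}$ as a set of lines in $K^{d+1}$; for $a\in K^{d+1}\setminus\{0\}$ let $e_a$ be the line spanned by $a$. $\widetilde{E}$ is the free exterior algebra over $R$ on the set $\mathcal{A}$, and $\delta:\widetilde{E}\to\widetilde{E}$ is the unique (graded) derivation, homogeneous of degree $-1$, with $\delta(e)=1$ for all $e\in\mathcal{A}$; so $\delta(e_0\wedge\cdots\wedge e_k)=\sum_{i=0}^k(-1)^ie_0\wedge\cdots\wedge\widehat{e_i}\wedge\cdots\wedge e_k$.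 Put $E=\operatorname{im}(\delta)=\ker(\delta)$, a subalgebra of $\widetilde{E}$. For a vertex $x$, an element $g\in\widetilde{E}$ is a standard generator of $I(x)$ if there are a lattice $L_x$ representing $x$ and elements $a_0,\ldots,a_m\in L_x\setminus\pi L_x$ with $e_{a_i}\in\mathcal{A}$, linearly dependent modulo $\pi L_x$ (i.e. in the vector space $L_x/\pi L_x$ over the residue field), such that $g=\delta(e_{a_0}\wedge\cdots\wedge e_{a_m})$. $I(x)\subset\widetilde{E}$ is the ideal generated by the standard generators of $I(x)$; for a simplex $\sigma$, $I(\sigma)=\sum_{x\in\sigma}I(x)$. Put $\widetilde{A}(\sigma)=\widetilde{E}/I(\sigma)$ and $A(\sigma)=E/(E\cap I(\sigma))$. Coefficient systems. A cohomological coefficient system (ccs) $\mathcal{F}$ on $X$ assigns to every simplex $\tau$ an abelian group $\mathcal{F}(\tau)$ and to every face inclusion $\tau\subset\sigma$ a homomorphism $r^\tau_\sigma:\mathcal{F}(\tau)\to\mathcal{F}(\sigma)$, transitively and with $r^\tau_\tau=\mathrm{id}$; $\widetilde{A}$ and $A$ are ccs with the natural projections as transition maps. $C^k(X,\mathcal{F})=\prod_{\tau\in X^k}\mathcal{F}(\tau)$, with $\partial:C^k(X,\mathcal{F})\to C^{k+1}(X,\mathcal{F})$, $(\partial c)_\tau=\sum_{\tau'\subset\tau}[\tau:\tau']r^{\tau'}_\tau(c_{\tau'})$ (sum over codimension one faces, $[\tau:\tau']=\pm1$ incidence numbers with respect to a fixed labelling of $X$ by vertex types). $H^k(X,\mathcal{F})$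 is the $k$-th cohomology group of $(C^\bullet(X,\mathcal{F}),\partial)$. *)

theory Defs
  imports "HOL-Analysis.Analysis" "HOL-Algebra.QuotRing" "HOL-Algebra.Product_Groups"
begin

section \<open>Non-archimedean locally compact fields\<close>

text \<open>The field is a type; its topology is the metric topology of a non-trivial
  ultrametric absolute value \<open>v\<close>.\<close>

definition nonarch_abs :: "('k::field \<Rightarrow> real) \<Rightarrow> bool" where
  "nonarch_abs v \<longleftrightarrow>
     (\<forall>x. 0 \<le> v x) \<and> (\<forall>x. v x = 0 \<longleftrightarrow> x = 0) \<and>
     (\<forall>x y. v (x * y) = v x * v y) \<and> (\<forall>x y. v (x + y) \<le> max (v x) (v y)) \<and>
     (\<exists>x. x \<noteq> 0 \<and> v x \<noteq> 1)"

definition nonarch_locally_compact_field :: "('k::field \<Rightarrow> real) \<Rightarrow> bool" where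
  "nonarch_locally_compact_field v \<longleftrightarrow>
     nonarch_abs v \<and>
     locally_compact_space (Metric_space.mtopology UNIV (\<lambda>x y. v (x - y)))"

definition integer_ring :: "('k::field \<Rightarrow> real) \<Rightarrow> 'k set" where
  "integer_ring v = {x. v x \<le> 1}"

text \<open>A prime element is a generator of the maximal ideal of the ring of integers.\<close>

definition prime_element :: "('k::field \<Rightarrow> real) \<Rightarrow> 'k \<Rightarrow> bool" where
  "prime_element v p \<longleftrightarrow> {x. v x < 1} = (\<lambda>y. p * y) ` integer_ring v"


section \<open>The building\<close>

definition scale_set :: "'k::field \<Rightarrow> ('k^'n) set \<Rightarrow> ('k^'n) set" where
  "scale_set c L = (\<lambda>x. c *s x) ` L"

definition is_lattice :: "('k::field \<Rightarrow> real) \<Rightarrow> ('k^'n) set \<Rightarrow> bool" where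
  "is_lattice v L \<longleftrightarrow>
     (\<exists>b :: 'n \<Rightarrow> 'k^'n.
        L = {\<Sum>i\<in>UNIV. c i *s b i | c. \<forall>i. c i \<in> integer_ring v} \<and>
        (\<forall>c. (\<forall>i. c i \<in> integer_ring v) \<and> (\<Sum>i\<in>UNIV. c i *s b i) = 0 \<longrightarrow> (\<forall>i. c i = 0)))"

definition homothety_class :: "('k::field^'n) set \<Rightarrow> ('k^'n) set set" where
  "homothety_class L = {scale_set c L | c. c \<noteq> 0}"

definition building :: "('k::field \<Rightarrow> real) \<Rightarrow> 'k \<Rightarrow> nat \<Rightarrow> ('k^'n) set set set set" where
  "building v p k =
     {(\<lambda>i. homothety_class (L i)) ` {..k} | L.
        (\<forall>i\<le>k. is_lattice v (L i)) \<and>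
        scale_set p (L k) \<subset> L 0 \<and> (\<forall>i<k. L i \<subset> L (Suc i))}"

text \<open>A labelling of the vertices by \<open>CARD('n) = d + 1\<close> types: the vertices of each simplex
  have pairwise distinct types.\<close>

definition type_labelling ::
    "('k::field \<Rightarrow> real) \<Rightarrow> 'k \<Rightarrow> (('k^'n) set set \<Rightarrow> nat) \<Rightarrow> bool" where
  "type_labelling v p lab \<longleftrightarrow>
     (\<forall>L. is_lattice v L \<longrightarrow> lab (homothety_class L) < CARD('n)) \<and>
     (\<forall>k. \<forall>\<sigma>\<in>building v p k. inj_on lab \<sigma>)"


section \<open>Cohomology of coefficient systems\<close>

text \<open>A simplicial complex is given by its sets \<open>X k\<close> of \<open>k\<close>-simplices. The abelian groups of a
  coefficient system are written multiplicatively.\<close>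

record ('v, 'm) ccs =
  ccs_group :: "'v set \<Rightarrow> 'm monoid"
  ccs_map :: "'v set \<Rightarrow> 'v set \<Rightarrow> 'm \<Rightarrow> 'm"  \<comment> \<open>\<open>ccs_map F \<tau> \<sigma>\<close> is the map \<open>F(\<tau>) \<rightarrow> F(\<sigma>)\<close> for \<open>\<tau> \<subseteq> \<sigma>\<close>\<close>

text \<open>For a codimension one face \<open>\<tau>'\<close> of \<open>\<tau>\<close>, omitting the vertex \<open>x\<close>, the sign is determined by the
  position of \<open>x\<close> in \<open>\<tau>\<close> when the vertices are ordered by their labels.\<close>

definition incidence :: "('v \<Rightarrow> nat) \<Rightarrow> 'v set \<Rightarrow> 'v set \<Rightarrow> int" where
  "incidence lab \<tau> \<tau>' = (-1) ^ card {y \<in> \<tau>. \<exists>x \<in> \<tau> - \<tau>'. lab y < lab x}"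

definition cochains :: "(nat \<Rightarrow> 'v set set) \<Rightarrow> ('v, 'm) ccs \<Rightarrow> nat \<Rightarrow> ('v set \<Rightarrow> 'm) monoid" where
  "cochains X F k = product_group (X k) (ccs_group F)"

definition coboundary ::
    "(nat \<Rightarrow> 'v set set) \<Rightarrow> ('v \<Rightarrow> nat) \<Rightarrow> ('v, 'm) ccs \<Rightarrow> nat \<Rightarrow> ('v set \<Rightarrow> 'm) \<Rightarrow> ('v set \<Rightarrow> 'm)" where
  "coboundary X lab F k c =
     (\<lambda>\<tau> \<in> X (Suc k).
        \<Otimes>\<^bsub>ccs_group F \<tau>\<^esub>\<tau>' \<in> {\<tau>' \<in> X k. \<tau>' \<subseteq> \<tau>}.
          ccs_map F \<tau>' \<tau> (c \<tau>') [^]\<^bsub>ccs_group F \<tau>\<^esub> incidence lab \<tau> \<tau>')"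

definition cocycles ::
    "(nat \<Rightarrow> 'v set set) \<Rightarrow> ('v \<Rightarrow> nat) \<Rightarrow> ('v, 'm) ccs \<Rightarrow> nat \<Rightarrow> ('v set \<Rightarrow> 'm) set" where
  "cocycles X lab F k = kernel (cochains X F k) (cochains X F (Suc k)) (coboundary X lab F k)"

definition coboundaries ::
    "(nat \<Rightarrow> 'v set set) \<Rightarrow> ('v \<Rightarrow> nat) \<Rightarrow> ('v, 'm) ccs \<Rightarrow> nat \<Rightarrow> ('v set \<Rightarrow> 'm) set" where
  "coboundaries X lab F k =
     (case k of 0 \<Rightarrow> {\<one>\<^bsub>cochains X F 0\<^esub>}
              | Suc j \<Rightarrow> coboundary X lab F j ` carrier (cochains X F j))"

definition cohomology ::
    "(nat \<Rightarrow> 'v set set) \<Rightarrow> ('v \<Rightarrow> nat) \<Rightarrow> ('v, 'm) ccs \<Rightarrow> nat \<Rightarrow> ('v set \<Rightarrow> 'm) set monoid" where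
  "cohomology X lab F k =
     (cochains X F k)\<lparr>carrier := cocycles X lab F k\<rparr> Mod coboundaries X lab F k"


section \<open>The exterior algebra on a set\<close>

text \<open>The coefficient ring is a type of sort \<open>{comm_ring, comm_monoid_mult}\<close>, that is, a commutative
  ring with one in which \<open>0 = 1\<close> is permitted (unlike in \<open>comm_ring_1\<close>).

  The exterior algebra is the free module on the monomials
  \<open>e\<^sub>S = e\<^bsub>s_0\<^esub> \<and> \<dots> \<and> e\<^bsub>s_k\<^esub>\<close>, where \<open>S = {s_0 < \<dots> < s_k}\<close> runs through the finite
  subsets of the given set \<open>A\<close>, and an element is represented by its coefficient function. The total
  order serves to normalise the signs of the monomials; it is chosen arbitrarily.\<close>

definition gen_less :: "'l \<Rightarrow> 'l \<Rightarrow> bool" where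
  "gen_less = (SOME r. (\<forall>x. \<not> r x x) \<and> (\<forall>x y z. r x y \<longrightarrow> r y z \<longrightarrow> r x z) \<and>
                       (\<forall>x y. x \<noteq> y \<longrightarrow> r x y \<or> r y x))"

definition signed :: "nat \<Rightarrow> 'r::ab_group_add \<Rightarrow> 'r" where
  "signed n x = (if even n then x else - x)"

definition inversions :: "'l set \<Rightarrow> 'l set \<Rightarrow> nat" where
  "inversions T U = card {(t, u). t \<in> T \<and> u \<in> U \<and> gen_less u t}"

text \<open>The product is given by \<open>e\<^sub>T \<and> e\<^sub>U = (-1)\<^bsup>inversions T U\<^esup> e\<^bsub>T \<union> U\<^esub>\<close> for
  disjoint \<open>T\<close> and \<open>U\<close>, and \<open>e\<^sub>T \<and> e\<^sub>U = 0\<close> otherwise.\<close>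

definition ext_alg :: "'l set \<Rightarrow> ('l set \<Rightarrow> 'r::{comm_ring, comm_monoid_mult}) ring" where
  "ext_alg A =
     \<lparr>carrier = {f. finite {S. f S \<noteq> 0} \<and> (\<forall>S. f S \<noteq> 0 \<longrightarrow> finite S \<and> S \<subseteq> A)},
      mult = (\<lambda>f g S. \<Sum>T\<in>Pow S. signed (inversions T (S - T)) (f T * g (S - T))),
      one = (\<lambda>S. if S = {} then 1 else 0),
      zero = (\<lambda>S. 0),
      add = (\<lambda>f g S. f S + g S)\<rparr>"

definition ext_gen :: "'l \<Rightarrow> 'l set \<Rightarrow> 'r::{comm_ring, comm_monoid_mult}" where
  "ext_gen l = (\<lambda>S. if S = {l} then 1 else 0)"

definition ext_prod :: "'l set \<Rightarrow> 'l list \<Rightarrow> 'l set \<Rightarrow> 'r::{comm_ring, comm_monoid_mult}" where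
  "ext_prod A ls = foldr (\<lambda>l f. ext_gen l \<otimes>\<^bsub>ext_alg A\<^esub> f) ls \<one>\<^bsub>ext_alg A\<^esub>"

text \<open>The derivation with \<open>e\<^bsub>s_0\<^esub> \<and> \<dots> \<and> e\<^bsub>s_k\<^esub> \<mapsto>
  \<Sum>\<^sub>i (-1)\<^sup>i e\<^bsub>s_0\<^esub> \<and> \<dots> \<and> e\<^bsub>s_k\<^esub>\<close> (omitting \<open>e\<^bsub>s_i\<^esub>\<close>): the coefficient of \<open>e\<^sub>S\<close> in the image
  of \<open>f\<close> collects those of the monomials \<open>e\<^bsub>S \<union> {l}\<^esub>\<close> with \<open>l \<notin> S\<close>, and \<open>i\<close> is the position of
  \<open>l\<close> in \<open>S \<union> {l}\<close>. Only finitely many of these are nonzero.\<close>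

definition ext_der :: "('l set \<Rightarrow> 'r::{comm_ring, comm_monoid_mult}) \<Rightarrow> 'l set \<Rightarrow> 'r" where
  "ext_der f = (\<lambda>S. \<Sum>l | l \<notin> S \<and> f (insert l S) \<noteq> 0.
                     signed (card {s \<in> S. gen_less s l}) (f (insert l S)))"

definition ext_im :: "'l set \<Rightarrow> ('l set \<Rightarrow> 'r::{comm_ring, comm_monoid_mult}) set" where
  "ext_im A = ext_der ` carrier (ext_alg A)"


section \<open>The coefficient systems attached to a set of lines\<close>

definition lines :: "('k::field^'n) set set" where
  "lines = {vec.span {a} | a. a \<noteq> 0}"

text \<open>Linear dependence in \<open>L / p L\<close> over the residue field: some \<open>\<O>\<close>-linear combination, with
  a coefficient that is not divisible by \<open>p\<close>, lies in \<open>p L\<close>.\<close>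

definition dependent_mod ::
    "('k::field \<Rightarrow> real) \<Rightarrow> 'k \<Rightarrow> ('k^'n) set \<Rightarrow> nat \<Rightarrow> (nat \<Rightarrow> 'k^'n) \<Rightarrow> bool" where
  "dependent_mod v p L m a \<longleftrightarrow>
     (\<exists>c. (\<forall>i\<le>m. c i \<in> integer_ring v) \<and>
          (\<exists>i\<le>m. c i \<notin> (\<lambda>y. p * y) ` integer_ring v) \<and>
          (\<Sum>i\<le>m. c i *s a i) \<in> scale_set p L)"

definition standard_generators ::
    "('k::field \<Rightarrow> real) \<Rightarrow> 'k \<Rightarrow> ('k^'n) set set \<Rightarrow> ('k^'n) set set \<Rightarrow>
     (('k^'n) set set \<Rightarrow> 'r::{comm_ring, comm_monoid_mult}) set" where
  "standard_generators v p A x =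
     {ext_der (ext_prod A (map (\<lambda>i. vec.span {a i}) [0..<Suc m])) | L m a.
        is_lattice v L \<and> homothety_class L = x \<and>
        (\<forall>i\<le>m. a i \<in> L - scale_set p L \<and> vec.span {a i} \<in> A) \<and>
        dependent_mod v p L m a}"

definition vertex_ideal ::
    "('k::field \<Rightarrow> real) \<Rightarrow> 'k \<Rightarrow> ('k^'n) set set \<Rightarrow> ('k^'n) set set \<Rightarrow>
     (('k^'n) set set \<Rightarrow> 'r::{comm_ring, comm_monoid_mult}) set" where
  "vertex_ideal v p A x = Idl\<^bsub>ext_alg A\<^esub> (standard_generators v p A x)"

definition simplex_ideal ::
    "('k::field \<Rightarrow> real) \<Rightarrow> 'k \<Rightarrow> ('k^'n) set set \<Rightarrow> ('k^'n) set set set \<Rightarrow>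
     (('k^'n) set set \<Rightarrow> 'r::{comm_ring, comm_monoid_mult}) set" where
  "simplex_ideal v p A \<sigma> =
     {\<Oplus>\<^bsub>ext_alg A\<^esub>x\<in>\<sigma>. g x | g. g \<in> (\<Pi> x\<in>\<sigma>. vertex_ideal v p A x)}"

text \<open>Elements of the quotient rings are cosets, and the natural projections are
  \<open>f + I(\<tau>) \<mapsto> I(\<sigma>) + (f + I(\<tau>)) = f + I(\<sigma>)\<close>.\<close>

definition ccs_Atilde ::
    "('k::field \<Rightarrow> real) \<Rightarrow> 'k \<Rightarrow> ('k^'n) set set \<Rightarrow>
     (('k^'n) set set, (('k^'n) set set \<Rightarrow> 'r::{comm_ring, comm_monoid_mult}) set) ccs" where
  "ccs_Atilde v p A =
     \<lparr>ccs_group = (\<lambda>\<sigma>. add_monoid (ext_alg A Quot simplex_ideal v p A \<sigma>)),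
      ccs_map = (\<lambda>\<tau> \<sigma> C. simplex_ideal v p A \<sigma> <+>\<^bsub>ext_alg A\<^esub> C)\<rparr>"

definition ccs_A ::
    "('k::field \<Rightarrow> real) \<Rightarrow> 'k \<Rightarrow> ('k^'n) set set \<Rightarrow>
     (('k^'n) set set, (('k^'n) set set \<Rightarrow> 'r::{comm_ring, comm_monoid_mult}) set) ccs" where
  "ccs_A v p A =
     \<lparr>ccs_group = (\<lambda>\<sigma>. add_monoid ((ext_alg A)\<lparr>carrier := ext_im A\<rparr> Quot
                              (ext_im A \<inter> simplex_ideal v p A \<sigma>))),
      ccs_map = (\<lambda>\<tau> \<sigma> C. (ext_im A \<inter> simplex_ideal v p A \<sigma>) <+>\<^bsub>ext_alg A\<^esub> C)\<rparr>"

end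

theory Submission
  imports Defs "HOL-Library.Function_Algebras" "HOL-Library.Multiset"
begin

text \<open>
  As an \<open>R\<close>-module, the ideal \<open>I(\<sigma>)\<close> is spanned by the monomials \<open>e\<^sub>T\<close> and their boundaries
  \<open>\<delta>(e\<^sub>T)\<close>, where \<open>T\<close> is linearly dependent modulo \<open>p L\<close> for some \<open>[L] \<in> \<sigma>\<close>. A linear order on the lines orders the
  monomials colexicographically, and modulo \<open>I(\<sigma>)\<close> the monomials without a broken circuit at any
  vertex of \<open>\<sigma>\<close> form a basis: a broken circuit gives a reduction to smaller monomials, and the iterated
  residue along a flag, a composite of contractions that anticommute with each other, detects a
  leading monomial without broken circuits.

  An induction on the leading monomial therefore reduces exactness of a cochain complex to constant
  coefficients on the vertices where \<open>e\<^sub>S\<close> has no broken circuit, and the lattices with this property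
  are closed under intersection. Build up \<open>X\<close> by increasing distance from a fixed vertex \<open>[L\<^sub>0]\<close>,
  normalising lattices so that they contain \<open>L\<^sub>0\<close> minimally. The vertices of the descending link of
  \<open>[L]\<close> correspond to the lattices between \<open>L\<^sub>0 + p L\<close> and \<open>L\<close>; the subset in question is empty or
  has a smallest element, so it spans a cone and contributes nothing. This treats
  the quotients of the full exterior algebra. Finally
  \<open>f \<mapsto> \<delta>(e\<^sub>l \<and> f)\<close> with \<open>l \<in> \<A>\<close> makes the quotients of the image of \<open>\<delta>\<close>
  direct summands of them.
\<close>

section \<open>Signs\<close>

text \<open>The monomials without broken circuits enter through two one-sided statements:
  \<open>broken_circuit_reduction\<close> trades any other monomial for smaller ones, and
  \<open>no_leading_nbc_monomial\<close> forbids them as leading terms of elements of the ideal. A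
  triangular argument needs no more. At one vertex the quotient is an Orlik-Solomon algebra of the
  lines reduced modulo \<open>p L\<close>. At a simplex the dependences at several lattices are
  superposed. What restores a single linear object is that all lattices representing its vertices
  form one chain, hence the balls of a norm: independence at every vertex is orthogonality for this
  norm, and flags are taken in the vector space itself, with closeness in place of membership. Two
  orders of the lines coexist. \<open>gen_less\<close> fixes the signs and is only known to be
  total; leading monomials need a well-order, because \<A> may be infinite and a reduction brings in
  new lines. Local compactness makes descending links finite, so that a cochain on such a link has a
  greatest monomial.\<close>

lemma signed_0 [simp]: "signed n 0 = 0"
  by (simp add: signed_def)

lemma signed_zero_exp [simp]: "signed 0 x = x"
  by (simp add: signed_def)

lemma signed_eq_0_iff [simp]: "signed n x = 0 \<longleftrightarrow> x = 0"
  by (simp add: signed_def)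

lemma signed_signed [simp]: "signed m (signed n x) = signed (m + n) x"
  by (simp add: signed_def)

lemma signed_cong_parity: "even m = even n \<Longrightarrow> signed m x = signed n x"
  by (simp add: signed_def)

lemma signed_opposite_parity: "even m \<noteq> even n \<Longrightarrow> signed m x = - signed n x"
  by (auto simp: signed_def)

lemma signed_minus: "signed n (- x) = - signed n x"
  by (simp add: signed_def)

lemma signed_add: "signed n (x + y) = signed n x + signed n y"
  by (simp add: signed_def)

lemma signed_diff: "signed n (x - y) = signed n x - signed n y"
  by (simp add: signed_def)

lemma signed_sum: "signed n (sum f I) = (\<Sum>i\<in>I. signed n (f i))"
  by (simp add: signed_def sum_negf)

lemma signed_mult_left: "signed n x * (y :: 'r :: comm_ring) = signed n (x * y)"
  by (simp add: signed_def)

lemma signed_mult_right: "(x :: 'r :: comm_ring) * signed n y = signed n (x * y)"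
  by (simp add: signed_def)

lemma signed_fun: "signed n f = (\<lambda>x. signed n (f x))"
  by (auto simp: signed_def fun_eq_iff)

lemma signed_Suc: "signed (Suc n) x = - signed n x"
  by (simp add: signed_def)

lemma signed_double [simp]: "signed (n + n) x = x" 
  by (simp add: signed_def)


section \<open>The auxiliary order of the generators\<close>

text \<open>The order is a choice, so its properties need an example; the strict part of a
  well-ordering serves. Well-foundedness does not survive the choice, whence the separate order of
  \<open>monomial_order\<close>.\<close>

lemma gen_less_total_order:
  "(\<forall>x::'l. \<not> gen_less x x) \<and> (\<forall>x y z::'l. gen_less x y \<longrightarrow> gen_less y z \<longrightarrow> gen_less x z) \<and>
     (\<forall>x y::'l. x \<noteq> y \<longrightarrow> gen_less x y \<or> gen_less y x)"
proof -
  obtain r :: "('l \<times> 'l) set" where wo: "Well_order r" and "Field r = UNIV"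
    using well_ordering[where 'a = 'l] by (elim exE conjE)
  then have "trans r" "antisym r" "total_on UNIV r"
    by (simp_all add: well_order_on_def linear_order_on_def partial_order_on_def preorder_on_def)
  then have r: "(x, y) \<in> r \<Longrightarrow> (y, z) \<in> r \<Longrightarrow> (x, z) \<in> r"
      "(x, y) \<in> r \<Longrightarrow> (y, x) \<in> r \<Longrightarrow> x = y"
      "x \<noteq> y \<Longrightarrow> (x, y) \<in> r \<or> (y, x) \<in> r" for x y z
    unfolding trans_def antisym_def total_on_def by blast+
  have "(\<forall>x::'l. \<not> ((x, x) \<in> r \<and> x \<noteq> x)) \<and>
      (\<forall>x y z. (x, y) \<in> r \<and> x \<noteq> y \<longrightarrow> (y, z) \<in> r \<and> y \<noteq> z \<longrightarrow> (x, z) \<in> r \<and> x \<noteq> z) \<and>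
      (\<forall>x y. x \<noteq> y \<longrightarrow> (x, y) \<in> r \<and> x \<noteq> y \<or> (y, x) \<in> r \<and> y \<noteq> x)"
    using r by metis
  then have "\<exists>r. (\<forall>x::'l. \<not> r x x) \<and> (\<forall>x y z. r x y \<longrightarrow> r y z \<longrightarrow> r x z) \<and>
                       (\<forall>x y. x \<noteq> y \<longrightarrow> r x y \<or> r y x)"
    by (intro exI[of _ "\<lambda>x y. (x, y) \<in> r \<and> x \<noteq> y"])
  then show ?thesis
    unfolding gen_less_def by (rule someI_ex)
qed

lemma gen_less_irrefl [simp]: "\<not> gen_less x x"
  using gen_less_total_order[THEN conjunct1] ..

lemma gen_less_trans: "gen_less x y \<Longrightarrow> gen_less y z \<Longrightarrow> gen_less x z"
  using gen_less_total_order[THEN conjunct2, THEN conjunct1, rule_format] .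

lemma gen_less_linear: "x \<noteq> y \<Longrightarrow> gen_less x y \<or> gen_less y x"
  using gen_less_total_order[THEN conjunct2, THEN conjunct2, rule_format] .

lemma gen_less_asym: "gen_less x y \<Longrightarrow> \<not> gen_less y x"
  using gen_less_trans[of x y x] by auto

text \<open>The number of transpositions that carry \<open>l\<close> from the front to its place
  among the lines of \<open>S\<close>; it is the exponent in the signs of contractions and of
  products with one generator.\<close>

definition below :: "'l set \<Rightarrow> 'l \<Rightarrow> nat" where
  "below S l = card {s \<in> S. gen_less s l}"

lemma below_insert_self [simp]: "below (insert l S) l = below S l"
  unfolding below_def by (rule arg_cong[where f = card]) auto

lemma below_insert:
  "finite S \<Longrightarrow> m \<notin> S \<Longrightarrow> below (insert m S) l = below S l + (if gen_less m l then 1 else 0)"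
proof -
  assume "finite S" "m \<notin> S"
  moreover have "{s \<in> insert m S. gen_less s l} =
      (if gen_less m l then insert m {s \<in> S. gen_less s l} else {s \<in> S. gen_less s l})"
    by auto
  ultimately show ?thesis by (simp add: below_def)
qed

lemma finite_inversions: "finite T \<Longrightarrow> finite U \<Longrightarrow> finite {(t, u). t \<in> T \<and> u \<in> U \<and> gen_less u t}"
  by (rule finite_subset[of _ "T \<times> U"]) auto

lemma inversions_Un_left:
  assumes "finite T" "finite U" "finite W" "T \<inter> U = {}"
  shows "inversions (T \<union> U) W = inversions T W + inversions U W"
proof -
  have "{(t, u). t \<in> T \<union> U \<and> u \<in> W \<and> gen_less u t} =
      {(t, u). t \<in> T \<and> u \<in> W \<and> gen_less u t} \<union> {(t, u). t \<in> U \<and> u \<in> W \<and> gen_less u t}"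
    by auto
  moreover have "{(t, u). t \<in> T \<and> u \<in> W \<and> gen_less u t} \<inter> {(t, u). t \<in> U \<and> u \<in> W \<and> gen_less u t} = {}"
    using assms(4) by auto
  ultimately show ?thesis
    unfolding inversions_def using assms by (simp add: card_Un_disjoint finite_inversions)
qed

lemma inversions_Un_right:
  assumes "finite T" "finite U" "finite W" "T \<inter> U = {}"
  shows "inversions W (T \<union> U) = inversions W T + inversions W U"
proof -
  have "{(t, u). t \<in> W \<and> u \<in> T \<union> U \<and> gen_less u t} =
      {(t, u). t \<in> W \<and> u \<in> T \<and> gen_less u t} \<union> {(t, u). t \<in> W \<and> u \<in> U \<and> gen_less u t}"
    by auto
  moreover have "{(t, u). t \<in> W \<and> u \<in> T \<and> gen_less u t} \<inter> {(t, u). t \<in> W \<and> u \<in> U \<and> gen_less u t} = {}"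
    using assms(4) by auto
  ultimately show ?thesis
    unfolding inversions_def using assms by (simp add: card_Un_disjoint finite_inversions)
qed

lemma inversions_empty [simp]: "inversions {} U = 0" "inversions T {} = 0"
  by (simp_all add: inversions_def)

lemma inversions_singleton_left: "inversions {l} U = below U l"
  unfolding inversions_def below_def
  by (rule bij_betw_same_card[of snd]) (auto simp: bij_betw_def inj_on_def image_iff)

lemma inversions_singleton_right:
  assumes "finite T" "l \<notin> T"
  shows "inversions T {l} + below T l = card T"
proof -
  have "inversions T {l} = card {t \<in> T. gen_less l t}"
    unfolding inversions_def
    by (rule bij_betw_same_card[of fst]) (auto simp: bij_betw_def inj_on_def image_iff)
  moreover have "T = {t \<in> T. gen_less l t} \<union> {t \<in> T. gen_less t l}"
    using gen_less_linear[of _ l] assms(2) by fastforce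
  moreover have "{t \<in> T. gen_less l t} \<inter> {t \<in> T. gen_less t l} = {}"
    using gen_less_asym[of l] by fastforce
  then have "card ({t \<in> T. gen_less l t} \<union> {t \<in> T. gen_less t l}) =
      card {t \<in> T. gen_less l t} + card {t \<in> T. gen_less t l}"
    using assms(1) by (intro card_Un_disjoint) auto
  ultimately show ?thesis by (simp add: below_def)
qed


section \<open>The exterior algebra as a ring\<close>

lemma carrier_ext_alg:
  "f \<in> carrier (ext_alg A) \<longleftrightarrow> finite {S. f S \<noteq> 0} \<and> (\<forall>S. f S \<noteq> 0 \<longrightarrow> finite S \<and> S \<subseteq> A)"
  by (simp add: ext_alg_def)

lemma ext_alg_simps:
  "f \<oplus>\<^bsub>ext_alg A\<^esub> g = f + g" "\<zero>\<^bsub>ext_alg A\<^esub> = 0"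
  by (simp_all add: ext_alg_def plus_fun_def zero_fun_def)

text \<open>The product of \<open>ext_alg A\<close> does not mention \<open>A\<close>. With a name
  of its own, its identities are proved once for all sets of generators.\<close>

definition wedge :: "('l set \<Rightarrow> 'r::{comm_ring, comm_monoid_mult}) \<Rightarrow> ('l set \<Rightarrow> 'r) \<Rightarrow> 'l set \<Rightarrow> 'r" where
  "wedge f g S = (\<Sum>T\<in>Pow S. signed (inversions T (S - T)) (f T * g (S - T)))"

lemma mult_ext_alg [simp]: "f \<otimes>\<^bsub>ext_alg A\<^esub> g = wedge f g"
  by (simp add: ext_alg_def wedge_def fun_eq_iff)

definition ext_mon :: "'l set \<Rightarrow> 'r::zero \<Rightarrow> 'l set \<Rightarrow> 'r" where
  "ext_mon S r = (\<lambda>T. if T = S then r else 0)"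

lemma one_ext_alg [simp]: "\<one>\<^bsub>ext_alg A\<^esub> = ext_mon {} 1"
  by (auto simp: ext_alg_def ext_mon_def fun_eq_iff)

lemma ext_mon_0 [simp]: "ext_mon S 0 = 0"
  by (simp add: ext_mon_def fun_eq_iff)

lemma ext_mon_in_carrier: "finite S \<Longrightarrow> S \<subseteq> A \<Longrightarrow> ext_mon S r \<in> carrier (ext_alg A)"
  by (auto simp: carrier_ext_alg ext_mon_def intro: finite_subset[of _ "{S}"])

text \<open>The side condition \<open>f S = 0\<close> keeps the supports disjoint, so a condition on
  the support of \<open>ext_mon S r + f\<close> is inherited by both summands.\<close>

lemma carrier_ext_alg_induct [consumes 1, case_names zero add]:
  assumes "f \<in> carrier (ext_alg A)"
    and "P 0"
    and "\<And>S r f. \<lbrakk>finite S; S \<subseteq> A; r \<noteq> 0; f S = 0; f \<in> carrier (ext_alg A); P f\<rbrakk> \<Longrightarrow> P (ext_mon S r + f)"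
  shows "P f"
proof -
  have "finite X \<Longrightarrow> f \<in> carrier (ext_alg A) \<Longrightarrow> {S. f S \<noteq> 0} = X \<Longrightarrow> P f" for X
  proof (induction X arbitrary: f rule: finite_induct)
    case empty
    then have "f = 0" by (auto simp: fun_eq_iff)
    then show ?case using assms(2) by metis
  next
    case (insert S X)
    define g where "g = (\<lambda>T. if T = S then 0 else f T)"
    have f: "f = ext_mon S (f S) + g" by (auto simp: g_def ext_mon_def fun_eq_iff)
    have supp: "{T. g T \<noteq> 0} = X" using insert.prems(2) insert.hyps(2) by (auto simp: g_def)
    have g: "g \<in> carrier (ext_alg A)"
      using insert.prems(1) insert.hyps(1) supp by (auto simp: carrier_ext_alg g_def)
    have "f S \<noteq> 0" using insert.prems(2) by auto
    moreover then have "finite S" "S \<subseteq> A" using insert.prems(1) by (auto simp: carrier_ext_alg)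
    ultimately show ?case using assms(3)[of S "f S" g] insert.IH[OF g supp] g f by (simp add: g_def)
  qed
  then show ?thesis using assms(1) by (auto simp: carrier_ext_alg)
qed

lemma add_in_carrier:
  assumes "f \<in> carrier (ext_alg A)" "g \<in> carrier (ext_alg A)"
  shows "f + g \<in> carrier (ext_alg A)"
proof -
  have "{S. (f + g) S \<noteq> 0} \<subseteq> {S. f S \<noteq> 0} \<union> {S. g S \<noteq> 0}" by auto
  then have "finite {S. (f + g) S \<noteq> 0}"
    by (rule finite_subset) (use assms in \<open>auto simp: carrier_ext_alg\<close>)
  moreover have "f S \<noteq> 0 \<or> g S \<noteq> 0" if "(f + g) S \<noteq> 0" for S
    using that by auto
  ultimately show ?thesis using assms unfolding carrier_ext_alg by blast
qed

lemma uminus_in_carrier: "f \<in> carrier (ext_alg A) \<Longrightarrow> - f \<in> carrier (ext_alg A)"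
  by (simp add: carrier_ext_alg)

lemma diff_in_carrier:
  "f \<in> carrier (ext_alg A) \<Longrightarrow> g \<in> carrier (ext_alg A) \<Longrightarrow> f - g \<in> carrier (ext_alg A)"
  using add_in_carrier[of f A "- g"] uminus_in_carrier[of g A] by simp

lemma zero_in_carrier: "0 \<in> carrier (ext_alg A)"
  by (simp add: carrier_ext_alg)

lemma wedge_nonzeroD:
  assumes "wedge f g S \<noteq> 0"
  obtains T where "T \<subseteq> S" "f T \<noteq> 0" "g (S - T) \<noteq> 0"
proof -
  obtain T where T: "T \<in> Pow S" and "signed (inversions T (S - T)) (f T * g (S - T)) \<noteq> 0"
    using assms unfolding wedge_def by (meson sum.not_neutral_contains_not_neutral)
  then have "f T * g (S - T) \<noteq> 0" by simp
  then have "f T \<noteq> 0" "g (S - T) \<noteq> 0" by auto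
  with T that show thesis by blast
qed

lemma wedge_in_carrier:
  assumes f: "f \<in> carrier (ext_alg A)" and g: "g \<in> carrier (ext_alg A)"
  shows "wedge f g \<in> carrier (ext_alg A)"
proof -
  have "{S. wedge f g S \<noteq> 0} \<subseteq> (\<lambda>(T, U). T \<union> U) ` ({S. f S \<noteq> 0} \<times> {S. g S \<noteq> 0})"
  proof
    fix S assume "S \<in> {S. wedge f g S \<noteq> 0}"
    then obtain T where "T \<subseteq> S" "f T \<noteq> 0" "g (S - T) \<noteq> 0" using wedge_nonzeroD by blast
    then show "S \<in> (\<lambda>(T, U). T \<union> U) ` ({S. f S \<noteq> 0} \<times> {S. g S \<noteq> 0})"
      by (intro image_eqI[of _ _ "(T, S - T)"]) auto
  qed
  then have "finite {S. wedge f g S \<noteq> 0}"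
    by (rule finite_subset) (use f g in \<open>auto simp: carrier_ext_alg\<close>)
  moreover have "finite S \<and> S \<subseteq> A" if S: "wedge f g S \<noteq> 0" for S
  proof -
    obtain T where T: "T \<subseteq> S" "f T \<noteq> 0" "g (S - T) \<noteq> 0" using S wedge_nonzeroD by blast
    then have "finite T \<and> T \<subseteq> A" "finite (S - T) \<and> S - T \<subseteq> A"
      using f g by (auto simp: carrier_ext_alg)
    then show ?thesis using T(1) by auto
  qed
  ultimately show ?thesis by (simp add: carrier_ext_alg)
qed

lemma wedge_add_left: "wedge (f + g) h = wedge f h + wedge g h"
  by (simp add: wedge_def fun_eq_iff distrib_right signed_add sum.distrib)

lemma wedge_add_right: "wedge h (f + g) = wedge h f + wedge h g"
  by (simp add: wedge_def fun_eq_iff distrib_left signed_add sum.distrib)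

lemma wedge_infinite: "infinite S \<Longrightarrow> wedge f g S = 0"
  by (simp add: wedge_def)

lemma diff_left_of_subset: "U \<subseteq> T \<Longrightarrow> S - U - (T - U) = S - T"
  by blast

text \<open>Both sides sum over the ways to cut \<open>S\<close> into three blocks, with the
  inversions between the blocks as sign; the nested sums differ only in which cut is made
  first.\<close>

lemma wedge_assoc: "wedge (wedge f g) h = wedge f (wedge g h)"
proof
  fix S :: "'a set"
  show "wedge (wedge f g) h S = wedge f (wedge g h) S"
  proof (cases "finite S")
    case False
    then show ?thesis by (simp add: wedge_infinite)
  next
    case True
    let ?F = "\<lambda>U V W. signed (inversions U V + inversions U W + inversions V W) (f U * g V * h W)"
    have "wedge (wedge f g) h S = (\<Sum>T\<in>Pow S. \<Sum>U\<in>Pow T. ?F U (T - U) (S - T))"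
      unfolding wedge_def sum_distrib_right signed_sum
    proof (intro sum.cong refl)
      fix T U assume "T \<in> Pow S" "U \<in> Pow T"
      then have "inversions T (S - T) = inversions U (S - T) + inversions (T - U) (S - T)"
        using inversions_Un_left[of U "T - U" "S - T"] True
        by (auto simp: Un_absorb1 dest: finite_subset)
      then show "signed (inversions T (S - T)) (signed (inversions U (T - U)) (f U * g (T - U)) * h (S - T)) =
          ?F U (T - U) (S - T)"
        by (simp add: signed_mult_left add_ac)
    qed
    also have "\<dots> = (\<Sum>(T, U)\<in>Sigma (Pow S) Pow. ?F U (T - U) (S - T))"
      by (rule sum.Sigma) (use True in \<open>auto dest: finite_subset\<close>)
    also have "\<dots> = (\<Sum>(U, V)\<in>(SIGMA U:Pow S. Pow (S - U)). ?F U V (S - U - V))"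
      by (rule sum.reindex_bij_witness[of _ "\<lambda>(U, V). (U \<union> V, U)" "\<lambda>(T, U). (U, T - U)"])
         (auto simp: diff_left_of_subset Un_absorb1 Diff_subset_conv)
    also have "\<dots> = (\<Sum>U\<in>Pow S. \<Sum>V\<in>Pow (S - U). ?F U V (S - U - V))"
      by (rule sum.Sigma[symmetric]) (use True in auto)
    also have "\<dots> = wedge f (wedge g h) S"
      unfolding wedge_def sum_distrib_left signed_sum
    proof (intro sum.cong refl)
      fix U V assume "U \<in> Pow S" "V \<in> Pow (S - U)"
      then have "inversions U (S - U) = inversions U V + inversions U (S - U - V)"
        using inversions_Un_right[of V "S - U - V" U] True
        by (auto simp: Un_absorb1 dest: finite_subset)
      then show "?F U V (S - U - V) =
          signed (inversions U (S - U)) (f U * signed (inversions V (S - U - V)) (g V * h (S - U - V)))"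
        by (simp add: signed_mult_right add_ac mult.assoc)
    qed
    finally show ?thesis .
  qed
qed

lemma wedge_ext_mon:
  assumes "finite T" "finite U"
  shows "wedge (ext_mon T r) (ext_mon U s) =
    (if T \<inter> U = {} then ext_mon (T \<union> U) (signed (inversions T U) (r * s)) else 0)"
proof
  fix S :: "'a set"
  have "wedge (ext_mon T r) (ext_mon U s) S =
      (\<Sum>T'\<in>Pow S. if T' = T then (if S - T = U then signed (inversions T U) (r * s) else 0) else 0)"
    unfolding wedge_def by (intro sum.cong) (auto simp: ext_mon_def)
  also have "\<dots> = (if finite S \<and> T \<subseteq> S \<and> S - T = U then signed (inversions T U) (r * s) else 0)"
    by (cases "finite S") auto
  also have "\<dots> = (if T \<inter> U = {} then ext_mon (T \<union> U) (signed (inversions T U) (r * s)) else 0) S"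
    using assms by (auto simp: ext_mon_def)
  finally show "wedge (ext_mon T r) (ext_mon U s) S =
      (if T \<inter> U = {} then ext_mon (T \<union> U) (signed (inversions T U) (r * s)) else 0) S" .
qed

lemma wedge_unit_left:
  assumes "f \<in> carrier (ext_alg A)" shows "wedge (ext_mon {} 1) f = f"
proof
  fix S
  have "wedge (ext_mon {} 1) f S = (\<Sum>T\<in>Pow S. if T = {} then f S else 0)"
    unfolding wedge_def by (intro sum.cong) (auto simp: ext_mon_def)
  then show "wedge (ext_mon {} 1) f S = f S"
    using assms by (cases "finite S") (auto simp: carrier_ext_alg)
qed

lemma wedge_unit_right:
  assumes "f \<in> carrier (ext_alg A)" shows "wedge f (ext_mon {} 1) = f"
proof
  fix S
  have "wedge f (ext_mon {} 1) S = (\<Sum>T\<in>Pow S. if T = S then f S else 0)"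
    unfolding wedge_def by (intro sum.cong) (auto simp: ext_mon_def)
  then show "wedge f (ext_mon {} 1) S = f S"
    using assms by (cases "finite S") (auto simp: carrier_ext_alg)
qed

lemma ring_ext_alg: "ring (ext_alg A :: ('l set \<Rightarrow> 'r::{comm_ring, comm_monoid_mult}) ring)"
  (is "ring ?E")
proof (rule ringI)
  show "abelian_group ?E"
  proof (rule abelian_groupI)
    fix f assume "f \<in> carrier ?E"
    then show "\<exists>g\<in>carrier ?E. g \<oplus>\<^bsub>?E\<^esub> f = \<zero>\<^bsub>?E\<^esub>"
      by (intro bexI[of _ "- f"]) (simp_all add: ext_alg_simps uminus_in_carrier)
  qed (simp_all only: ext_alg_simps add_in_carrier zero_in_carrier add_0_left, (simp only: ac_simps)+)
  show "Group.monoid ?E"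
    by (rule monoidI)
       (simp_all add: wedge_in_carrier wedge_assoc wedge_unit_left wedge_unit_right ext_mon_in_carrier)
qed (simp_all only: ext_alg_simps mult_ext_alg wedge_add_left wedge_add_right)

section \<open>Contractions\<close>

text \<open>The derivation with \<open>e\<^sub>l \<mapsto> 1\<close> for \<open>l \<in> H\<close> and \<open>e\<^sub>l \<mapsto> 0\<close> for \<open>l \<notin> H\<close>.\<close>

definition contr :: "'l set \<Rightarrow> ('l set \<Rightarrow> 'r::{comm_ring, comm_monoid_mult}) \<Rightarrow> 'l set \<Rightarrow> 'r" where
  "contr H f S = (\<Sum>l | l \<in> H \<and> l \<notin> S \<and> f (insert l S) \<noteq> 0. signed (below S l) (f (insert l S)))"

lemma ext_der_contr: "ext_der = contr UNIV"
  by (simp add: ext_der_def contr_def below_def fun_eq_iff)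

definition gens_of :: "('l set \<Rightarrow> 'r::zero) \<Rightarrow> 'l set" where
  "gens_of f = \<Union>{S. f S \<noteq> 0}"

lemma finite_gens_of: "f \<in> carrier (ext_alg A) \<Longrightarrow> finite (gens_of f)"
  unfolding gens_of_def by (intro finite_Union) (auto simp: carrier_ext_alg)

text \<open>The index set in \<open>contr\<close> varies with \<open>f\<close> and \<open>S\<close>.
  A fixed finite set containing all generators that occur makes sums for different arguments
  comparable term by term.\<close>

lemma contr_eq_sum:
  assumes "finite Z" "gens_of f \<subseteq> Z"
  shows "contr H f S = (\<Sum>l\<in>Z. if l \<in> H \<and> l \<notin> S then signed (below S l) (f (insert l S)) else 0)"
  unfolding contr_def
  by (rule sum.mono_neutral_cong_left) (use assms in \<open>auto simp: gens_of_def\<close>)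

lemma contr_nonzeroD:
  assumes "contr H f S \<noteq> 0"
  obtains l where "l \<in> H" "l \<notin> S" "f (insert l S) \<noteq> 0"
proof -
  have "{l \<in> H. l \<notin> S \<and> f (insert l S) \<noteq> 0} \<noteq> {}"
    using assms unfolding contr_def by (metis (no_types) sum.empty)
  with that show thesis by blast
qed

lemma contr_in_carrier:
  assumes f: "f \<in> carrier (ext_alg A)"
  shows "contr H f \<in> carrier (ext_alg A)"
proof -
  have sub: "S \<subseteq> gens_of f \<and> finite S \<and> S \<subseteq> A" if "contr H f S \<noteq> 0" for S
  proof -
    obtain l where "f (insert l S) \<noteq> 0" using \<open>contr H f S \<noteq> 0\<close> by (rule contr_nonzeroD)
    then show ?thesis using f by (auto simp: carrier_ext_alg gens_of_def)
  qed
  have "finite {S. contr H f S \<noteq> 0}"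
    by (rule finite_subset[of _ "Pow (gens_of f)"]) (use sub finite_gens_of[OF f] in auto)
  then show ?thesis using sub by (simp add: carrier_ext_alg)
qed

lemma contr_0 [simp]: "contr H 0 = 0"
  by (simp add: contr_def fun_eq_iff)

lemma contr_uminus: "contr H (- f) = - contr H f"
  by (simp add: contr_def fun_eq_iff signed_minus sum_negf)

lemma contr_signed: "contr H (signed n f) = signed n (contr H f)"
  by (simp add: signed_def contr_uminus)

lemma contr_add:
  assumes "f \<in> carrier (ext_alg A)" "g \<in> carrier (ext_alg A)"
  shows "contr H (f + g) = contr H f + contr H g"
proof
  fix S
  let ?Z = "gens_of f \<union> gens_of g"
  have "finite ?Z" using assms finite_gens_of by blast
  moreover have "gens_of (f + g) \<subseteq> ?Z"
    unfolding gens_of_def by (auto, metis add.right_neutral)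
  ultimately show "contr H (f + g) S = (contr H f + contr H g) S"
    unfolding plus_fun_apply
    by (simp only: contr_eq_sum[of ?Z] Un_upper1 Un_upper2 sum.distrib[symmetric])
       (intro sum.cong refl, simp add: signed_add)
qed

lemma sum_in_carrier:
  "(\<And>i. i \<in> I \<Longrightarrow> f i \<in> carrier (ext_alg A)) \<Longrightarrow> (\<Sum>i\<in>I. f i) \<in> carrier (ext_alg A)"
  by (induction I rule: infinite_finite_induct) (auto simp: zero_in_carrier intro!: add_in_carrier)

lemma contr_sum:
  "(\<And>i. i \<in> I \<Longrightarrow> f i \<in> carrier (ext_alg A)) \<Longrightarrow> contr H (\<Sum>i\<in>I. f i) = (\<Sum>i\<in>I. contr H (f i))"
proof (induction I rule: infinite_finite_induct)
  case (insert x F)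
  then have "contr H (f x + sum f F) = contr H (f x) + contr H (sum f F)"
    by (intro contr_add[of _ A] sum_in_carrier) auto
  with insert show ?case by (simp only: sum.insert insert_iff simp_thms)
qed auto

lemma signed_in_carrier: "f \<in> carrier (ext_alg A) \<Longrightarrow> signed n f \<in> carrier (ext_alg A)"
  by (simp add: signed_def uminus_in_carrier)

text \<open>The exponent is symmetric in \<open>l\<close> and \<open>m\<close> up to the summand for
  \<open>gen_less l m\<close>, so exchanging the two lines reverses the sign of each term.\<close>

lemma contr_contr_eq_sum:
  assumes f: "f \<in> carrier (ext_alg A)" and S: "finite S"
  shows "contr H (contr G f) S =
    (\<Sum>l\<in>gens_of f. \<Sum>m\<in>gens_of f. if l \<in> H \<and> m \<in> G \<and> l \<noteq> m \<and> l \<notin> S \<and> m \<notin> S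
      then signed (below S l + below S m + (if gen_less l m then 1 else 0)) (f (insert l (insert m S))) else 0)"
proof -
  have fin: "finite (gens_of f)" using f by (rule finite_gens_of)
  have sub: "gens_of (contr G f) \<subseteq> gens_of f"
    unfolding gens_of_def by (auto elim!: contr_nonzeroD)
  show ?thesis
    unfolding contr_eq_sum[OF fin sub]
  proof (intro sum.cong refl)
    fix l assume "l \<in> gens_of f"
    show "(if l \<in> H \<and> l \<notin> S then signed (below S l) (contr G f (insert l S)) else 0) =
      (\<Sum>m\<in>gens_of f. if l \<in> H \<and> m \<in> G \<and> l \<noteq> m \<and> l \<notin> S \<and> m \<notin> S
      then signed (below S l + below S m + (if gen_less l m then 1 else 0)) (f (insert l (insert m S))) else 0)"
    proof (cases "l \<in> H \<and> l \<notin> S")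
      case True
      then have "below (insert l S) m = below S m + (if gen_less l m then 1 else 0)" for m
        using below_insert[OF S, of l m] by simp
      with True show ?thesis
        unfolding contr_eq_sum[OF fin subset_refl] if_P[OF True] signed_sum
        by (intro sum.cong refl) (auto simp: insert_commute add.assoc)
    next
      case False
      then show ?thesis by (auto intro!: sum.neutral[symmetric])
    qed
  qed
qed

lemma contr_infinite: "f \<in> carrier (ext_alg A) \<Longrightarrow> infinite S \<Longrightarrow> contr H f S = 0"
  using contr_in_carrier[of f A H] by (auto simp: carrier_ext_alg)

lemma contr_anticommute:
  assumes f: "f \<in> carrier (ext_alg A)"
  shows "contr H (contr G f) = - contr G (contr H f)"
proof
  fix S
  show "contr H (contr G f) S = (- contr G (contr H f)) S"
  proof (cases "finite S")
    case True
    have swap: "signed (below S l + below S m + (if gen_less l m then 1 else 0)) x =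
        - signed (below S m + below S l + (if gen_less m l then 1 else 0)) x" if "l \<noteq> m" for l m and x :: 'b
      by (rule signed_opposite_parity) (use gen_less_linear[OF that] gen_less_asym[of l m] in auto)
    show ?thesis
      unfolding uminus_apply contr_contr_eq_sum[OF f True]
      by (subst sum.swap, unfold sum_negf[symmetric], intro sum.cong refl)
         (auto simp: insert_commute swap[symmetric] simp del: One_nat_def)
  next
    case False
    then show ?thesis using f by (simp add: contr_infinite[of _ A] contr_in_carrier)
  qed
qed

text \<open>Anticommutation only gives twice the claim, and R may have 2-torsion. The antisymmetric
  double sum is therefore cut into halves by the total order, and the halves cancel.\<close>

lemma contr_contr_same:
  assumes f: "f \<in> carrier (ext_alg A)"
  shows "contr H (contr H f) = 0"
proof
  fix S
  show "contr H (contr H f) S = 0 S"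
  proof (cases "finite S")
    case True
    let ?Z = "gens_of f"
    let ?g = "\<lambda>l m. if l \<in> H \<and> m \<in> H \<and> l \<noteq> m \<and> l \<notin> S \<and> m \<notin> S
      then signed (below S l + below S m + (if gen_less l m then 1 else 0)) (f (insert l (insert m S))) else 0"
    have anti: "?g m l = - ?g l m" for l m
    proof (cases "l = m")
      case False
      then show ?thesis using gen_less_linear[OF False] gen_less_asym[of l m]
        by (auto simp: insert_commute add.commute signed_Suc)
    qed simp
    have split: "?g l m = (if gen_less l m then ?g l m else 0) + (if gen_less m l then ?g l m else 0)" for l m
    proof (cases "l = m")
      case False
      then consider "gen_less l m" "\<not> gen_less m l" | "gen_less m l" "\<not> gen_less l m"
        using gen_less_linear[OF False] gen_less_asym[of l m] by blast
      then show ?thesis by cases simp_all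
    qed simp
    have swap: "(if gen_less l m then ?g m l else 0) = - (if gen_less l m then ?g l m else 0)" for l m
      by (subst anti) simp
    have "contr H (contr H f) S = (\<Sum>l\<in>?Z. \<Sum>m\<in>?Z. ?g l m)"
      by (rule contr_contr_eq_sum[OF f True])
    also have "\<dots> = (\<Sum>l\<in>?Z. \<Sum>m\<in>?Z. (if gen_less l m then ?g l m else 0)) +
        (\<Sum>l\<in>?Z. \<Sum>m\<in>?Z. (if gen_less m l then ?g l m else 0))"
      unfolding sum.distrib[symmetric] by (intro sum.cong refl) (rule split)
    also have "(\<Sum>l\<in>?Z. \<Sum>m\<in>?Z. (if gen_less m l then ?g l m else 0)) =
        (\<Sum>l\<in>?Z. \<Sum>m\<in>?Z. - (if gen_less l m then ?g l m else 0))"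
      by (subst sum.swap, intro sum.cong refl) (rule swap)
    finally show ?thesis by (simp add: sum_negf)
  next
    case False
    then show ?thesis using f by (simp add: contr_infinite[of _ A] contr_in_carrier)
  qed
qed

lemma contr_disjoint_Un:
  assumes f: "f \<in> carrier (ext_alg A)" and "H \<inter> G = {}"
  shows "contr (H \<union> G) f = contr H f + contr G f"
proof
  fix S
  show "contr (H \<union> G) f S = (contr H f + contr G f) S"
    unfolding plus_fun_apply contr_eq_sum[OF finite_gens_of[OF f] subset_refl] sum.distrib[symmetric]
    by (intro sum.cong refl) (use assms(2) in auto)
qed

lemma contr_empty [simp]: "contr {} f = 0"
  by (simp add: contr_def fun_eq_iff)

lemma contr_disjoint_UNION:
  assumes f: "f \<in> carrier (ext_alg A)"
  shows "finite I \<Longrightarrow> disjoint_family_on H I \<Longrightarrow> contr (\<Union>i\<in>I. H i) f = (\<Sum>i\<in>I. contr (H i) f)"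
proof (induction I rule: finite_induct)
  case (insert i I)
  then have "H i \<inter> (\<Union>i\<in>I. H i) = {}" by (auto simp: disjoint_family_on_def)
  then have "contr (H i \<union> (\<Union>i\<in>I. H i)) f = contr (H i) f + contr (\<Union>i\<in>I. H i) f"
    by (rule contr_disjoint_Un[OF f])
  moreover have "disjoint_family_on H I" using insert by (auto simp: disjoint_family_on_def)
  ultimately show ?case using insert by simp
qed simp


section \<open>The derivation and products with generators\<close>

lemma wedge_gen_left:
  "wedge (ext_mon {l} 1) g S = (if finite S \<and> l \<in> S then signed (below S l) (g (S - {l})) else 0)"
proof -
  have "wedge (ext_mon {l} 1) g S = (\<Sum>T\<in>Pow S. if T = {l} then signed (below S l) (g (S - {l})) else 0)"
    unfolding wedge_def
  proof (intro sum.cong refl)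
    fix T assume "T \<in> Pow S"
    have "below (S - {l}) l = below S l"
      unfolding below_def by (rule arg_cong[where f = card]) auto
    then show "signed (inversions T (S - T)) (ext_mon {l} 1 T * g (S - T)) =
        (if T = {l} then signed (below S l) (g (S - {l})) else 0)"
      by (simp add: ext_mon_def inversions_singleton_left)
  qed
  then show ?thesis by (cases "finite S") auto
qed

text \<open>The grading involution. It turns right multiplication by a generator into left
  multiplication, so that two-sided ideals need only be checked from the left.\<close>

definition grade_inv :: "('l set \<Rightarrow> 'r::ab_group_add) \<Rightarrow> 'l set \<Rightarrow> 'r" where
  "grade_inv f S = signed (card S) (f S)"

lemma grade_inv_in_carrier: "f \<in> carrier (ext_alg A) \<Longrightarrow> grade_inv f \<in> carrier (ext_alg A)"
  by (simp add: carrier_ext_alg grade_inv_def)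

lemma grade_inv_add: "grade_inv (f + g) = grade_inv f + grade_inv g"
  by (simp add: grade_inv_def fun_eq_iff signed_add)

lemma wedge_gen_right:
  "wedge g (ext_mon {l} 1) = wedge (ext_mon {l} 1) (grade_inv g)"
proof
  fix S
  have "wedge g (ext_mon {l} 1) S =
      (\<Sum>T\<in>Pow S. if T = S - {l} then (if l \<in> S then signed (inversions (S - {l}) {l}) (g (S - {l})) else 0) else 0)"
    unfolding wedge_def
  proof (intro sum.cong refl)
    fix T assume T: "T \<in> Pow S"
    then have "S - T = {l} \<longleftrightarrow> l \<in> S \<and> T = S - {l}" by blast
    then show "signed (inversions T (S - T)) (g T * ext_mon {l} 1 (S - T)) =
        (if T = S - {l} then (if l \<in> S then signed (inversions (S - {l}) {l}) (g (S - {l})) else 0) else 0)"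
      by (auto simp: ext_mon_def)
  qed
  also have "\<dots> = (if finite S \<and> l \<in> S then signed (inversions (S - {l}) {l}) (g (S - {l})) else 0)"
    by (cases "finite S") auto
  also have "\<dots> = wedge (ext_mon {l} 1) (grade_inv g) S"
  proof (cases "finite S \<and> l \<in> S")
    case True
    have "below (S - {l}) l = below S l"
      unfolding below_def by (rule arg_cong[where f = card]) auto
    moreover have "inversions (S - {l}) {l} + below (S - {l}) l = card (S - {l})"
      using True by (intro inversions_singleton_right) auto
    ultimately have "inversions (S - {l}) {l} + below S l = card (S - {l})" by simp
    then have "even (inversions (S - {l}) {l}) = even (below S l + card (S - {l}))"
      by presburger
    then show ?thesis
      unfolding wedge_gen_left grade_inv_def signed_signed if_P[OF True] by (intro signed_cong_parity)
  qed (auto simp: wedge_gen_left)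
  finally show "wedge g (ext_mon {l} 1) S = wedge (ext_mon {l} 1) (grade_inv g) S" .
qed

text \<open>The Leibniz rule for a generator on the left, the form in which the derivation property
  of \<open>ext_der\<close> enters.\<close>

lemma ext_der_gen_wedge:
  assumes g: "g \<in> carrier (ext_alg A)"
  shows "ext_der (wedge (ext_mon {l} 1) g) = g - wedge (ext_mon {l} 1) (ext_der g)"
proof
  fix S
  let ?h = "wedge (ext_mon {l} 1) g"
  have h: "?h \<in> carrier (ext_alg (insert l A))"
    using g by (intro wedge_in_carrier ext_mon_in_carrier) (auto simp: carrier_ext_alg)
  show "ext_der ?h S = (g - wedge (ext_mon {l} 1) (ext_der g)) S"
  proof (cases "finite S")
    case False
    then show ?thesis using h g
      by (simp add: ext_der_contr contr_infinite[of _ "insert l A"] wedge_gen_left carrier_ext_alg) blast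
  next
    case S: True
    let ?Z = "insert l (gens_of g)"
    have fin: "finite ?Z" using finite_gens_of[OF g] by simp
    have sub: "gens_of ?h \<subseteq> ?Z"
      by (auto simp: gens_of_def wedge_gen_left split: if_splits)
    have lhs: "ext_der ?h S = (\<Sum>m\<in>?Z. if m \<notin> S then signed (below S m) (?h (insert m S)) else 0)"
      by (simp only: ext_der_contr contr_eq_sum[OF fin sub] UNIV_I simp_thms)
    show ?thesis
    proof (cases "l \<in> S")
      case False
      \<comment> \<open>As \<open>l\<close> is not in \<open>S\<close>, the set
        \<open>insert m S\<close> contains \<open>l\<close> only for \<open>m = l\<close>.\<close>
      have "(\<Sum>m\<in>?Z. if m \<notin> S then signed (below S m) (?h (insert m S)) else 0) = (\<Sum>m\<in>?Z. if m = l then g S else 0)"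
        by (intro sum.cong refl) (use False S in \<open>auto simp: wedge_gen_left\<close>)
      then show ?thesis using fin False lhs by (simp add: wedge_gen_left)
    next
      case True
      define U where "U = S - {l}"
      have U: "S = insert l U" "l \<notin> U" "finite U" using True S by (auto simp: U_def)
      \<comment> \<open>The summand \<open>m = l\<close> is zero on the left and
        \<open>g S - g S\<close> on the right; this is where the term \<open>g S\<close> comes
        from.\<close>
      have "(\<Sum>m\<in>?Z. if m \<notin> S then signed (below S m) (?h (insert m S)) else 0) =
          (\<Sum>m\<in>?Z. (if m = l then g S else 0) -
            signed (below S l) (if m \<notin> U then signed (below U m) (g (insert m U)) else 0))"
      proof (intro sum.cong refl)
        fix m assume "m \<in> ?Z"
        show "(if m \<notin> S then signed (below S m) (?h (insert m S)) else 0) =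
          (if m = l then g S else 0) - signed (below S l) (if m \<notin> U then signed (below U m) (g (insert m U)) else 0)"
        proof (cases "m = l \<or> m \<in> U")
          case True
          then show ?thesis using U by auto
        next
          case False
          then have "insert m S - {l} = insert m U" using U by auto
          moreover have "signed (below S m + below (insert m S) l) x = - signed (below S l + below U m) x" for x :: 'b
          proof (rule signed_opposite_parity)
            have "below S m = below U m + (if gen_less l m then 1 else 0)"
              using U below_insert by metis
            moreover have "below (insert m S) l = below S l + (if gen_less m l then 1 else 0)"
              using U False S by (intro below_insert) auto
            ultimately show "even (below S m + below (insert m S) l) \<noteq> even (below S l + below U m)"
              using gen_less_linear[of l m] gen_less_asym[of l m] False by auto
          qed
          ultimately show ?thesis using False U by (simp add: wedge_gen_left)
        qed
      qed
      also have "\<dots> = g S - signed (below S l) (ext_der g U)"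
        using fin contr_eq_sum[OF fin, of g UNIV U]
        by (simp add: sum_subtractf ext_der_contr signed_sum[symmetric] subset_insertI)
      finally show ?thesis using lhs True S by (simp add: wedge_gen_left U_def)
    qed
  qed
qed

section \<open>Ideals spanned by dependent monomials and their boundaries\<close>

definition scal :: "'r::{comm_ring, comm_monoid_mult} \<Rightarrow> ('l set \<Rightarrow> 'r) \<Rightarrow> 'l set \<Rightarrow> 'r" where
  "scal r f = (\<lambda>S. r * f S)"

lemma wedge_scalar_left: "f \<in> carrier (ext_alg A) \<Longrightarrow> wedge (ext_mon {} r) f = scal r f"
proof
  fix S assume f: "f \<in> carrier (ext_alg A)"
  have "wedge (ext_mon {} r) f S = (\<Sum>T\<in>Pow S. if T = {} then r * f S else 0)"
    unfolding wedge_def by (intro sum.cong) (auto simp: ext_mon_def)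
  then show "wedge (ext_mon {} r) f S = scal r f S"
    using f by (cases "finite S") (auto simp: carrier_ext_alg scal_def, metis mult_zero_right)
qed

lemma wedge_scalar_right: "f \<in> carrier (ext_alg A) \<Longrightarrow> wedge f (ext_mon {} r) = scal r f"
proof
  fix S assume f: "f \<in> carrier (ext_alg A)"
  have "wedge f (ext_mon {} r) S = (\<Sum>T\<in>Pow S. if T = S then r * f S else 0)"
    unfolding wedge_def by (intro sum.cong) (auto simp: ext_mon_def mult.commute)
  then show "wedge f (ext_mon {} r) S = scal r f S"
    using f by (cases "finite S") (auto simp: carrier_ext_alg scal_def, metis mult_zero_right)
qed

lemma scal_in_carrier: "f \<in> carrier (ext_alg A) \<Longrightarrow> scal r f \<in> carrier (ext_alg A)"
  using wedge_in_carrier[of "ext_mon {} r" A f] ext_mon_in_carrier[of "{}" A r]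
  by (simp add: wedge_scalar_left)

lemma scal_add: "scal r (f + g) = scal r f + scal r g"
  by (simp add: scal_def fun_eq_iff distrib_left)

lemma contr_scal:
  assumes f: "f \<in> carrier (ext_alg A)"
  shows "contr H (scal r f) = scal r (contr H f)"
proof
  fix S
  have "gens_of (scal r f) \<subseteq> gens_of f"
    unfolding gens_of_def scal_def by (intro Union_mono) auto
  then show "contr H (scal r f) S = scal r (contr H f) S"
    unfolding scal_def[of r "contr H f"] contr_eq_sum[OF finite_gens_of[OF f] subset_refl]
      contr_eq_sum[OF finite_gens_of[OF f] \<open>gens_of (scal r f) \<subseteq> gens_of f\<close>] sum_distrib_left
    by (intro sum.cong refl) (simp add: scal_def signed_mult_right)
qed

lemma contr_grade_inv:
  assumes f: "f \<in> carrier (ext_alg A)"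
  shows "contr H (grade_inv f) = - grade_inv (contr H f)"
proof
  fix S
  show "contr H (grade_inv f) S = (- grade_inv (contr H f)) S"
  proof (cases "finite S")
    case True
    have "gens_of (grade_inv f) \<subseteq> gens_of f"
      by (auto simp: gens_of_def grade_inv_def)
    then show ?thesis
      unfolding uminus_apply grade_inv_def[of "contr H f"] contr_eq_sum[OF finite_gens_of[OF f] subset_refl]
        contr_eq_sum[OF finite_gens_of[OF f] \<open>gens_of (grade_inv f) \<subseteq> gens_of f\<close>]
        signed_sum sum_negf[symmetric]
      by (intro sum.cong refl) (use True in \<open>simp add: grade_inv_def signed_Suc signed_minus add.commute\<close>)
  next
    case False
    then show ?thesis using f
      by (simp add: contr_infinite[of _ A] grade_inv_in_carrier grade_inv_def[of "contr H f"])
  qed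
qed

definition dep_part :: "'l set \<Rightarrow> ('l set \<Rightarrow> bool) \<Rightarrow> ('l set \<Rightarrow> 'r::{comm_ring, comm_monoid_mult}) set" where
  "dep_part A Dep = {f \<in> carrier (ext_alg A). \<forall>T. f T \<noteq> 0 \<longrightarrow> Dep T}"

text \<open>Boundaries alone would not be stable under products: by the Leibniz rule, a generator
  times \<open>ext_der g\<close> is \<open>g\<close> minus the boundary of the generator times
  \<open>g\<close>, so dependent monomials appear. Keeping \<open>f\<close> and \<open>g\<close>
  apart lets an additive functional be tested on each kind of element.\<close>

definition dep_ideal :: "'l set \<Rightarrow> ('l set \<Rightarrow> bool) \<Rightarrow> ('l set \<Rightarrow> 'r::{comm_ring, comm_monoid_mult}) set" where
  "dep_ideal A Dep = {f + ext_der g | f g. f \<in> dep_part A Dep \<and> g \<in> dep_part A Dep}"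

lemma dep_part_carrier: "f \<in> dep_part A Dep \<Longrightarrow> f \<in> carrier (ext_alg A)"
  by (simp add: dep_part_def)

lemma dep_part_zero: "0 \<in> dep_part A Dep"
  by (simp add: dep_part_def zero_in_carrier)

lemma dep_part_add:
  assumes "f \<in> dep_part A Dep" "g \<in> dep_part A Dep" shows "f + g \<in> dep_part A Dep"
proof -
  have "Dep T" if "(f + g) T \<noteq> 0" for T
  proof -
    have "f T \<noteq> 0 \<or> g T \<noteq> 0" using that by auto
    then show ?thesis using assms by (auto simp: dep_part_def)
  qed
  then show ?thesis using assms unfolding dep_part_def by (blast intro: add_in_carrier)
qed

lemma dep_part_uminus: "f \<in> dep_part A Dep \<Longrightarrow> - f \<in> dep_part A Dep"
  by (simp add: dep_part_def uminus_in_carrier)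

lemma dep_part_scal: "f \<in> dep_part A Dep \<Longrightarrow> scal r f \<in> dep_part A Dep"
  using scal_in_carrier[of f A r] by (auto simp: dep_part_def scal_def) (metis mult_zero_right)

lemma dep_part_grade_inv: "f \<in> dep_part A Dep \<Longrightarrow> grade_inv f \<in> dep_part A Dep"
  using grade_inv_in_carrier[of f A] by (auto simp: dep_part_def grade_inv_def)

lemma dep_part_mono:
  assumes "\<And>T. D T \<Longrightarrow> D' T" shows "dep_part A D \<subseteq> dep_part A D'"
  using assms by (auto simp: dep_part_def)

lemma dep_idealI: "f \<in> dep_part A Dep \<Longrightarrow> g \<in> dep_part A Dep \<Longrightarrow> f + ext_der g \<in> dep_ideal A Dep"
  by (auto simp: dep_ideal_def)

lemma dep_idealE:
  assumes "h \<in> dep_ideal A Dep"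
  obtains f g where "h = f + ext_der g" "f \<in> dep_part A Dep" "g \<in> dep_part A Dep"
  using assms by (auto simp: dep_ideal_def)

lemma dep_ideal_mono:
  assumes "\<And>T. D T \<Longrightarrow> D' T" shows "dep_ideal A D \<subseteq> dep_ideal A D'"
  using dep_part_mono[of D D' A, OF assms] unfolding dep_ideal_def by blast

lemma dep_part_in_dep_ideal: "f \<in> dep_part A Dep \<Longrightarrow> f \<in> dep_ideal A Dep"
  using dep_idealI[of f A Dep 0] by (simp add: dep_part_zero ext_der_contr)

lemma ext_der_in_dep_ideal: "f \<in> dep_part A Dep \<Longrightarrow> ext_der f \<in> dep_ideal A Dep"
  using dep_idealI[of 0 A Dep f] by (simp add: dep_part_zero)

lemma dep_ideal_carrier: "h \<in> dep_ideal A Dep \<Longrightarrow> h \<in> carrier (ext_alg A)"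
  by (erule dep_idealE)
     (auto simp only: ext_der_contr intro!: add_in_carrier contr_in_carrier intro: dep_part_carrier)

lemma dep_ideal_zero: "0 \<in> dep_ideal A Dep"
  by (rule dep_part_in_dep_ideal[OF dep_part_zero])

lemma dep_ideal_add:
  assumes "h \<in> dep_ideal A Dep" "h' \<in> dep_ideal A Dep" shows "h + h' \<in> dep_ideal A Dep"
proof -
  obtain f g where 1: "h = f + ext_der g" "f \<in> dep_part A Dep" "g \<in> dep_part A Dep"
    using assms(1) by (rule dep_idealE)
  obtain f' g' where 2: "h' = f' + ext_der g'" "f' \<in> dep_part A Dep" "g' \<in> dep_part A Dep"
    using assms(2) by (rule dep_idealE)
  have "ext_der (g + g') = ext_der g + ext_der g'"
    unfolding ext_der_contr by (rule contr_add[OF dep_part_carrier[OF 1(3)] dep_part_carrier[OF 2(3)]])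
  then have "h + h' = (f + f') + ext_der (g + g')" unfolding 1(1) 2(1) by (simp only: ac_simps)
  then show ?thesis using dep_idealI[OF dep_part_add[OF 1(2) 2(2)] dep_part_add[OF 1(3) 2(3)]] by metis
qed

lemma dep_ideal_uminus:
  assumes "h \<in> dep_ideal A Dep" shows "- h \<in> dep_ideal A Dep"
proof -
  obtain f g where 1: "h = f + ext_der g" "f \<in> dep_part A Dep" "g \<in> dep_part A Dep"
    using assms(1) by (rule dep_idealE)
  have "- h = - f + ext_der (- g)" unfolding 1(1) ext_der_contr contr_uminus by (rule minus_add_distrib)
  then show ?thesis using dep_idealI[OF dep_part_uminus[OF 1(2)] dep_part_uminus[OF 1(3)]] by metis
qed

lemma dep_ideal_diff:
  "h \<in> dep_ideal A Dep \<Longrightarrow> h' \<in> dep_ideal A Dep \<Longrightarrow> h - h' \<in> dep_ideal A Dep"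
  unfolding diff_conv_add_uminus by (intro dep_ideal_add dep_ideal_uminus)

lemma dep_ideal_signed: "h \<in> dep_ideal A Dep \<Longrightarrow> signed n h \<in> dep_ideal A Dep"
  by (cases "even n") (simp_all only: signed_def dep_ideal_uminus if_True if_False)

lemma dep_ideal_sum: "(\<And>i. i \<in> I \<Longrightarrow> f i \<in> dep_ideal A Dep) \<Longrightarrow> (\<Sum>i\<in>I. f i) \<in> dep_ideal A Dep"
  by (induction I rule: infinite_finite_induct) (auto simp: dep_ideal_zero intro!: dep_ideal_add)

lemma dep_ideal_scal:
  assumes "h \<in> dep_ideal A Dep" shows "scal r h \<in> dep_ideal A Dep"
proof -
  obtain f g where 1: "h = f + ext_der g" "f \<in> dep_part A Dep" "g \<in> dep_part A Dep"
    using assms(1) by (rule dep_idealE)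
  have "scal r h = scal r f + ext_der (scal r g)"
    unfolding 1(1) ext_der_contr contr_scal[OF dep_part_carrier[OF 1(3)]] by (rule scal_add)
  then show ?thesis using dep_idealI[OF dep_part_scal[OF 1(2)] dep_part_scal[OF 1(3)]] by metis
qed

lemma dep_ideal_grade_inv:
  assumes "h \<in> dep_ideal A Dep" shows "grade_inv h \<in> dep_ideal A Dep"
proof -
  obtain f g where 1: "h = f + ext_der g" "f \<in> dep_part A Dep" "g \<in> dep_part A Dep"
    using assms(1) by (rule dep_idealE)
  have "grade_inv h = grade_inv f + ext_der (- grade_inv g)"
    unfolding 1(1) ext_der_contr contr_uminus contr_grade_inv[OF dep_part_carrier[OF 1(3)]] minus_minus
    by (rule grade_inv_add)
  then show ?thesis
    using dep_idealI[OF dep_part_grade_inv[OF 1(2)] dep_part_uminus[OF dep_part_grade_inv[OF 1(3)]]] by metis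
qed

lemma ext_der_dep_ideal:
  assumes "h \<in> dep_ideal A Dep" shows "ext_der h \<in> dep_ideal A Dep"
proof -
  obtain f g where 1: "h = f + ext_der g" "f \<in> dep_part A Dep" "g \<in> dep_part A Dep"
    using assms(1) by (rule dep_idealE)
  have "ext_der h = ext_der f + ext_der (ext_der g)"
    unfolding 1(1) ext_der_contr
    by (rule contr_add[OF dep_part_carrier[OF 1(2)] contr_in_carrier[OF dep_part_carrier[OF 1(3)]]])
  also have "ext_der (ext_der g) = 0"
    unfolding ext_der_contr by (rule contr_contr_same[OF dep_part_carrier[OF 1(3)]])
  finally have "ext_der h = ext_der f" by simp
  then show ?thesis using ext_der_in_dep_ideal[OF 1(2)] by metis
qed

lemma ext_mon_insert:
  "finite T \<Longrightarrow> l \<notin> T \<Longrightarrow>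
    ext_mon (insert l T) r = wedge (ext_mon {l} 1) (ext_mon T (signed (below T l) r))"
  by (simp add: wedge_ext_mon inversions_singleton_left)

text \<open>Used for a single vertex and for a whole simplex alike. \<open>not_Dep_empty\<close>
  supplies the line by which a dependent monomial is recovered from its boundary.\<close>

locale dependence =
  fixes A :: "'l set" and Dep :: "'l set \<Rightarrow> bool"
  assumes Dep_superset: "Dep T \<Longrightarrow> T \<subseteq> U \<Longrightarrow> finite U \<Longrightarrow> U \<subseteq> A \<Longrightarrow> Dep U"
    and not_Dep_empty: "\<not> Dep {}"
begin

lemma dep_part_gen_wedge:
  assumes "l \<in> A" "f \<in> dep_part A Dep" shows "wedge (ext_mon {l} 1) f \<in> dep_part A Dep"
proof -
  have c: "wedge (ext_mon {l} 1) f \<in> carrier (ext_alg A)"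
    using assms by (intro wedge_in_carrier ext_mon_in_carrier) (auto simp: dep_part_def)
  moreover have "Dep T" if "wedge (ext_mon {l} 1) f T \<noteq> 0" for T
  proof -
    have "f (T - {l}) \<noteq> 0" using that by (auto simp: wedge_gen_left split: if_splits)
    then have "Dep (T - {l})" using assms(2) by (simp add: dep_part_def)
    moreover have "finite T \<and> T \<subseteq> A" using c that by (auto simp: carrier_ext_alg)
    ultimately show ?thesis using Dep_superset[of "T - {l}" T] by blast
  qed
  ultimately show ?thesis by (simp add: dep_part_def)
qed

lemma dep_ideal_gen_wedge_left:
  assumes "l \<in> A" "h \<in> dep_ideal A Dep" shows "wedge (ext_mon {l} 1) h \<in> dep_ideal A Dep"
proof -
  let ?e = "ext_mon {l} 1"
  obtain f g where 1: "h = f + ext_der g" "f \<in> dep_part A Dep" "g \<in> dep_part A Dep"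
    using assms(2) by (rule dep_idealE)
  have "ext_der (wedge ?e g) = g - wedge ?e (ext_der g)"
    by (rule ext_der_gen_wedge[OF dep_part_carrier[OF 1(3)]])
  then have "wedge ?e (ext_der g) = g - ext_der (wedge ?e g)" by (simp only: algebra_simps)
  then have "wedge ?e h = wedge ?e f + (g - ext_der (wedge ?e g))" 
    unfolding 1(1) wedge_add_right by simp
  moreover have "wedge ?e f \<in> dep_ideal A Dep" "g \<in> dep_ideal A Dep" "ext_der (wedge ?e g) \<in> dep_ideal A Dep"
    using assms(1) 1 by (auto intro: dep_part_in_dep_ideal ext_der_in_dep_ideal dep_part_gen_wedge)
  ultimately show ?thesis by (simp only: dep_ideal_add dep_ideal_diff)
qed

lemma dep_ideal_ext_mon_wedge:
  assumes "finite T" "T \<subseteq> A" "h \<in> dep_ideal A Dep"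
  shows "wedge (ext_mon T r) h \<in> dep_ideal A Dep \<and> wedge h (ext_mon T r) \<in> dep_ideal A Dep"
  using assms
proof (induction T arbitrary: r h rule: finite_induct)
  case empty
  then show ?case
    using wedge_scalar_left[OF dep_ideal_carrier] wedge_scalar_right[OF dep_ideal_carrier] dep_ideal_scal
    by metis
next
  case (insert l T)
  let ?e = "ext_mon {l} 1" and ?m = "ext_mon T (signed (below T l) r)"
  have l: "l \<in> A" and T: "T \<subseteq> A" using insert.prems(1) by auto
  have "wedge ?e (wedge ?m h) \<in> dep_ideal A Dep"
    using insert.IH[OF T insert.prems(2)] dep_ideal_gen_wedge_left[OF l] by blast
  moreover have "wedge h ?e \<in> dep_ideal A Dep"
    unfolding wedge_gen_right
    by (intro dep_ideal_gen_wedge_left[OF l] dep_ideal_grade_inv insert.prems(2))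
  then have "wedge (wedge h ?e) ?m \<in> dep_ideal A Dep"
    using insert.IH[OF T] by blast
  ultimately show ?case
    unfolding ext_mon_insert[OF insert.hyps] wedge_assoc by blast
qed

lemma dep_ideal_wedge:
  assumes "f \<in> carrier (ext_alg A)" "h \<in> dep_ideal A Dep"
  shows "wedge f h \<in> dep_ideal A Dep \<and> wedge h f \<in> dep_ideal A Dep"
  using assms(1)
proof (induction f rule: carrier_ext_alg_induct)
  case zero
  have "wedge 0 h = 0" "wedge h 0 = 0" by (simp_all add: wedge_def fun_eq_iff)
  then show ?case by (simp only: dep_ideal_zero simp_thms)
next
  case (add S r f)
  then show ?case
    using dep_ideal_ext_mon_wedge[OF add(1,2) assms(2), of r]
    unfolding wedge_add_left wedge_add_right by (blast intro: dep_ideal_add)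
qed

lemma ideal_dep_ideal: "ideal (dep_ideal A Dep :: ('l set \<Rightarrow> 'r::{comm_ring, comm_monoid_mult}) set) (ext_alg A)"
proof -
  let ?E = "ext_alg A :: ('l set \<Rightarrow> 'r) ring"
  interpret ring ?E by (rule ring_ext_alg)
  have neg: "\<ominus>\<^bsub>?E\<^esub> f = - f" if "f \<in> carrier ?E" for f
    by (rule minus_equality) (use that in \<open>simp_all add: ext_alg_simps uminus_in_carrier\<close>)
  show ?thesis
  proof (rule idealI)
    show "subgroup (dep_ideal A Dep) (add_monoid ?E)"
    proof (rule add.subgroupI)
      show "dep_ideal A Dep \<subseteq> carrier ?E" using dep_ideal_carrier by blast
      show "dep_ideal A Dep \<noteq> ({} :: ('l set \<Rightarrow> 'r) set)" using dep_ideal_zero by blast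
      show "\<ominus>\<^bsub>?E\<^esub> f \<in> dep_ideal A Dep" if "f \<in> dep_ideal A Dep" for f
        using neg[OF dep_ideal_carrier[OF that]] dep_ideal_uminus[OF that] by metis
      show "f \<oplus>\<^bsub>?E\<^esub> g \<in> dep_ideal A Dep" if "f \<in> dep_ideal A Dep" "g \<in> dep_ideal A Dep" for f g
        unfolding ext_alg_simps using that by (rule dep_ideal_add)
    qed
  qed (use ring_ext_alg dep_ideal_wedge in auto)
qed

text \<open>For \<open>c\<close> in \<open>T\<close> the product of the generator of
  \<open>c\<close> with the monomial of \<open>T\<close> vanishes, and the Leibniz rule then
  exhibits this monomial as the generator times its boundary. The unspecified \<open>n\<close>
  absorbs the sign of sorting a product of generators.\<close>

lemma genideal_eq_dep_ideal:
  fixes G :: "('l set \<Rightarrow> 'r::{comm_ring, comm_monoid_mult}) set"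
  assumes sub: "G \<subseteq> dep_ideal A Dep"
    and ex: "\<And>T. \<lbrakk>finite T; T \<subseteq> A; Dep T\<rbrakk> \<Longrightarrow> \<exists>n. ext_der (ext_mon T (signed n 1)) \<in> G"
  shows "Idl\<^bsub>ext_alg A\<^esub> G = dep_ideal A Dep"
proof
  let ?E = "ext_alg A :: ('l set \<Rightarrow> 'r) ring"
  interpret ring ?E by (rule ring_ext_alg)
  show "Idl\<^bsub>?E\<^esub> G \<subseteq> dep_ideal A Dep"
    by (rule genideal_minimal[OF ideal_dep_ideal sub])
  have G: "G \<subseteq> carrier ?E" using sub dep_ideal_carrier by blast
  then interpret I: ideal "Idl\<^bsub>?E\<^esub> G" ?E by (rule genideal_ideal)
  have mon: "ext_mon T r \<in> Idl\<^bsub>?E\<^esub> G \<and> ext_der (ext_mon T r) \<in> Idl\<^bsub>?E\<^esub> G"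
    if T: "finite T" "T \<subseteq> A" "Dep T" for T r
  proof -
    obtain n where "ext_der (ext_mon T (signed n 1)) \<in> G" using ex[OF T] ..
    then have n: "ext_der (ext_mon T (signed n 1)) \<in> Idl\<^bsub>?E\<^esub> G" using genideal_self[OF G] by blast
    have m: "ext_mon T s \<in> carrier ?E" for s by (rule ext_mon_in_carrier[OF T(1,2)])
    have "wedge (ext_mon {} (signed n r)) (ext_der (ext_mon T (signed n 1))) =
        scal (signed n r) (ext_der (ext_mon T (signed n 1)))"
      unfolding ext_der_contr by (rule wedge_scalar_left[OF contr_in_carrier[OF m]])
    also have "\<dots> = ext_der (scal (signed n r) (ext_mon T (signed n 1)))"
      unfolding ext_der_contr by (rule contr_scal[OF m, symmetric])
    also have "scal (signed n r) (ext_mon T (signed n 1)) = ext_mon T r"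
      by (simp add: scal_def ext_mon_def fun_eq_iff signed_mult_left signed_mult_right)
    finally have "ext_der (ext_mon T r) = ext_mon {} (signed n r) \<otimes>\<^bsub>?E\<^esub> ext_der (ext_mon T (signed n 1))"
      by simp
    then have der: "ext_der (ext_mon T r) \<in> Idl\<^bsub>?E\<^esub> G"
      using I.I_l_closed[OF n ext_mon_in_carrier[of "{}"]] by simp
    obtain c where c: "c \<in> T" using T(3) not_Dep_empty by (cases "T = {}") auto
    then have "wedge (ext_mon {c} 1) (ext_mon T r) = 0"
      by (simp add: wedge_ext_mon T(1))
    then have "ext_mon T r - wedge (ext_mon {c} 1) (ext_der (ext_mon T r)) = 0"
      using ext_der_gen_wedge[OF m, of c r] by (simp add: ext_der_contr)
    then have "ext_mon T r = ext_mon {c} 1 \<otimes>\<^bsub>?E\<^esub> ext_der (ext_mon T r)" by simp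
    then have "ext_mon T r \<in> Idl\<^bsub>?E\<^esub> G"
      using I.I_l_closed[OF der ext_mon_in_carrier[of "{c}" A 1]] c T(2) by auto
    with der show ?thesis by blast
  qed
  have part: "f \<in> Idl\<^bsub>?E\<^esub> G \<and> ext_der f \<in> Idl\<^bsub>?E\<^esub> G" if "f \<in> dep_part A Dep" for f
    using dep_part_carrier[OF that] that
  proof (induction f rule: carrier_ext_alg_induct)
    case zero
    show ?case using I.zero_closed unfolding ext_der_contr contr_0 ext_alg_simps by blast
  next
    case (add S r f)
    have "Dep T" if "f T \<noteq> 0" for T
    proof -
      have "T \<noteq> S" using that \<open>f S = 0\<close> by metis
      then have "(ext_mon S r + f) T \<noteq> 0" using that by (simp add: ext_mon_def)
      then show ?thesis using add.prems unfolding dep_part_def by blast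
    qed
    then have "f \<in> dep_part A Dep" using \<open>f \<in> carrier ?E\<close> by (simp add: dep_part_def)
    moreover have "(ext_mon S r + f) S \<noteq> 0" using add by (simp add: ext_mon_def)
    then have "Dep S" using add.prems by (simp add: dep_part_def)
    ultimately have "ext_mon S r \<in> Idl\<^bsub>?E\<^esub> G" "ext_der (ext_mon S r) \<in> Idl\<^bsub>?E\<^esub> G"
      "f \<in> Idl\<^bsub>?E\<^esub> G" "ext_der f \<in> Idl\<^bsub>?E\<^esub> G"
      using mon[OF add(1,2)] add.IH by blast+
    moreover have "ext_der (ext_mon S r + f) = ext_der (ext_mon S r) + ext_der f"
      unfolding ext_der_contr by (rule contr_add[OF ext_mon_in_carrier[OF add(1,2)] add(5)])
    ultimately show ?case
      using I.a_closed unfolding ext_alg_simps by metis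
  qed
  show "dep_ideal A Dep \<subseteq> Idl\<^bsub>?E\<^esub> G"
  proof
    fix h :: "'l set \<Rightarrow> 'r" assume "h \<in> dep_ideal A Dep"
    then obtain f g where "h = f + ext_der g" "f \<in> dep_part A Dep" "g \<in> dep_part A Dep"
      by (rule dep_idealE)
    then show "h \<in> Idl\<^bsub>?E\<^esub> G" using part I.a_closed unfolding ext_alg_simps by metis
  qed
qed

end

text \<open>Sorting the factors costs a sign whose value never matters; a repeated factor gives
  zero, which covers standard generators with repeated lines.\<close>

lemma ext_prod_eq_ext_mon:
  fixes ls :: "'l list"
  shows "\<exists>n. (ext_prod A ls :: 'l set \<Rightarrow> 'r::{comm_ring, comm_monoid_mult}) = (if distinct ls then ext_mon (set ls) (signed n 1) else 0)"
proof (induction ls)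
  case Nil
  have "(ext_prod A [] :: 'l set \<Rightarrow> 'r) = ext_mon {} (signed 0 1)" by (simp add: ext_prod_def)
  then show ?case by (intro exI[of _ 0]) simp
next
  case (Cons l ls)
  then obtain n where n: "(ext_prod A ls :: 'l set \<Rightarrow> 'r) = (if distinct ls then ext_mon (set ls) (signed n 1) else 0)" ..
  have gen: "(ext_gen l :: 'l set \<Rightarrow> 'r) = ext_mon {l} 1" by (auto simp: ext_gen_def ext_mon_def)
  have w: "(ext_prod A (l # ls) :: 'l set \<Rightarrow> 'r) = wedge (ext_mon {l} 1) (ext_prod A ls)"
    by (simp add: ext_prod_def gen)
  show ?case
  proof (cases "distinct ls")
    case True
    then have "(ext_prod A (l # ls) :: 'l set \<Rightarrow> 'r) =
        (if l \<in> set ls then 0 else ext_mon (set (l # ls)) (signed (inversions {l} (set ls) + n) 1))"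
      unfolding w by (simp add: n wedge_ext_mon)
    with True show ?thesis by (intro exI[of _ "inversions {l} (set ls) + n"]) simp
  next
    case False
    have "(ext_prod A (l # ls) :: 'l set \<Rightarrow> 'r) = 0" unfolding w using False n by (simp add: wedge_def fun_eq_iff)
    with False show ?thesis by simp
  qed
qed

lemma finsum_ext_alg:
  fixes g :: "'v \<Rightarrow> 'l set \<Rightarrow> 'r::{comm_ring, comm_monoid_mult}"
  assumes "finite I" "\<And>i. i \<in> I \<Longrightarrow> g i \<in> carrier (ext_alg A)"
  shows "(\<Oplus>\<^bsub>ext_alg A\<^esub>i\<in>I. g i) = (\<Sum>i\<in>I. g i)"
proof -
  interpret ring "ext_alg A :: ('l set \<Rightarrow> 'r) ring" by (rule ring_ext_alg)
  show ?thesis using assms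
  proof (induction I rule: finite_induct)
    case empty
    then show ?case by (simp add: ext_alg_simps)
  next
    case (insert i I)
    then show ?case by (subst finsum_insert) (auto simp: ext_alg_simps)
  qed
qed

text \<open>For the inclusion of the right side in the left, every dependent monomial is assigned to
  one index at which it is dependent; cutting \<open>f\<close> and \<open>g\<close> along this
  assignment distributes the element over the ideals.\<close>

lemma sum_of_dep_ideals:
  fixes Dep :: "'v \<Rightarrow> 'l set \<Rightarrow> bool"
  assumes "finite I"
  shows "{(\<Oplus>\<^bsub>ext_alg A\<^esub>x\<in>I. g x) | g. g \<in> (\<Pi> x\<in>I. dep_ideal A (Dep x))} =
    (dep_ideal A (\<lambda>T. \<exists>x\<in>I. Dep x T) :: ('l set \<Rightarrow> 'r::{comm_ring, comm_monoid_mult}) set)"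
    (is "?L = dep_ideal A ?D")
proof
  show "?L \<subseteq> dep_ideal A ?D"
  proof
    fix h :: "'l set \<Rightarrow> 'r" assume "h \<in> ?L"
    then obtain g where h: "h = (\<Oplus>\<^bsub>ext_alg A\<^esub>x\<in>I. g x)" and g: "\<And>x. x \<in> I \<Longrightarrow> g x \<in> dep_ideal A (Dep x)"
      by blast
    have "h = (\<Sum>x\<in>I. g x)"
      unfolding h by (rule finsum_ext_alg[OF assms]) (use g in \<open>blast intro: dep_ideal_carrier\<close>)
    moreover have "g x \<in> dep_ideal A ?D" if "x \<in> I" for x
      using g[OF that] dep_ideal_mono[of "Dep x" ?D A] that by blast
    ultimately show "h \<in> dep_ideal A ?D" by (simp only: dep_ideal_sum)
  qed
  show "dep_ideal A ?D \<subseteq> ?L"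
  proof
    fix h :: "'l set \<Rightarrow> 'r" assume "h \<in> dep_ideal A ?D"
    then obtain f g where h: "h = f + ext_der g" and f: "f \<in> dep_part A ?D" and g: "g \<in> dep_part A ?D"
      by (rule dep_idealE)
    define pick where "pick T = (SOME x. x \<in> I \<and> Dep x T)" for T
    have pick: "pick T \<in> I \<and> Dep (pick T) T" if "?D T" for T
      unfolding pick_def by (rule someI_ex) (use that in blast)
    define part where "part k x = (\<lambda>T. if pick T = x then k T else 0)" for k :: "'l set \<Rightarrow> 'r" and x
    have part: "part k x \<in> dep_part A (Dep x)" if k: "k \<in> dep_part A ?D" for k x
    proof -
      have "finite {S. part k x S \<noteq> 0}"
        by (rule finite_subset[of _ "{S. k S \<noteq> 0}"])
           (use k in \<open>auto simp: part_def dep_part_def carrier_ext_alg\<close>)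
      moreover have "finite T \<and> T \<subseteq> A \<and> Dep x T" if "part k x T \<noteq> 0" for T
      proof -
        have "pick T = x" "k T \<noteq> 0" using that by (auto simp: part_def split: if_splits)
        then show ?thesis using k pick[of T] by (auto simp: dep_part_def carrier_ext_alg)
      qed
      ultimately show ?thesis by (simp add: dep_part_def carrier_ext_alg)
    qed
    have sum_part: "k = (\<Sum>x\<in>I. part k x)" if k: "k \<in> dep_part A ?D" for k
    proof
      fix T
      have "(\<Sum>x\<in>J. part k x) T = (\<Sum>x\<in>J. part k x T)" for J
        by (induction J rule: infinite_finite_induct) auto
      moreover have "(\<Sum>x\<in>I. part k x T) = (if pick T \<in> I then k T else 0)"
        using assms by (simp add: part_def)
      moreover have "k T = 0" if "pick T \<notin> I"
        using k pick[of T] that by (auto simp: dep_part_def)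
      ultimately show "k T = (\<Sum>x\<in>I. part k x) T" by auto
    qed
    define u where "u x = part f x + ext_der (part g x)" for x
    have u: "u x \<in> dep_ideal A (Dep x)" for x
      unfolding u_def by (intro dep_idealI part f g)
    have "ext_der g = (\<Sum>x\<in>I. ext_der (part g x))"
      unfolding ext_der_contr
      by (subst sum_part[OF g], rule contr_sum[of _ _ A]) (rule dep_part_carrier[OF part[OF g]])
    then have "h = (\<Sum>x\<in>I. u x)"
      unfolding h u_def sum.distrib using sum_part[OF f] by metis
    also have "\<dots> = (\<Oplus>\<^bsub>ext_alg A\<^esub>x\<in>I. u x)"
      by (rule finsum_ext_alg[OF assms, symmetric]) (rule dep_ideal_carrier[OF u])
    finally show "h \<in> ?L" using u by blast
  qed
qed


section \<open>The retraction onto the image of the derivation\<close>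

definition retract :: "'l \<Rightarrow> ('l set \<Rightarrow> 'r::{comm_ring, comm_monoid_mult}) \<Rightarrow> 'l set \<Rightarrow> 'r" where
  "retract l f = ext_der (wedge (ext_mon {l} 1) f)"

lemma retract_add:
  assumes "l \<in> A" "f \<in> carrier (ext_alg A)" "g \<in> carrier (ext_alg A)"
  shows "retract l (f + g) = retract l f + retract l g"
  unfolding retract_def wedge_add_right ext_der_contr
  using assms by (intro contr_add[of _ A] wedge_in_carrier ext_mon_in_carrier) auto

lemma retract_uminus: "retract l (- f) = - retract l f"
proof -
  have "wedge (ext_mon {l} 1) (- f) = - wedge (ext_mon {l} 1) f"
    by (simp add: wedge_def fun_eq_iff signed_minus sum_negf)
  then show ?thesis by (simp only: retract_def ext_der_contr contr_uminus)
qed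

lemma retract_in_ext_im:
  assumes "l \<in> A" "f \<in> carrier (ext_alg A)"
  shows "retract l f \<in> ext_im A"
  unfolding retract_def ext_im_def
  using assms by (intro imageI wedge_in_carrier ext_mon_in_carrier) auto

lemma ext_im_carrier: "f \<in> ext_im A \<Longrightarrow> f \<in> carrier (ext_alg A)"
  unfolding ext_im_def ext_der_contr using contr_in_carrier by blast

text \<open>By the Leibniz rule \<open>retract l f\<close> differs from \<open>f\<close> by a
  multiple of \<open>ext_der f\<close>, which is zero on the image because the derivation squares to
  zero.\<close>

lemma retract_ext_im:
  assumes "f \<in> ext_im A" shows "retract l f = f"
proof -
  obtain g where f: "f = ext_der g" and g: "g \<in> carrier (ext_alg A)" using assms by (auto simp: ext_im_def)
  have "ext_der f = 0" unfolding f ext_der_contr by (rule contr_contr_same[OF g])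
  then have "wedge (ext_mon {l} 1) (ext_der f) = 0" by (simp add: wedge_def fun_eq_iff)
  then show ?thesis
    unfolding retract_def ext_der_gen_wedge[OF ext_im_carrier[OF assms]] by simp
qed

lemma (in dependence) retract_dep_ideal:
  "l \<in> A \<Longrightarrow> h \<in> dep_ideal A Dep \<Longrightarrow> retract l h \<in> dep_ideal A Dep"
  unfolding retract_def by (intro ext_der_dep_ideal dep_ideal_gen_wedge_left)

section \<open>Ordering monomials\<close>

text \<open>Well-foundedness passes to \<open>colex\<close> and allows induction on leading
  monomials over an infinite set of lines.\<close>

locale monomial_order =
  fixes less :: "'l \<Rightarrow> 'l \<Rightarrow> bool"
  assumes less_irrefl: "\<not> less x x"
    and less_trans: "less x y \<Longrightarrow> less y z \<Longrightarrow> less x z"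
    and less_linear: "less x y \<or> x = y \<or> less y x"
    and wf_less: "wf {(x, y). less x y}"
begin

lemma less_asym: "less x y \<Longrightarrow> \<not> less y x"
  using less_trans[of x y x] less_irrefl[of x] by auto

lemma finite_max_ex:
  assumes "finite X" "X \<noteq> {}" obtains m where "m \<in> X" "\<And>x. x \<in> X \<Longrightarrow> \<not> less m x"
proof -
  have "\<exists>m\<in>X. \<forall>x\<in>X. \<not> less m x" using assms
  proof (induction X rule: finite_ne_induct)
    case (singleton x)
    then show ?case using less_irrefl by blast
  next
    case (insert x F)
    then obtain m where m: "m \<in> F" "\<forall>x\<in>F. \<not> less m x" by blast
    show ?case
    proof (cases "less m x")
      case True
      then have "\<not> less x y" if "y \<in> F" for y using m(2) less_trans[of m x y] that by blast
      then show ?thesis using less_irrefl[of x] by blast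
    next
      case False
      then show ?thesis using m by blast
    qed
  qed
  then show thesis using that by blast
qed

lemma finite_min_ex:
  assumes "finite X" "X \<noteq> {}" obtains m where "m \<in> X" "\<And>x. x \<in> X \<Longrightarrow> \<not> less x m"
proof -
  obtain y where "y \<in> X" using assms(2) by blast
  then obtain m where "m \<in> X" "\<And>z. (z, m) \<in> {(x, y). less x y} \<Longrightarrow> z \<notin> X"
    using wfE_min[OF wf_less] by metis
  then show thesis using that by blast
qed

text \<open>The greatest line at which two sets differ decides. Only what lies above it must agree,
  so sets of different cardinality are compared too.\<close>

definition colex :: "'l set \<Rightarrow> 'l set \<Rightarrow> bool" where
  "colex T S \<longleftrightarrow> (\<exists>m\<in>S - T. \<forall>x. less m x \<longrightarrow> (x \<in> T \<longleftrightarrow> x \<in> S))"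

lemma colex_linear:
  assumes "finite S" "finite T" "S \<noteq> T" shows "colex T S \<or> colex S T"
proof -
  let ?X = "(S - T) \<union> (T - S)"
  have "finite ?X" "?X \<noteq> {}" using assms by auto
  then obtain m where m: "m \<in> ?X" "\<And>x. x \<in> ?X \<Longrightarrow> \<not> less m x"
    using finite_max_ex[of ?X] by metis
  then have "\<forall>x. less m x \<longrightarrow> (x \<in> T \<longleftrightarrow> x \<in> S)" by blast
  then show ?thesis using m(1) unfolding colex_def by blast
qed

text \<open>Below the deciding line \<open>m\<close> the smaller set may have many more elements;
  this is one step of the multiset extension of \<open>less\<close>, which is well-founded.\<close>

lemma wf_colex: "wf {(T, S). finite T \<and> finite S \<and> colex T S}"
proof (rule wf_subset[OF wf_inv_image[OF wf_mult[OF wf_less], of mset_set]], safe)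
  fix T S assume fin: "finite T" "finite S" and "colex T S"
  then obtain m where m: "m \<in> S - T" "\<forall>x. less m x \<longrightarrow> (x \<in> T \<longleftrightarrow> x \<in> S)" by (auto simp: colex_def)
  have split: "mset_set T = mset_set (T \<inter> S) + mset_set (T - S)" "mset_set S = mset_set (T \<inter> S) + mset_set (S - T)"
    using fin by (subst mset_set_Union[symmetric]; auto intro!: arg_cong[where f = mset_set])+
  have "less k m" if "k \<in> T - S" for k
    using less_linear[of k m] m that by blast
  then show "(T, S) \<in> inv_image (Multiset.mult {(x, y). less x y}) mset_set"
    unfolding inv_image_def using fin m(1)
    by (simp only: split mem_Collect_eq case_prod_conv, intro one_step_implies_mult)
       (auto simp: mset_set_empty_iff intro!: bexI[of _ m])
qed

text \<open>A failure of transitivity would, by totality, close a cycle, which well-foundedness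
  forbids. This avoids comparing the deciding lines.\<close>

lemma colex_trans:
  assumes "finite S" "finite T" "finite U" "colex S T" "colex T U" shows "colex S U"
proof (rule ccontr)
  let ?R = "{(T, S). finite T \<and> finite S \<and> colex T S}"
  assume "\<not> colex S U"
  then have "S = U \<or> colex U S" using colex_linear assms by blast
  then have "(S, S) \<in> ?R\<^sup>+"
  proof
    assume "S = U"
    then have "(S, T) \<in> ?R" "(T, S) \<in> ?R" using assms by auto
    then show ?thesis by (rule trancl_trans[OF r_into_trancl r_into_trancl])
  next
    assume "colex U S"
    then have "(S, T) \<in> ?R" "(T, U) \<in> ?R" "(U, S) \<in> ?R" using assms by auto
    then show ?thesis
      by (rule trancl_trans[OF r_into_trancl trancl_trans[OF r_into_trancl r_into_trancl]])
  qed
  then show False using wf_acyclic[OF wf_colex] unfolding acyclic_def by blast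
qed

lemma colex_greatest_ex:
  assumes "finite X" "X \<noteq> {}" "\<And>T. T \<in> X \<Longrightarrow> finite T"
  obtains M where "M \<in> X" "\<And>T. T \<in> X \<Longrightarrow> T = M \<or> colex T M"
proof -
  have "\<exists>M\<in>X. \<forall>T\<in>X. T = M \<or> colex T M" using assms
  proof (induction X rule: finite_ne_induct)
    case (insert S F)
    have "\<exists>M\<in>F. \<forall>T\<in>F. T = M \<or> colex T M"
      by (rule insert.IH) (rule insert.prems, simp)
    then obtain M where M: "M \<in> F" "\<forall>T\<in>F. T = M \<or> colex T M" by blast
    show ?case
    proof (cases "S = M \<or> colex S M")
      case True
      then show ?thesis using M by blast
    next
      case False
      then have "colex M S" using colex_linear[of S M] insert.prems M(1) by blast
      have "T = S \<or> colex T S" if T: "T \<in> insert S F" for T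
      proof (cases "T = S \<or> T = M")
        case True
        then show ?thesis using \<open>colex M S\<close> by blast
      next
        case False
        then have "colex T M" using M(2) T by blast
        moreover have "finite T" "finite M" "finite S" using insert.prems T M(1) by simp_all
        ultimately show ?thesis using colex_trans \<open>colex M S\<close> by metis
      qed
      then show ?thesis by blast
    qed
  qed simp
  then show thesis using that by blast
qed

text \<open>Suppose \<open>m\<close> decides. Every \<open>s\<close> in \<open>S\<close> not below
  \<open>m\<close> is sent strictly above \<open>m\<close>, where the two sets agree; so
  \<open>t\<close> injects the part of \<open>S\<close> from \<open>m\<close> on into the part above
  \<open>m\<close>, which is smaller by \<open>m\<close> itself.\<close>

lemma not_colex_transversal:
  assumes S: "finite S" and t: "inj_on t S" "\<And>s. s \<in> S \<Longrightarrow> \<not> less (t s) s"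
  shows "\<not> colex (t ` S) S"
proof
  assume "colex (t ` S) S"
  then obtain m where m: "m \<in> S" "m \<notin> t ` S" "\<And>x. less m x \<Longrightarrow> (x \<in> t ` S \<longleftrightarrow> x \<in> S)"
    by (auto simp: colex_def)
  have "t ` {s \<in> S. \<not> less s m} \<subseteq> {x \<in> S. less m x}"
  proof safe
    fix s assume s: "s \<in> S" "\<not> less s m"
    have "t s \<noteq> m" using m(2) s(1) by blast
    moreover have "\<not> less (t s) m"
      using t(2)[OF s(1)] s(2) less_linear[of s m] less_trans[of "t s" m s] by blast
    ultimately show *: "less m (t s)" using less_linear[of m "t s"] by blast
    show "t s \<in> S" using m(3)[OF *] s(1) by blast
  qed
  then have "card (t ` {s \<in> S. \<not> less s m}) \<le> card {x \<in> S. less m x}"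
    using S by (intro card_mono) auto
  moreover have "card (t ` {s \<in> S. \<not> less s m}) = card {s \<in> S. \<not> less s m}"
    by (rule card_image) (use t(1) in \<open>auto simp: inj_on_def\<close>)
  moreover have "{x \<in> S. less m x} \<subset> {s \<in> S. \<not> less s m}"
    using m(1) less_irrefl[of m] less_asym by blast
  then have "card {x \<in> S. less m x} < card {s \<in> S. \<not> less s m}"
    using S by (intro psubset_card_mono) auto
  ultimately show False by simp
qed

end

lemma monomial_order_exists: "\<exists>less :: 'l \<Rightarrow> 'l \<Rightarrow> bool. monomial_order less"
proof -
  obtain r :: "('l \<times> 'l) set" where "Well_order r" and F: "Field r = UNIV"
    using well_ordering[where 'a = 'l] by (elim exE conjE)
  then have "trans r" "antisym r" "total_on UNIV r" and wf: "wf (r - Id)"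
    by (simp_all add: well_order_on_def linear_order_on_def partial_order_on_def preorder_on_def)
  then have r: "(x, y) \<in> r \<Longrightarrow> (y, z) \<in> r \<Longrightarrow> (x, z) \<in> r"
      "(x, y) \<in> r \<Longrightarrow> (y, x) \<in> r \<Longrightarrow> x = y"
      "x \<noteq> y \<Longrightarrow> (x, y) \<in> r \<or> (y, x) \<in> r" for x y z
    unfolding trans_def antisym_def total_on_def by blast+
  have "monomial_order (\<lambda>x y. (x, y) \<in> r - Id)"
  proof
    show "(x, z) \<in> r - Id" if "(x, y) \<in> r - Id" "(y, z) \<in> r - Id" for x y z
      using r(1)[of x y z] r(2)[of x y] that by auto
    show "(x, y) \<in> r - Id \<or> x = y \<or> (y, x) \<in> r - Id" for x y
      using r(3)[of x y] by auto
    have "{(x, y). (x, y) \<in> r - Id} = r - Id" by auto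
    then show "wf {(x, y). (x, y) \<in> r - Id}" using wf by metis
  qed simp
  then show ?thesis by blast
qed

locale ordered_dependence = dependence A Dep + monomial_order less
  for A :: "'l set" and Dep :: "'l set \<Rightarrow> bool" and less :: "'l \<Rightarrow> 'l \<Rightarrow> bool"
begin

text \<open>Reduction modulo a broken circuit: \<open>insert b {s \<in> S. less b s}\<close> is dependent, and the boundary
  of \<open>insert b S\<close> contains \<open>e\<^sub>S\<close>, smaller monomials and dependent monomials.\<close>

lemma broken_circuit_reduction:
  assumes S: "finite S" "S \<subseteq> A" and b: "b \<in> A" and dep: "Dep (insert b {s \<in> S. less b s})"
  obtains h :: "'l set \<Rightarrow> 'r::{comm_ring, comm_monoid_mult}"
    where "h \<in> carrier (ext_alg A)" "\<And>T. h T \<noteq> 0 \<Longrightarrow> colex T S" "ext_mon S r - h \<in> dep_ideal A Dep"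
proof (cases "b \<in> S")
  case True
  then have "Dep S" using Dep_superset[OF dep] S by auto
  then have "ext_mon S r \<in> dep_part A Dep"
    using ext_mon_in_carrier[OF S] by (auto simp: dep_part_def ext_mon_def)
  then have "ext_mon S r - 0 \<in> dep_ideal A Dep" using dep_part_in_dep_ideal by fastforce
  then show thesis using that[OF zero_in_carrier] by simp
next
  case False
  let ?W = "insert b S"
  define g where "g = ext_mon ?W r"
  have W: "finite ?W" "?W \<subseteq> A" using S b by auto
  have gc: "g \<in> carrier (ext_alg A)" unfolding g_def by (rule ext_mon_in_carrier[OF W])
  have "Dep ?W" using Dep_superset[OF dep _ W] by auto
  then have g: "g \<in> dep_part A Dep" using gc by (auto simp: dep_part_def g_def ext_mon_def)
  define k where "k = ext_mon S r - signed (below S b) (ext_der g)"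
  have kc: "k \<in> carrier (ext_alg A)"
    unfolding k_def ext_der_contr
    by (intro diff_in_carrier signed_in_carrier contr_in_carrier gc ext_mon_in_carrier S)
  have derS: "ext_der g S = signed (below S b) r"
  proof -
    have gen: "gens_of g \<subseteq> ?W" by (auto simp: gens_of_def g_def ext_mon_def split: if_splits)
    have "ext_der g S = (\<Sum>l\<in>?W. if l = b then signed (below S b) r else 0)"
      unfolding ext_der_contr contr_eq_sum[OF W(1) gen]
      by (intro sum.cong refl) (auto simp: False g_def ext_mon_def)
    then show ?thesis using W(1) by simp
  qed
  have kS: "k S = 0" by (simp add: k_def ext_mon_def signed_fun derS)
  have k_supp: "\<exists>l\<in>S. U = ?W - {l}" if kU: "k U \<noteq> 0" for U
  proof -
    have "U \<noteq> S" using kS kU by metis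
    then have "ext_der g U \<noteq> 0" using kU by (simp add: k_def ext_mon_def signed_fun)
    then obtain l where "l \<notin> U" "g (insert l U) \<noteq> 0" unfolding ext_der_contr by (rule contr_nonzeroD)
    then have "insert l U = ?W" by (auto simp: g_def ext_mon_def split: if_splits)
    then have "U = ?W - {l}" "l \<in> ?W" using \<open>l \<notin> U\<close> by auto
    moreover have "l \<noteq> b" using \<open>U \<noteq> S\<close> \<open>U = ?W - {l}\<close> False by auto
    ultimately show ?thesis by blast
  qed
  \<comment> \<open>Dependent monomials of \<open>k\<close> lie in the ideal anyway; once they are
    discarded, the remaining monomials have lost a line above \<open>b\<close>.\<close>
  define h where "h = (\<lambda>U. if Dep U then 0 else k U)"
  define d where "d = (\<lambda>U. if Dep U then k U else 0)"
  have hd: "k = h + d" by (auto simp: h_def d_def fun_eq_iff)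
  have hc: "h \<in> carrier (ext_alg A)"
  proof -
    have "finite {U. h U \<noteq> 0}"
      by (rule finite_subset[of _ "{U. k U \<noteq> 0}"]) (use kc in \<open>auto simp: h_def carrier_ext_alg\<close>)
    then show ?thesis using kc by (auto simp: h_def carrier_ext_alg)
  qed
  have "d = k - h" unfolding hd by simp
  then have "d \<in> carrier (ext_alg A)" using diff_in_carrier[OF kc hc] by simp
  then have d: "d \<in> dep_part A Dep" by (auto simp: dep_part_def d_def)
  show thesis
  proof (rule that[OF hc])
    fix T assume "h T \<noteq> 0"
    then have T: "\<not> Dep T" "k T \<noteq> 0" by (auto simp: h_def split: if_splits)
    then obtain l where l: "l \<in> S" "T = ?W - {l}" using k_supp by blast
    \<comment> \<open>If \<open>l\<close> were below \<open>b\<close>, the dependent set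
      \<open>insert b {s \<in> S. less b s}\<close> would survive inside \<open>T\<close>.\<close>
    have "\<not> less l b"
    proof
      assume "less l b"
      then have "insert b {s \<in> S. less b s} \<subseteq> T" using l False less_asym[of l b] by auto
      moreover have "finite T" "T \<subseteq> A" using l W by auto
      ultimately show False using Dep_superset[OF dep] T(1) by blast
    qed
    then have bl: "less b l" using less_linear[of b l] l(1) False by blast
    have "\<not> less l b" "\<not> less l l" using bl less_asym less_irrefl by blast+
    then have "\<forall>x. less l x \<longrightarrow> (x \<in> T \<longleftrightarrow> x \<in> S)" using l by auto
    then show "colex T S" unfolding colex_def using l by (intro bexI[of _ l]) auto
  next
    have "ext_mon S r - h = d + signed (below S b) (ext_der g)"
      using hd unfolding k_def by (simp only: algebra_simps)
    then show "ext_mon S r - h \<in> dep_ideal A Dep"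
      using dep_ideal_add[OF dep_part_in_dep_ideal[OF d] dep_ideal_signed[OF ext_der_in_dep_ideal[OF g]]]
      by metis
  qed
qed

end


section \<open>Iterated contractions\<close>

fun contrs :: "'l set list \<Rightarrow> ('l set \<Rightarrow> 'r::{comm_ring, comm_monoid_mult}) \<Rightarrow> 'l set \<Rightarrow> 'r" where
  "contrs [] f = f"
| "contrs (H # Hs) f = contr H (contrs Hs f)"

lemma contrs_in_carrier: "f \<in> carrier (ext_alg A) \<Longrightarrow> contrs Hs f \<in> carrier (ext_alg A)"
  by (induction Hs) (auto intro: contr_in_carrier)

lemma contrs_append: "contrs (Hs @ Gs) f = contrs Hs (contrs Gs f)"
  by (induction Hs) auto

lemma contrs_zero: "contrs Hs 0 = 0"
  by (induction Hs) (simp_all only: contrs.simps contr_0)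

lemma contrs_add:
  "f \<in> carrier (ext_alg A) \<Longrightarrow> g \<in> carrier (ext_alg A) \<Longrightarrow> contrs Hs (f + g) = contrs Hs f + contrs Hs g"
proof (induction Hs)
  case (Cons H Hs)
  then have "contrs Hs (f + g) = contrs Hs f + contrs Hs g" by blast
  then show ?case
    using contr_add[OF contrs_in_carrier[OF Cons.prems(1)] contrs_in_carrier[OF Cons.prems(2)], of H Hs Hs]
    by (simp only: contrs.simps)
qed simp

lemma contrs_sum:
  assumes "\<And>i. i \<in> I \<Longrightarrow> f i \<in> carrier (ext_alg A)"
  shows "contrs Hs (\<Sum>i\<in>I. f i) = (\<Sum>i\<in>I. contrs Hs (f i))"
  using assms
proof (induction I rule: infinite_finite_induct)
  case (insert i I)
  then have "contrs Hs (f i + sum f I) = contrs Hs (f i) + contrs Hs (sum f I)"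
    by (intro contrs_add[of _ A] sum_in_carrier) auto
  then show ?case using insert by (simp only: sum.insert insert_iff simp_thms)
next
  case (infinite I)
  then show ?case unfolding sum.infinite[OF infinite(1)] by (intro contrs_zero)
next
  case empty
  show ?case unfolding sum.empty by (rule contrs_zero)
qed

lemma contrs_contr:
  assumes "f \<in> carrier (ext_alg A)"
  shows "contrs Hs (contr H f) = signed (length Hs) (contr H (contrs Hs f))"
proof (induction Hs)
  case (Cons G Gs)
  have "contrs (G # Gs) (contr H f) = signed (length Gs) (contr G (contr H (contrs Gs f)))"
    by (simp only: contrs.simps Cons.IH contr_signed)
  also have "contr G (contr H (contrs Gs f)) = - contr H (contr G (contrs Gs f))"
    by (rule contr_anticommute[OF contrs_in_carrier[OF assms]])
  finally show ?case by (simp only: contrs.simps list.size signed_minus signed_Suc add_Suc_right add_0_right)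
qed simp

text \<open>Anticommutation moves the inner contraction outwards, up to sign, until it meets its
  equal, and the square is zero.\<close>

lemma contrs_contr_mem:
  assumes "f \<in> carrier (ext_alg A)"
  shows "H \<in> set Hs \<Longrightarrow> contrs Hs (contr H f) = 0"
proof (induction Hs)
  case (Cons G Gs)
  show ?case
  proof (cases "H \<in> set Gs")
    case True
    then have "contrs Gs (contr H f) = 0" by (rule Cons.IH)
    then show ?thesis by (simp only: contrs.simps contr_0)
  next
    case False
    then have "H = G" using Cons.prems by simp
    moreover have "contr G (contr G (contrs Gs f)) = 0"
      by (rule contr_contr_same[OF contrs_in_carrier[OF assms]])
    ultimately show ?thesis
      by (simp only: contrs.simps contrs_contr[OF assms] contr_signed signed_0)
  qed
qed simp

text \<open>Each contraction removes one generator of its class, so a nonzero coefficient can be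
  traced back to a monomial of \<open>f\<close> that has, besides \<open>X\<close>, one member for
  each prescribed class.\<close>

lemma contrs_nonzeroD:
  "contrs (map (\<lambda>h. {c. lam c = h}) hs) f X \<noteq> 0 \<Longrightarrow>
    \<exists>ts. map lam ts = hs \<and> set ts \<inter> X = {} \<and> f (set ts \<union> X) \<noteq> 0"
proof (induction hs arbitrary: X)
  case Nil
  then show ?case by (intro exI[of _ "[]"]) simp
next
  case (Cons h hs)
  then obtain l where l: "lam l = h" "l \<notin> X" "contrs (map (\<lambda>h. {c. lam c = h}) hs) f (insert l X) \<noteq> 0"
    by (auto elim: contr_nonzeroD)
  then obtain ts where "map lam ts = hs" "set ts \<inter> insert l X = {}" "f (set ts \<union> insert l X) \<noteq> 0"
    using Cons.IH by blast
  then show ?case using l by (intro exI[of _ "l # ts"]) auto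
qed

text \<open>Since \<open>H x\<close> meets \<open>S\<close> in \<open>x\<close> alone, each
  contraction has a single choice. The coefficient survives up to sign, so it is recovered over any
  ring.\<close>

lemma contrs_ext_mon:
  assumes "finite S" "distinct xs" "set xs \<inter> Y = {}" "set xs \<union> Y = S"
    and "\<And>x. x \<in> set xs \<Longrightarrow> H x \<inter> S = {x}"
  shows "\<exists>n. contrs (map H xs) (ext_mon S r) Y = signed n r"
  using assms(2-5)
proof (induction xs arbitrary: Y)
  case Nil
  then show ?case by (intro exI[of _ 0]) (simp add: ext_mon_def)
next
  case (Cons x xs)
  have supp: "U \<subseteq> S" if "contrs (map G ys) (ext_mon S r) U \<noteq> 0" for G :: "'a \<Rightarrow> 'a set" and ys U
    using that
  proof (induction ys arbitrary: U)
    case Nil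
    then show ?case by (auto simp: ext_mon_def split: if_splits)
  next
    case (Cons y ys)
    then obtain l where "contrs (map G ys) (ext_mon S r) (insert l U) \<noteq> 0"
      by (auto elim: contr_nonzeroD)
    then show ?case using Cons.IH by blast
  qed
  let ?g = "contrs (map H xs) (ext_mon S r)"
  obtain n where n: "?g (insert x Y) = signed n r"
    using Cons.IH[of "insert x Y"] Cons.prems by auto
  have S: "ext_mon S r \<in> carrier (ext_alg S)" by (rule ext_mon_in_carrier) (use assms(1) in auto)
  have gen: "gens_of ?g \<subseteq> S" using supp unfolding gens_of_def by blast
  have "contr (H x) ?g Y = (\<Sum>l\<in>S. if l = x then signed (below Y x + n) r else 0)"
    unfolding contr_eq_sum[OF assms(1) gen]
  proof (intro sum.cong refl)
    fix l assume "l \<in> S"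
    have "H x \<inter> S = {x}" "x \<notin> Y" using Cons.prems by auto
    then show "(if l \<in> H x \<and> l \<notin> Y then signed (below Y l) (?g (insert l Y)) else 0) =
        (if l = x then signed (below Y x + n) r else 0)"
      using \<open>l \<in> S\<close> n by auto
  qed
  also have "\<dots> = signed (below Y x + n) r" using Cons.prems assms(1) by auto
  finally show ?case by auto
qed

section \<open>Independence of lines modulo a lattice\<close>

text \<open>For a lattice \<open>L\<close> and unimodular vectors spanning the lines in \<open>T\<close>, this is linear independence
  modulo \<open>p L\<close>, in a form that does not change when \<open>L\<close> is replaced by a homothetic lattice.\<close>

definition indep :: "('k::field^'n) set \<Rightarrow> ('k^'n) set set \<Rightarrow> bool" where
  "indep L T \<longleftrightarrow> (\<forall>f. (\<forall>l\<in>T. f l \<in> l) \<longrightarrow> (\<Sum>l\<in>T. f l) \<in> L \<longrightarrow> (\<forall>l\<in>T. f l \<in> L))"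

lemma indepD:
  "indep L T \<Longrightarrow> (\<And>l. l \<in> T \<Longrightarrow> f l \<in> l) \<Longrightarrow> (\<Sum>l\<in>T. f l) \<in> L \<Longrightarrow> l \<in> T \<Longrightarrow> f l \<in> L"
  by (simp add: indep_def)

lemma lines_zero: "l \<in> lines \<Longrightarrow> 0 \<in> l"
  by (auto simp: lines_def intro: vec.span_zero)

lemma lines_scale: "l \<in> lines \<Longrightarrow> a \<in> l \<Longrightarrow> k *s a \<in> l"
  by (auto simp: lines_def intro: vec.span_scale)

lemma lines_uminus: "l \<in> lines \<Longrightarrow> a \<in> l \<Longrightarrow> - a \<in> l"
  by (auto simp: lines_def intro: vec.span_neg)

lemma lines_proportional:
  assumes "l \<in> lines" "a \<in> l" "b \<in> l" "a \<noteq> 0"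
  obtains k where "b = k *s a"
proof -
  obtain x where x: "l = vec.span {x}" using assms(1) by (auto simp: lines_def)
  obtain s where s: "a = s *s x" using assms(2) by (auto simp: x vec.span_singleton)
  obtain t where t: "b = t *s x" using assms(3) by (auto simp: x vec.span_singleton)
  have "s \<noteq> 0" using s assms(4) by auto
  then have "b = (t / s) *s a" by (simp add: s t vec.scale_scale)
  then show thesis by (rule that)
qed

lemma lines_nonzero: "l \<in> lines \<Longrightarrow> \<exists>a\<in>l. a \<noteq> 0"
  by (auto simp: lines_def intro: vec.span_base)

lemma indep_subset:
  assumes "indep L T'" "T \<subseteq> T'" "finite T'" "T' \<subseteq> lines"
  shows "indep L T"
  unfolding indep_def
proof (intro allI impI)
  fix f assume f: "\<forall>l\<in>T. f l \<in> l" "(\<Sum>l\<in>T. f l) \<in> L"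
  let ?g = "\<lambda>l. if l \<in> T then f l else 0"
  have "(\<Sum>l\<in>T'. ?g l) = (\<Sum>l\<in>T. f l)"
    using assms(2,3) by (intro sum.mono_neutral_cong_right) auto
  moreover have "\<forall>l\<in>T'. ?g l \<in> l" using f(1) assms(4) lines_zero by auto
  ultimately have "?g l \<in> L" if "l \<in> T'" for l
    using indepD[OF assms(1), of ?g l] f(2) that by simp
  then show "\<forall>l\<in>T. f l \<in> L" using assms(2) by (metis subsetD)
qed

lemma indep_scale:
  assumes c: "c \<noteq> 0" and T: "T \<subseteq> lines"
  shows "indep (scale_set c L) T \<longleftrightarrow> indep L T"
proof -
  have 1: "indep (scale_set c L) T" if i: "indep L T" and c: "c \<noteq> 0" for c and L :: "('a^'b) set"
    unfolding indep_def
  proof (intro allI impI)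
    fix f assume f: "\<forall>l\<in>T. f l \<in> l" "(\<Sum>l\<in>T. f l) \<in> scale_set c L"
    then obtain y where y: "y \<in> L" "(\<Sum>l\<in>T. f l) = c *s y" by (auto simp: scale_set_def)
    have "(\<Sum>l\<in>T. (1 / c) *s f l) = (1 / c) *s (\<Sum>l\<in>T. f l)" by (rule vec.scale_sum_right[symmetric])
    also have "\<dots> = y" using c by (simp add: y vec.scale_scale)
    finally have "(\<Sum>l\<in>T. (1 / c) *s f l) \<in> L" using y(1) by simp
    moreover have "\<forall>l\<in>T. (1 / c) *s f l \<in> l" using f(1) T lines_scale by blast
    ultimately have "(1 / c) *s f l \<in> L" if "l \<in> T" for l
      using indepD[OF i, of "\<lambda>l. (1 / c) *s f l" l] that by simp
    moreover have "f l = c *s ((1 / c) *s f l)" for l using c by (simp add: vec.scale_scale)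
    ultimately show "\<forall>l\<in>T. f l \<in> scale_set c L" unfolding scale_set_def by blast
  qed
  have "scale_set (1 / c) (scale_set c L) = L"
    using c by (simp add: scale_set_def image_image vec.scale_scale)
  then show ?thesis using 1[of L c] 1[of "scale_set c L" "1 / c"] c by auto
qed

text \<open>The reason for the form of \<open>indep\<close>: phrased by membership in the lattice,
  it passes to intersections at once, and this closure produces the cone points of descending
  links.\<close>

lemma indep_Int: "indep L T \<Longrightarrow> indep M T \<Longrightarrow> indep (L \<inter> M) T"
  unfolding indep_def by simp

lemma indep_empty: "indep L {}"
  by (simp add: indep_def)

lemma span_Union_lines:
  assumes "finite U" "U \<subseteq> lines" "w \<in> vec.span (\<Union>U)"
  obtains f where "\<And>l. l \<in> U \<Longrightarrow> f l \<in> l" "w = (\<Sum>l\<in>U. f l)"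
proof -
  let ?W = "{w. \<exists>f. (\<forall>l\<in>U. f l \<in> l) \<and> w = (\<Sum>l\<in>U. f l)}"
  have sub: "\<exists>x. l = vec.span {x}" if "l \<in> U" for l using assms(2) that by (auto simp: lines_def)
  have "vec.subspace ?W"
  proof (rule vec.subspaceI)
    show "0 \<in> ?W" using assms(2) lines_zero by (intro CollectI exI[of _ "\<lambda>_. 0"]) auto
  next
    fix x y assume "x \<in> ?W" "y \<in> ?W"
    then obtain f g where "\<forall>l\<in>U. f l \<in> l" "x = (\<Sum>l\<in>U. f l)" "\<forall>l\<in>U. g l \<in> l" "y = (\<Sum>l\<in>U. g l)" by blast
    moreover then have "\<forall>l\<in>U. f l + g l \<in> l" using sub vec.span_add by fast
    ultimately show "x + y \<in> ?W" by (intro CollectI exI[of _ "\<lambda>l. f l + g l"]) (auto simp: sum.distrib)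
  next
    fix c x assume "x \<in> ?W"
    then obtain f where "\<forall>l\<in>U. f l \<in> l" "x = (\<Sum>l\<in>U. f l)" by blast
    moreover then have "\<forall>l\<in>U. c *s f l \<in> l" using lines_scale assms(2) by blast
    ultimately show "c *s x \<in> ?W" by (intro CollectI exI[of _ "\<lambda>l. c *s f l"]) (auto simp: vec.scale_sum_right)
  qed
  moreover have "\<Union>U \<subseteq> ?W"
  proof
    fix x assume "x \<in> \<Union>U"
    then obtain l where "l \<in> U" "x \<in> l" by blast
    then show "x \<in> ?W" using assms(1,2) lines_zero
      by (intro CollectI exI[of _ "\<lambda>m. if m = l then x else 0"]) auto
  qed
  ultimately have "w \<in> ?W" using vec.span_minimal assms(3) by blast
  then show thesis using that by blast
qed

text \<open>Models the union of the homothety classes of a simplex, the periodic chain of lattices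
  through its vertices. \<open>LL_separates\<close> makes the associated norm definite.\<close>

locale lattice_chain =
  fixes LL :: "('k::field^'n) set set"
  assumes LL_zero: "L \<in> LL \<Longrightarrow> 0 \<in> L"
    and LL_add: "L \<in> LL \<Longrightarrow> x \<in> L \<Longrightarrow> y \<in> L \<Longrightarrow> x + y \<in> L"
    and LL_uminus: "L \<in> LL \<Longrightarrow> x \<in> L \<Longrightarrow> - x \<in> L"
    and LL_scale: "L \<in> LL \<Longrightarrow> c \<noteq> 0 \<Longrightarrow> scale_set c L \<in> LL"
    and LL_chain: "L \<in> LL \<Longrightarrow> M \<in> LL \<Longrightarrow> L \<subseteq> M \<or> M \<subseteq> L"
    and LL_separates: "a \<noteq> 0 \<Longrightarrow> \<exists>L\<in>LL. a \<notin> L"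
begin

lemma LL_diff: "L \<in> LL \<Longrightarrow> x \<in> L \<Longrightarrow> y \<in> L \<Longrightarrow> x - y \<in> L"
  using LL_add[of L x "- y"] LL_uminus by simp

lemma LL_sum: "L \<in> LL \<Longrightarrow> (\<And>i. i \<in> I \<Longrightarrow> f i \<in> L) \<Longrightarrow> sum f I \<in> L"
  by (induction I rule: infinite_finite_induct) (auto simp: LL_zero LL_add)

text \<open>A chain \<open>LL\<close> that is stable under homothety is the set of balls of a non-archimedean norm; the
  condition below says that some \<open>a \<in> b\<close> is strictly closer to the span of \<open>U\<close> than to \<open>0\<close>.\<close>

definition closes :: "('k^'n) set set \<Rightarrow> ('k^'n) set set" where
  "closes U = {b. \<exists>a\<in>b. \<exists>w\<in>vec.span (\<Union>U). \<exists>L\<in>LL. a - w \<in> L \<and> a \<notin> L}"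

lemma closes_empty: "b \<notin> closes {}"
  by (auto simp: closes_def)

lemma closes_mono: "U \<subseteq> V \<Longrightarrow> closes U \<subseteq> closes V"
  unfolding closes_def using vec.span_mono[of "\<Union>U" "\<Union>V"] by blast

lemma closes_member: "b \<in> U \<Longrightarrow> b \<in> lines \<Longrightarrow> b \<in> closes U"
proof -
  assume b: "b \<in> U" "b \<in> lines"
  then obtain a where a: "a \<in> b" "a \<noteq> 0" using lines_nonzero by blast
  then obtain L where "L \<in> LL" "a \<notin> L" using LL_separates by blast
  moreover have "a \<in> vec.span (\<Union>U)" using a b by (auto intro: vec.span_base)
  ultimately show ?thesis using a LL_zero unfolding closes_def
    by (intro CollectI bexI[of _ a] bexI[of _ L] conjI) auto
qed

text \<open>Independence of \<open>b\<close> and \<open>U\<close> at every ball is orthogonality, so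
  subtracting an element of the span of \<open>U\<close> cannot make a vector of \<open>b\<close>
  shorter.\<close>

lemma not_closes_if_indep:
  assumes "\<And>L. L \<in> LL \<Longrightarrow> indep L (insert b U)" "finite U" "U \<subseteq> lines" "b \<in> lines" "b \<notin> U"
  shows "b \<notin> closes U"
proof
  assume "b \<in> closes U"
  then obtain a w L where a: "a \<in> b" "w \<in> vec.span (\<Union>U)" "L \<in> LL" "a - w \<in> L" "a \<notin> L"
    by (auto simp: closes_def)
  obtain f where f: "\<And>l. l \<in> U \<Longrightarrow> f l \<in> l" "w = (\<Sum>l\<in>U. f l)"
    using span_Union_lines[OF assms(2,3) a(2)] by blast
  let ?g = "\<lambda>l. if l = b then a else - f l"
  have "(\<Sum>l\<in>U. ?g l) = (\<Sum>l\<in>U. - f l)"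
    by (rule sum.cong) (use assms(5) in auto)
  then have "(\<Sum>l\<in>insert b U. ?g l) = a - w"
    using assms(2,5) by (simp add: f(2) sum_negf)
  moreover have "?g l \<in> l" if "l \<in> insert b U" for l
    using a(1) f(1) lines_uminus assms(3) that by auto
  ultimately have "?g b \<in> L"
    using indepD[OF assms(1)[OF a(3)], of ?g b] a(4) by simp
  then show False using a(5) by simp
qed

lemma finite_chain_union:
  assumes "finite F" "F \<subseteq> LL" "F \<noteq> {}"
  obtains M where "M \<in> F" "\<And>L. L \<in> F \<Longrightarrow> L \<subseteq> M"
proof -
  obtain M where M: "M \<in> F" "\<forall>L\<in>F. M \<subseteq> L \<longrightarrow> M = L"
    using finite_has_maximal[OF assms(1,3)] by blast
  then have "L \<subseteq> M" if "L \<in> F" for L using LL_chain assms(2) that by blast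
  with M(1) that show thesis by blast
qed

text \<open>Closeness is invariant under scaling, because \<open>LL\<close> is stable under
  homothety; hence any nonzero vector of \<open>b\<close> can be the witness.\<close>

lemma closes_member_witness:
  assumes "b \<in> closes U" "b \<in> lines" "a \<in> b" "a \<noteq> 0"
  obtains w L where "w \<in> vec.span (\<Union>U)" "L \<in> LL" "a - w \<in> L" "a \<notin> L"
proof -
  obtain x w L where x: "x \<in> b" "w \<in> vec.span (\<Union>U)" "L \<in> LL" "x - w \<in> L" "x \<notin> L"
    using assms(1) by (auto simp: closes_def)
  have "x \<noteq> 0" using x LL_zero by metis
  then obtain k where k: "a = k *s x" using lines_proportional[OF assms(2) x(1) assms(3)] by blast
  then have "k \<noteq> 0" using assms(4) by auto
  have "a - k *s w = k *s (x - w)" by (simp add: k vec.scale_right_diff_distrib)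
  then have "a - k *s w \<in> scale_set k L" using x(4) by (simp only: scale_set_def imageI)
  moreover have "a \<notin> scale_set k L"
    using x(5) \<open>k \<noteq> 0\<close> by (auto simp: scale_set_def k vec.scale_cancel_left)
  ultimately show thesis using that[of "k *s w" "scale_set k L"] x \<open>k \<noteq> 0\<close> LL_scale
    by (auto intro: vec.span_scale)
qed

end

locale ordered_lattice_chain = lattice_chain LL + monomial_order less
  for LL :: "('k::field^'n) set set" and less :: "('k^'n) set \<Rightarrow> ('k^'n) set \<Rightarrow> bool"
begin

text \<open>\<open>closes\<close> grows with its argument, so this is an initial segment of
  \<open>S\<close>. Its greatest element starts the smallest final segment of \<open>S\<close> whose
  span comes close to \<open>c\<close>; if it is empty, no such segment exists.\<close>

definition level :: "('k^'n) set set \<Rightarrow> ('k^'n) set \<Rightarrow> ('k^'n) set set" where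
  "level S c = {s \<in> S. c \<in> closes {t \<in> S. \<not> less t s}}"

lemma level_down_closed:
  assumes "s \<in> level S c" "s' \<in> S" "\<not> less s s'" shows "s' \<in> level S c"
proof -
  have "\<not> less t s'" if "\<not> less t s" for t
    using that assms(3) less_trans[of t s' s] less_linear[of s s'] by metis
  then have "closes {t \<in> S. \<not> less t s} \<subseteq> closes {t \<in> S. \<not> less t s'}"
    by (intro closes_mono) auto
  then show ?thesis using assms by (auto simp: level_def)
qed

text \<open>If no two lines of \<open>C\<close> have the same level, then \<open>C\<close> is a small perturbation of a family that is
  orthogonal for the norm defined by \<open>LL\<close>.\<close>

lemma indep_if_inj_on_level:
  assumes C: "finite C" "C \<subseteq> lines" and S: "finite S" and inj: "inj_on (level S) C" and L: "L \<in> LL"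
  shows "indep L C"
  unfolding indep_def
proof (intro allI impI, rule ccontr)
  fix f assume f: "\<forall>l\<in>C. f l \<in> l" "(\<Sum>l\<in>C. f l) \<in> L" "\<not> (\<forall>l\<in>C. f l \<in> L)"
  then obtain c1 where c1: "c1 \<in> C" "f c1 \<notin> L" by blast
  \<comment> \<open>\<open>N c\<close> stands for the norm of \<open>f c\<close>: by
    \<open>LL_chain\<close> these sets are nested, and a smaller \<open>N c\<close> means a longer
    vector.\<close>
  define N where "N c = {M \<in> LL. f c \<in> M}" for c
  have nested: "N c \<subseteq> N d \<or> N d \<subseteq> N c" for c d
    unfolding N_def using LL_chain by blast
  obtain m where m: "m \<in> C" "\<And>c. c \<in> C \<Longrightarrow> N m \<subseteq> N c"
  proof -
    obtain X where X: "X \<in> N ` C" "\<forall>Y\<in>N ` C. Y \<subseteq> X \<longrightarrow> X = Y"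
      using finite_has_minimal[of "N ` C"] C(1) c1(1) by blast
    then obtain m where m: "m \<in> C" "X = N m" by blast
    have "N m \<subseteq> N c" if "c \<in> C" for c
      using X(2) nested[of m c] m(2) that by auto
    with m(1) show thesis by (rule that)
  qed
  have mL: "f m \<notin> L" using m(2)[OF c1(1)] c1(2) L by (auto simp: N_def)
  define X where "X = {c \<in> C. N c = N m}"
  have "finite X" "m \<in> X" using C(1) m(1) by (auto simp: X_def)
  \<comment> \<open>Among the longest vectors, \<open>c0\<close> enters the flag last: its level is
    smallest.\<close>
  then obtain c0 where c0: "c0 \<in> X" "\<And>c. c \<in> X \<Longrightarrow> card (level S c0) \<le> card (level S c)"
    using arg_min_if_finite(1)[of X "\<lambda>c. card (level S c)"] arg_min_least[of X _ "\<lambda>c. card (level S c)"]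
    by (metis empty_iff)
  \<comment> \<open>A member of the flag close to all lines of \<open>X\<close> but
    \<open>c0\<close>. Levels are initial segments, so the least element of \<open>S\<close> outside
    the level of \<open>c0\<close> lies in every other level.\<close>
  obtain U where U: "\<And>c. c \<in> X - {c0} \<Longrightarrow> c \<in> closes U" "c0 \<notin> closes U"
  proof (cases "X = {c0}")
    case True
    then show thesis using that[of "{}"] closes_empty by blast
  next
    case False
    have fl: "finite (level S c)" for c using S by (simp add: level_def)
    have ex: "\<exists>q\<in>level S c. q \<notin> level S c0" if c: "c \<in> X - {c0}" for c
    proof (rule ccontr)
      assume "\<not> ?thesis"
      then have "level S c = level S c0"
        using card_subset_eq[OF fl, of "level S c" c0] c0(2)[of c] card_mono[OF fl, of "level S c" c0] c
        by (metis DiffD1 le_antisym subsetI)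
      then show False using inj c c0(1) by (auto simp: inj_on_def X_def)
    qed
    let ?Q = "S - level S c0"
    obtain c where "c \<in> X - {c0}" using False c0(1) by blast
    then have "?Q \<noteq> {}" using ex[of c] by (auto simp: level_def)
    then obtain s where s: "s \<in> ?Q" "\<And>x. x \<in> ?Q \<Longrightarrow> \<not> less x s"
      using finite_min_ex[of ?Q] S by (metis finite_Diff)
    have "s \<in> level S c" if c: "c \<in> X - {c0}" for c
    proof -
      obtain q where q: "q \<in> level S c" "q \<notin> level S c0" using ex[OF c] by blast
      then have "\<not> less q s" using s(2)[of q] by (auto simp: level_def)
      then show ?thesis using level_down_closed[OF q(1)] s(1) by blast
    qed
    then show thesis using s(1) by (intro that[of "{t \<in> S. \<not> less t s}"]) (auto simp: level_def)
  qed
  \<comment> \<open>Modulo the span of \<open>U\<close>, every term other than that of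
    \<open>c0\<close> is shorter than \<open>f m\<close>: the longest ones by closeness, the others
    as they are.\<close>
  have "\<exists>w M. w \<in> vec.span (\<Union>U) \<and> M \<in> LL \<and> f c - w \<in> M \<and> f m \<notin> M" if c: "c \<in> C - {c0}" for c
  proof (cases "c \<in> X")
    case True
    then have "f c \<notin> L" using mL L by (auto simp: X_def N_def)
    then have "f c \<noteq> 0" using L LL_zero by metis
    moreover have "c \<in> closes U" "c \<in> lines" "f c \<in> c" using U(1) True c f(1) C(2) by auto
    ultimately obtain w M where M: "w \<in> vec.span (\<Union>U)" "M \<in> LL" "f c - w \<in> M" "f c \<notin> M"
      using closes_member_witness[of c U "f c"] by metis
    moreover have "f m \<notin> M" using True M(2,4) by (auto simp: X_def N_def)
    ultimately show ?thesis by blast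
  next
    case False
    then have "N m \<subset> N c" using m(2)[of c] c by (auto simp: X_def)
    then obtain M where "M \<in> LL" "f c \<in> M" "f m \<notin> M" by (auto simp: N_def)
    then show ?thesis by (intro exI[of _ 0] exI[of _ M]) (auto intro: vec.span_zero)
  qed
  then obtain w M where wM: "\<And>c. c \<in> C - {c0} \<Longrightarrow> w c \<in> vec.span (\<Union>U) \<and> M c \<in> LL \<and> f c - w c \<in> M c \<and> f m \<notin> M c"
    by metis
  obtain K where K: "K \<in> insert L (M ` (C - {c0}))" "\<And>J. J \<in> insert L (M ` (C - {c0})) \<Longrightarrow> J \<subseteq> K"
    by (rule finite_chain_union[of "insert L (M ` (C - {c0}))"]) (use C(1) wM L in auto)
  have KLL: "K \<in> LL" and mK: "f m \<notin> K" using K(1) wM L mL by auto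
  have c0C: "c0 \<in> C" using c0(1) by (simp add: X_def)
  have c0K: "f c0 \<notin> K" using c0(1) KLL mK by (auto simp: X_def N_def)
  \<comment> \<open>Solving the relation for \<open>f c0\<close> exhibits it as close to the span of
    \<open>U\<close>.\<close>
  let ?w = "- (\<Sum>c\<in>C - {c0}. w c)"
  have "f c0 - ?w = (\<Sum>l\<in>C. f l) - (\<Sum>c\<in>C - {c0}. f c - w c)"
    by (simp add: sum.remove[OF C(1) c0C] sum_subtractf)
  also have "\<dots> \<in> K"
  proof (rule LL_diff[OF KLL])
    show "(\<Sum>l\<in>C. f l) \<in> K" using K(2)[of L] f(2) by auto
    show "(\<Sum>c\<in>C - {c0}. f c - w c) \<in> K"
    proof (rule LL_sum[OF KLL])
      fix c assume c: "c \<in> C - {c0}"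
      then have "M c \<subseteq> K" by (intro K(2)) blast
      then show "f c - w c \<in> K" using wM[OF c] by blast
    qed
  qed
  finally have "f c0 - ?w \<in> K" .
  moreover have "?w \<in> vec.span (\<Union>U)" using wM by (intro vec.span_neg vec.span_sum) blast
  ultimately have "c0 \<in> closes U" unfolding closes_def using f(1) c0C KLL c0K by blast
  then show False using U(2) by blast
qed

text \<open>The functional \<open>\<phi>\<close> below is the iterated residue along the flag of the spans of the final segments of
  \<open>S\<close>. It annihilates \<open>dep_ideal A Dep\<close> because \<open>\<delta>\<close> is the sum of the contractions with the layers of the
  flag and contractions anticommute and square to zero.\<close>

lemma no_leading_nbc_monomial:
  fixes f :: "('k^'n) set set \<Rightarrow> 'r::{comm_ring, comm_monoid_mult}"
  assumes A: "A \<subseteq> lines" and S: "finite S" "S \<subseteq> A"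
    and Dep: "\<And>T. Dep T \<longleftrightarrow> (\<exists>L\<in>LL. \<not> indep L T)"
    and nbc: "\<And>b L. b \<in> A \<Longrightarrow> L \<in> LL \<Longrightarrow> indep L (insert b {s \<in> S. less b s})"
    and f: "f \<in> dep_ideal A Dep" and lead: "\<And>T. f T \<noteq> 0 \<Longrightarrow> T = S \<or> colex T S"
  shows "f S = 0"
proof -
  \<comment> \<open>The absence of broken circuits says that a line of \<open>A\<close> below
    \<open>s\<close> is not close to the span of the lines of \<open>S\<close> from \<open>s\<close>
    on.\<close>
  have not_closes: "b \<notin> closes {t \<in> S. \<not> less t s}" if b: "b \<in> A" "less b s" for b s
  proof (rule not_closes_if_indep)
    have "\<not> less t s \<Longrightarrow> less b t" for t
      using b(2) less_linear[of t s] less_trans[of b s t] by metis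
    then have sub: "insert b {t \<in> S. \<not> less t s} \<subseteq> insert b {s \<in> S. less b s}" by auto
    show "indep L (insert b {t \<in> S. \<not> less t s})" if "L \<in> LL" for L
      by (rule indep_subset[OF nbc[OF b(1) that] sub]) (use S A b(1) in auto)
  qed (use S A b in auto)
  define top where "top s = {t \<in> S. \<not> less s t}" for s
  \<comment> \<open>The lines of \<open>S\<close> itself enter the flag one at a time, each at its
    own step.\<close>
  have level_S: "level S s = top s" if "s \<in> S" for s
  proof -
    have "t \<in> level S s \<longleftrightarrow> \<not> less s t" if t: "t \<in> S" for t
    proof
      assume "\<not> less s t"
      then show "t \<in> level S s"
        using closes_member[of s "{x \<in> S. \<not> less x t}"] \<open>s \<in> S\<close> t S A by (auto simp: level_def)
    next
      assume "t \<in> level S s"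
      then show "\<not> less s t" using not_closes[of s t] \<open>s \<in> S\<close> S by (auto simp: level_def)
    qed
    then show ?thesis by (auto simp: level_def top_def)
  qed
  have top_inj: "s = s'" if "s \<in> S" "s' \<in> S" "top s = top s'" for s s'
    using that less_linear[of s s'] less_irrefl by (auto simp: top_def)
  have level_cases: "level S c = {} \<or> (\<exists>s\<in>S. level S c = top s)" for c
  proof (cases "level S c = {}")
    case False
    have "finite (level S c)" using S by (simp add: level_def)
    then obtain s where s: "s \<in> level S c" "\<And>x. x \<in> level S c \<Longrightarrow> \<not> less s x"
      using False finite_max_ex[of "level S c"] by metis
    then have "level S c = top s"
      using level_down_closed[OF s(1)] by (auto simp: top_def level_def)
    then show ?thesis using s(1) by (auto simp: level_def)
  qed simp
  obtain xs where xs: "distinct xs" "set xs = S" using finite_distinct_list[OF S(1)] by blast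
  let ?H = "\<lambda>h. {c. level S c = h}"
  define \<phi> :: "(('k^'n) set set \<Rightarrow> 'r) \<Rightarrow> 'r" where "\<phi> g = contrs (map ?H (map top xs)) g {}" for g
  \<comment> \<open>A surviving monomial would be a transversal of distinct levels, hence
    independent by \<open>indep_if_inj_on_level\<close>, while \<open>g\<close> has only dependent
    monomials.\<close>
  have vanish: "contrs (map ?H hs) g {} = 0" if g: "g \<in> dep_part A Dep" and hs: "distinct hs" for g :: "_ \<Rightarrow> 'r" and hs
  proof (rule ccontr)
    assume "contrs (map ?H hs) g {} \<noteq> 0"
    then obtain ts where ts: "map (level S) ts = hs" "g (set ts) \<noteq> 0"
      using contrs_nonzeroD[of "level S" hs g "{}"] by auto
    then have "Dep (set ts)" "set ts \<subseteq> A" using g by (auto simp: dep_part_def carrier_ext_alg)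
    moreover have "inj_on (level S) (set ts)" using hs ts(1) by (auto simp: distinct_map)
    ultimately show False using indep_if_inj_on_level[of "set ts" S] A S(1) Dep by auto
  qed
  have dist: "distinct (map top xs)" using xs top_inj by (auto simp: distinct_map inj_on_def)
  have top_ne: "top s \<noteq> {}" if "s \<in> S" for s using that less_irrefl by (auto simp: top_def)
  have der: "\<phi> (ext_der g) = 0" if g: "g \<in> dep_part A Dep" for g
  proof -
    note gc = dep_part_carrier[OF g]
    \<comment> \<open>Every level is empty or some \<open>top s\<close>, so the derivation splits
      into finitely many contractions, one for each layer.\<close>
    have "UNIV = ?H {} \<union> (\<Union>s\<in>S. ?H (top s))" using level_cases by auto
    moreover have "?H {} \<inter> (\<Union>s\<in>S. ?H (top s)) = {}" using top_ne by auto
    ultimately have "ext_der g = contr (?H {}) g + contr (\<Union>s\<in>S. ?H (top s)) g"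
      unfolding ext_der_contr using contr_disjoint_Un[OF gc] by metis
    also have "contr (\<Union>s\<in>S. ?H (top s)) g = (\<Sum>s\<in>S. contr (?H (top s)) g)"
      by (rule contr_disjoint_UNION[OF gc S(1)]) (use top_inj in \<open>auto simp: disjoint_family_on_def\<close>)
    finally have "contrs (map ?H (map top xs)) (ext_der g) =
        contrs (map ?H (map top xs)) (contr (?H {}) g) + (\<Sum>s\<in>S. contrs (map ?H (map top xs)) (contr (?H (top s)) g))"
      using contrs_add[OF contr_in_carrier[OF gc] sum_in_carrier[OF contr_in_carrier[OF gc]]]
        contrs_sum[OF contr_in_carrier[OF gc]] by metis
    \<comment> \<open>A layer already present in \<phi> kills itself. Only the lines of empty level
      remain, and they prolong the list by one new level.\<close>
    also have "(\<Sum>s\<in>S. contrs (map ?H (map top xs)) (contr (?H (top s)) g)) = 0"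
      by (intro sum.neutral ballI contrs_contr_mem[OF gc]) (use xs(2) in auto)
    finally have "\<phi> (ext_der g) = contrs (map ?H (map top xs)) (contr (?H {}) g) {}"
      unfolding \<phi>_def by (simp only: add_0_right)
    also have "\<dots> = contrs (map ?H (map top xs @ [{}])) g {}" by (simp add: contrs_append)
    also have "\<dots> = 0" by (rule vanish[OF g]) (use dist top_ne xs(2) in auto)
    finally show ?thesis .
  qed
  obtain g1 g2 where g: "f = g1 + ext_der g2" "g1 \<in> dep_part A Dep" "g2 \<in> dep_part A Dep"
    using f by (rule dep_idealE)
  have "\<phi> f = \<phi> g1 + \<phi> (ext_der g2)"
    unfolding g(1) \<phi>_def ext_der_contr
    by (subst contrs_add[OF dep_part_carrier[OF g(2)] contr_in_carrier[OF dep_part_carrier[OF g(3)]]]) simp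
  also have "\<dots> = 0" using der[OF g(3)] vanish[OF g(2) dist] by (simp add: \<phi>_def)
  finally have f0: "\<phi> f = 0" .
  define f' where "f' = f - ext_mon S (f S)"
  have fc: "f \<in> carrier (ext_alg A)" by (rule dep_ideal_carrier[OF f])
  have mc: "ext_mon S (f S) \<in> carrier (ext_alg A)" by (rule ext_mon_in_carrier[OF S])
  have f'c: "f' \<in> carrier (ext_alg A)" unfolding f'_def by (rule diff_in_carrier[OF fc mc])
  \<comment> \<open>Another monomial of \<open>f\<close> seen by \<phi> would be a transversal
    \<open>t\<close> of the levels with no \<open>t s\<close> below \<open>s\<close>, and such a set
    does not precede \<open>S\<close> in \<open>colex\<close>.\<close>
  have "\<phi> f' = 0"
  proof (rule ccontr)
    assume "\<phi> f' \<noteq> 0"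
    then obtain ts where ts: "map (level S) ts = map top xs" "f' (set ts) \<noteq> 0"
      unfolding \<phi>_def using contrs_nonzeroD[of "level S" "map top xs" f' "{}"] by auto
    have "set ts \<noteq> S" using ts(2) by (auto simp: f'_def ext_mon_def)
    moreover then have "f (set ts) \<noteq> 0" using ts(2) by (simp add: f'_def ext_mon_def)
    ultimately have less: "colex (set ts) S" and sub: "set ts \<subseteq> A"
      using lead fc by (auto simp: carrier_ext_alg)
    have len: "length ts = length xs" using arg_cong[OF ts(1), of length] by simp
    have lev: "level S (ts ! i) = top (xs ! i)" if "i < length xs" for i
      using arg_cong[OF ts(1), of "\<lambda>l. l ! i"] that len by simp
    define t where "t s = ts ! (THE i. i < length xs \<and> xs ! i = s)" for s
    have t: "t (xs ! i) = ts ! i" if "i < length xs" for i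
    proof -
      have "(THE j. j < length xs \<and> xs ! j = xs ! i) = i"
        using that xs(1) by (intro the_equality) (auto simp: nth_eq_iff_index_eq)
      then show ?thesis by (simp add: t_def)
    qed
    have lev_t: "level S (t s) = top s" and t_mem: "t s \<in> set ts" if "s \<in> S" for s
    proof -
      obtain i where "i < length xs" "xs ! i = s" using \<open>s \<in> S\<close> xs(2) by (metis in_set_conv_nth)
      then show "level S (t s) = top s" "t s \<in> set ts" using t[of i] lev[of i] len by auto
    qed
    have "t ` S = set ts"
    proof
      show "set ts \<subseteq> t ` S"
      proof
        fix y assume "y \<in> set ts"
        then obtain i where i: "i < length xs" "y = ts ! i" using len by (metis in_set_conv_nth)
        then show "y \<in> t ` S" using t[OF i(1)] xs(2) by (metis imageI nth_mem)
      qed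
    qed (use t_mem in auto)
    moreover have "inj_on t S" using lev_t top_inj by (metis inj_onI)
    moreover have "\<not> less (t s) s" if "s \<in> S" for s
    proof -
      have "s \<in> level S (t s)" using lev_t[OF that] that less_irrefl by (auto simp: top_def)
      then have "t s \<in> closes {x \<in> S. \<not> less x s}" by (simp add: level_def)
      then show ?thesis using not_closes[of "t s" s] t_mem[OF that] sub by blast
    qed
    ultimately show False using not_colex_transversal[OF S(1), of t] less by metis
  qed
  moreover have "f = ext_mon S (f S) + f'" by (simp add: f'_def)
  then have "\<phi> f = \<phi> (ext_mon S (f S) + f')" by (rule arg_cong)
  then have "\<phi> f = \<phi> (ext_mon S (f S)) + \<phi> f'"
    by (simp only: \<phi>_def contrs_add[OF mc f'c] plus_fun_apply)
  ultimately have "\<phi> (ext_mon S (f S)) = 0" using f0 by simp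
  moreover obtain n where "contrs (map (\<lambda>s. ?H (top s)) xs) (ext_mon S (f S)) {} = signed n (f S)"
  proof -
    have "?H (top s) \<inter> S = {s}" if "s \<in> set xs" for s
    proof -
      have s: "s \<in> S" using that xs(2) by simp
      have "x = s" if "x \<in> S" "level S x = top s" for x
        using top_inj[OF that(1) s] level_S[OF that(1)] that(2) by simp
      then show ?thesis using s level_S[OF s] by blast
    qed
    then show thesis using contrs_ext_mon[OF S(1) xs(1), of "{}" "\<lambda>s. ?H (top s)" "f S"] xs(2) that by auto
  qed
  ultimately show ?thesis by (simp add: \<phi>_def comp_def)
qed

end

section \<open>Lattices over a discrete valuation ring\<close>

locale valued_field =
  fixes v :: "'k::field \<Rightarrow> real" and p :: 'k
  assumes nonarch: "nonarch_abs v" and prime: "prime_element v p"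
begin

section \<open>Discreteness of the absolute value\<close>

lemma v_nonneg [simp]: "0 \<le> v x"
  and v_eq_0 [simp]: "v x = 0 \<longleftrightarrow> x = 0"
  and v_mult: "v (x * y) = v x * v y"
  and v_add: "v (x + y) \<le> max (v x) (v y)"
  and v_nontrivial: "\<exists>x. x \<noteq> 0 \<and> v x \<noteq> 1"
  using nonarch by (auto simp: nonarch_abs_def)

lemma v_pos: "x \<noteq> 0 \<Longrightarrow> 0 < v x"
  using v_nonneg[of x] v_eq_0[of x] by linarith

lemma v_0 [simp]: "v 0 = 0"
  by simp

lemma v_1 [simp]: "v 1 = 1"
  using v_mult[of 1 1] v_eq_0[of 1] by simp

lemma v_minus [simp]: "v (- x) = v x"
proof -
  have "v (- 1) * v (- 1) = 1" using v_mult[of "- 1" "- 1"] by simp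
  then have "(v (- 1) - 1) * (v (- 1) + 1) = 0" by (simp add: algebra_simps)
  moreover have "v (- 1) + 1 \<noteq> 0" using v_nonneg[of "- 1"] by linarith
  ultimately have "v (- 1) = 1" by simp
  then show ?thesis using v_mult[of "- 1" x] by simp
qed

lemma v_diff: "v (x - y) \<le> max (v x) (v y)"
  using v_add[of x "- y"] by simp

lemma v_divide: "v (x / y) = v x / v y"
proof (cases "y = 0")
  case False
  then have "v (x / y) * v y = v x" using v_mult[of "x / y" y] by simp
  then show ?thesis using False by (simp add: field_simps)
qed simp

lemma v_power: "v (x ^ n) = v x ^ n"
  by (induction n) (simp_all add: v_mult)

lemma v_mult_le_1: "v x \<le> 1 \<Longrightarrow> v y \<le> 1 \<Longrightarrow> v (x * y) \<le> 1"
  by (simp add: v_mult mult_le_one)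

lemma v_less_1_iff: "v x < 1 \<longleftrightarrow> (\<exists>y. v y \<le> 1 \<and> x = p * y)"
proof -
  have "{x. v x < 1} = (\<lambda>y. p * y) ` {x. v x \<le> 1}"
    using prime by (simp add: prime_element_def integer_ring_def)
  then have "x \<in> {x. v x < 1} \<longleftrightarrow> x \<in> (\<lambda>y. p * y) ` {x. v x \<le> 1}" by simp
  then show ?thesis by auto
qed

lemma v_p_less_1: "v p < 1"
  using v_less_1_iff[of p] by (metis mult.right_neutral order_refl v_1)

lemma p_nonzero: "p \<noteq> 0"
proof
  assume "p = 0"
  obtain x where x: "x \<noteq> 0" "v x \<noteq> 1" using v_nontrivial by blast
  have "v x < 1 \<or> v (1 / x) < 1"
    using x v_pos[OF x(1)] by (auto simp: v_divide field_simps)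
  then show False using v_less_1_iff[of x] v_less_1_iff[of "1 / x"] x(1) \<open>p = 0\<close> by auto
qed

lemma v_p_pos: "0 < v p"
  by (rule v_pos[OF p_nonzero])

lemma v_less_1_imp_le: "v x < 1 \<Longrightarrow> v x \<le> v p"
  using v_less_1_iff[of x] v_p_pos by (auto simp: v_mult mult_left_le)

lemma exists_small: "0 < r \<Longrightarrow> \<exists>c. c \<noteq> 0 \<and> v c < r \<and> v c \<le> 1"
proof -
  assume "0 < r"
  then obtain n where "v p ^ n < r" using real_arch_pow_inv[OF _ v_p_less_1] by blast
  moreover have "v p ^ n \<le> 1" using v_p_less_1 by (simp add: power_le_one)
  ultimately show ?thesis using p_nonzero by (intro exI[of _ "p ^ n"]) (auto simp: v_power)
qed

text \<open>Take the least \<open>n\<close> with \<open>v p ^ Suc n < v x\<close>. Then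
  \<open>x / p ^ n\<close> has value above \<open>v p\<close>, and so, by
  \<open>v_less_1_imp_le\<close>, not below 1.\<close>

lemma v_eq_power:
  assumes "x \<noteq> 0" "v x \<le> 1" shows "\<exists>n. v x = v p ^ n"
proof -
  obtain N where N: "v p ^ N < v x" using real_arch_pow_inv[OF v_pos[OF assms(1)] v_p_less_1] by blast
  define n where "n = (LEAST n. v p ^ Suc n < v x)"
  have "v p ^ Suc N \<le> v p ^ N * 1"
    using v_p_less_1 by (simp add: mult_left_le_one_le)
  then have "v p ^ Suc N < v x" using N by linarith
  then have n: "v p ^ Suc n < v x" unfolding n_def by (rule LeastI)
  have le: "v x \<le> v p ^ n"
  proof (cases n)
    case (Suc m)
    then have "\<not> v p ^ Suc m < v x" using not_less_Least[of m "\<lambda>n. v p ^ Suc n < v x"] n_def by simp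
    then show ?thesis using Suc by simp
  qed (simp add: assms(2))
  have pn: "0 < v p ^ n" using v_p_pos by simp
  have q: "v (x / p ^ n) = v x / v p ^ n" by (simp add: v_divide v_power)
  have "\<not> v (x / p ^ n) < 1"
  proof
    assume "v (x / p ^ n) < 1"
    then have "v x / v p ^ n \<le> v p" using v_less_1_imp_le q by metis
    then have "v x \<le> v p ^ Suc n" using pn by (simp add: pos_divide_le_eq)
    then show False using n by simp
  qed
  then have "v p ^ n \<le> v x" using q pn by (simp add: field_simps)
  then show ?thesis using le by (intro exI[of _ n]) simp
qed

text \<open>A largest value is a least exponent, so it exists even when \<open>X\<close> is
  infinite.\<close>

lemma v_maximal_ex:
  assumes "X \<noteq> {}" "\<And>x. x \<in> X \<Longrightarrow> v (g x) \<le> 1" "\<And>x. x \<in> X \<Longrightarrow> g x \<noteq> 0"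
  obtains m where "m \<in> X" "\<And>x. x \<in> X \<Longrightarrow> v (g x) \<le> v (g m)"
proof -
  define e where "e x = (SOME n. v (g x) = v p ^ n)" for x
  have e: "v (g x) = v p ^ e x" if "x \<in> X" for x
    unfolding e_def by (rule someI_ex) (rule v_eq_power[OF assms(3)[OF that] assms(2)[OF that]])
  obtain m where m: "m \<in> X" "\<And>x. x \<in> X \<Longrightarrow> e m \<le> e x"
    using ex_has_least_nat[of "\<lambda>x. x \<in> X" _ e] assms(1) by (metis ex_in_conv)
  have "v (g x) \<le> v (g m)" if "x \<in> X" for x
    using e[OF that] e[OF m(1)] power_decreasing[OF m(2)[OF that], of "v p"] v_p_less_1 v_p_pos by simp
  with m(1) that show thesis by blast
qed

lemma v_max_component:
  fixes y :: "'k^'n"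
  obtains j where "\<And>i. v (y $ i) \<le> v (y $ j)"
proof -
  have "Max (range (\<lambda>i. v (y $ i))) \<in> range (\<lambda>i. v (y $ i))"
    by (rule Max_in) auto
  then obtain j where "Max (range (\<lambda>i. v (y $ i))) = v (y $ j)" by blast
  then have "v (y $ i) \<le> v (y $ j)" for i
    using Max_ge[of "range (\<lambda>i. v (y $ i))" "v (y $ i)"] by simp
  then show thesis by (rule that)
qed

section \<open>Lattices as linear images of the unit box\<close>

definition box :: "('k^'n) set" where
  "box = {y. \<forall>i. v (y $ i) \<le> 1}"

definition lin :: "('n \<Rightarrow> 'k^'n) \<Rightarrow> 'k^'n \<Rightarrow> 'k^'n" where
  "lin b y = (\<Sum>i\<in>UNIV. y $ i *s b i)"

lemma lin_add: "lin b (y + z) = lin b y + lin b z"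
  by (simp add: lin_def vec.scale_left_distrib sum.distrib)

lemma lin_scale: "lin b (c *s y) = c *s lin b y"
  by (simp add: lin_def vec.scale_sum_right vec.scale_scale)

lemma lin_diff: "lin b (y - z) = lin b y - lin b z"
  by (simp add: lin_def vec.scale_left_diff_distrib sum_subtractf)

lemma lin_0 [simp]: "lin b 0 = 0"
  by (simp add: lin_def)

lemma lin_sum: "lin b (\<Sum>j\<in>J. f j) = (\<Sum>j\<in>J. lin b (f j))"
  by (induction J rule: infinite_finite_induct) (simp_all add: lin_add)

text \<open>A linear relation over the field becomes one over the integers after division by a
  coordinate of largest value, so integral independence of a basis is independence over the
  field.\<close>

lemma is_lattice_iff:
  "is_lattice v L \<longleftrightarrow> (\<exists>b. L = lin b ` box \<and> (\<forall>y. lin b y = 0 \<longrightarrow> y = 0))"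
proof -
  have set_eq: "{\<Sum>i\<in>UNIV. c i *s b i | c. \<forall>i. c i \<in> integer_ring v} = lin b ` box" for b :: "'a \<Rightarrow> 'k^'a"
  proof
    show "{\<Sum>i\<in>UNIV. c i *s b i | c. \<forall>i. c i \<in> integer_ring v} \<subseteq> lin b ` box"
    proof
      fix x assume "x \<in> {\<Sum>i\<in>UNIV. c i *s b i | c. \<forall>i. c i \<in> integer_ring v}"
      then obtain c where c: "x = (\<Sum>i\<in>UNIV. c i *s b i)" "\<forall>i. c i \<in> integer_ring v" by blast
      then have "x = lin b (vec_lambda c)" "vec_lambda c \<in> box"
        by (simp_all add: lin_def box_def integer_ring_def)
      then show "x \<in> lin b ` box" by blast
    qed
    show "lin b ` box \<subseteq> {\<Sum>i\<in>UNIV. c i *s b i | c. \<forall>i. c i \<in> integer_ring v}"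
    proof
      fix x assume "x \<in> lin b ` box"
      then obtain y where "y \<in> box" "x = lin b y" by blast
      then show "x \<in> {\<Sum>i\<in>UNIV. c i *s b i | c. \<forall>i. c i \<in> integer_ring v}"
        by (intro CollectI exI[of _ "\<lambda>i. y $ i"]) (simp add: lin_def box_def integer_ring_def)
    qed
  qed
  have indep: "(\<forall>c. (\<forall>i. c i \<in> integer_ring v) \<and> (\<Sum>i\<in>UNIV. c i *s b i) = 0 \<longrightarrow> (\<forall>i. c i = 0)) \<longleftrightarrow>
      (\<forall>y. lin b y = 0 \<longrightarrow> y = 0)" (is "?l \<longleftrightarrow> ?r") for b :: "'a \<Rightarrow> 'k^'a"
  proof
    assume l: ?l
    show ?r
    proof (intro allI impI, rule ccontr)
      fix y assume y: "lin b y = 0" "y \<noteq> 0"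
      obtain j where j: "\<And>i. v (y $ i) \<le> v (y $ j)" using v_max_component[of y] by blast
      have "y $ j \<noteq> 0"
      proof
        assume "y $ j = 0"
        then have "v (y $ i) \<le> 0" for i using j[of i] by simp
        then have "y $ i = 0" for i using v_nonneg[of "y $ i"] v_eq_0[of "y $ i"] by (metis order_antisym)
        then show False using y(2) by (simp add: vec_eq_iff)
      qed
      then have "v (y $ i / y $ j) \<le> 1" for i using j[of i] v_pos[of "y $ j"] by (simp add: v_divide)
      moreover have "(\<Sum>i\<in>UNIV. (y $ i / y $ j) *s b i) = lin b ((1 / y $ j) *s y)"
        by (simp add: lin_def)
      then have "(\<Sum>i\<in>UNIV. (y $ i / y $ j) *s b i) = 0" using y(1) by (simp add: lin_scale)
      ultimately have "(\<forall>i. y $ i / y $ j \<in> integer_ring v) \<and> (\<Sum>i\<in>UNIV. (y $ i / y $ j) *s b i) = 0"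
        unfolding integer_ring_def by blast
      then have "\<forall>i. y $ i / y $ j = 0"
        by (rule l[THEN spec[of _ "\<lambda>i. y $ i / y $ j"], THEN mp])
      then have "y $ j / y $ j = 0" ..
      then show False using \<open>y $ j \<noteq> 0\<close> by simp
    qed
  next
    assume r: ?r
    show ?l
    proof (intro allI impI)
      fix c i assume "(\<forall>i. c i \<in> integer_ring v) \<and> (\<Sum>i\<in>UNIV. c i *s b i) = 0"
      then have "lin b (vec_lambda c) = 0" by (simp add: lin_def)
      then have "vec_lambda c = 0" using r by blast
      then show "c i = 0" by (simp add: vec_eq_iff)
    qed
  qed
  show ?thesis unfolding is_lattice_def set_eq indep ..
qed

lemma inj_lin:
  assumes "\<forall>y. lin b y = 0 \<longrightarrow> y = 0" shows "inj (lin b)"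
proof (rule injI)
  fix x y assume "lin b x = lin b y"
  then have "lin b (x - y) = 0" by (simp add: lin_diff)
  then have "x - y = 0" using assms by blast
  then show "x = y" by simp
qed

lemma surj_lin:
  fixes b :: "'n \<Rightarrow> 'k^'n"
  assumes "\<forall>y. lin b y = 0 \<longrightarrow> y = 0" shows "surj (lin b)"
proof (rule vec.linear_inj_imp_surj)
  show "Vector_Spaces.linear (*s) (*s) (lin b)"
    by (simp add: Vector_Spaces.linear_iff lin_add lin_scale vec.vector_space_axioms)
qed (rule inj_lin[OF assms])

lemma lattice_basis:
  fixes L :: "('k^'n) set"
  assumes "is_lattice v L"
  obtains b where "L = lin b ` box" "\<forall>y. lin b y = 0 \<longrightarrow> y = 0" "inj (lin b)" "surj (lin b)"
proof -
  obtain b where "L = lin b ` box" "\<forall>y. lin b y = 0 \<longrightarrow> y = 0"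
    using assms unfolding is_lattice_iff by (elim exE conjE)
  then show thesis by (intro that[of b] inj_lin surj_lin)
qed

section \<open>Submodules over the integers and homotheties\<close>

definition submodule :: "('k^'n) set \<Rightarrow> bool" where
  "submodule L \<longleftrightarrow> 0 \<in> L \<and> (\<forall>x\<in>L. \<forall>y\<in>L. x + y \<in> L) \<and> (\<forall>c. \<forall>x\<in>L. v c \<le> 1 \<longrightarrow> c *s x \<in> L)"

lemma submodule_zero: "submodule L \<Longrightarrow> 0 \<in> L"
  and submodule_add: "submodule L \<Longrightarrow> x \<in> L \<Longrightarrow> y \<in> L \<Longrightarrow> x + y \<in> L"
  and submodule_scale: "submodule L \<Longrightarrow> x \<in> L \<Longrightarrow> v c \<le> 1 \<Longrightarrow> c *s x \<in> L"
  by (simp_all add: submodule_def)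

lemma submodule_uminus: "submodule L \<Longrightarrow> x \<in> L \<Longrightarrow> - x \<in> L"
  using submodule_scale[of L x "- 1"] by simp

lemma submodule_diff: "submodule L \<Longrightarrow> x \<in> L \<Longrightarrow> y \<in> L \<Longrightarrow> x - y \<in> L"
  using submodule_add[of L x "- y"] submodule_uminus[of L y] by simp

lemma submodule_Int: "submodule L \<Longrightarrow> submodule M \<Longrightarrow> submodule (L \<inter> M)"
  by (simp add: submodule_def)

lemma submodule_sum: "submodule L \<Longrightarrow> (\<And>i. i \<in> I \<Longrightarrow> f i \<in> L) \<Longrightarrow> sum f I \<in> L"
  by (induction I rule: infinite_finite_induct) (auto simp: submodule_zero submodule_add)

lemma submodule_box: "submodule box"
  unfolding submodule_def box_def
  by (auto simp: v_mult_le_1 intro: order_trans[OF v_add])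

lemma submodule_lattice: "is_lattice v L \<Longrightarrow> submodule L"
proof -
  assume "is_lattice v L"
  then obtain b where b: "L = lin b ` box" by (auto simp: is_lattice_iff)
  have "x + y \<in> L" if xy: "x \<in> L" "y \<in> L" for x y
  proof -
    obtain x' y' where "x = lin b x'" "y = lin b y'" "x' \<in> box" "y' \<in> box" using xy b by blast
    then have "x + y = lin b (x' + y')" "x' + y' \<in> box"
      using submodule_add[OF submodule_box] by (simp_all add: lin_add)
    then show ?thesis using b by blast
  qed
  moreover have "c *s x \<in> L" if x: "x \<in> L" and c: "v c \<le> 1" for c x
  proof -
    obtain x' where "x = lin b x'" "x' \<in> box" using x b by blast
    then have "c *s x = lin b (c *s x')" "c *s x' \<in> box"
      using submodule_scale[OF submodule_box] c by (simp_all add: lin_scale)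
    then show ?thesis using b by blast
  qed
  moreover have "0 \<in> L" using b lin_0 submodule_zero[OF submodule_box] by (metis imageI)
  ultimately show ?thesis by (simp add: submodule_def)
qed

lemma scale_set_scale_set: "scale_set c (scale_set d L) = scale_set (c * d) L"
  by (simp add: scale_set_def image_image vec.scale_scale)

lemma scale_set_1 [simp]: "scale_set 1 L = L"
  by (simp add: scale_set_def)

lemma scale_set_mono: "L \<subseteq> M \<Longrightarrow> scale_set c L \<subseteq> scale_set c M"
  by (auto simp: scale_set_def)

lemma scale_set_subset_iff: "c \<noteq> 0 \<Longrightarrow> scale_set c L \<subseteq> scale_set c M \<longleftrightarrow> L \<subseteq> M"
proof
  assume c: "c \<noteq> 0" "scale_set c L \<subseteq> scale_set c M"
  from c(2) have "scale_set (1 / c) (scale_set c L) \<subseteq> scale_set (1 / c) (scale_set c M)"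
    by (rule scale_set_mono)
  then show "L \<subseteq> M" using c(1) by (simp add: scale_set_scale_set)
qed (rule scale_set_mono)

lemma scale_set_le:
  assumes "submodule L" "d \<noteq> 0" "v c \<le> v d" shows "scale_set c L \<subseteq> scale_set d L"
proof
  fix x assume "x \<in> scale_set c L"
  then obtain y where y: "y \<in> L" "x = c *s y" by (auto simp: scale_set_def)
  have "v (c / d) \<le> 1" using assms(2,3) v_pos by (simp add: v_divide)
  then have "(c / d) *s y \<in> L" using submodule_scale[OF assms(1) y(1)] by blast
  moreover have "x = d *s ((c / d) *s y)" using assms(2) by (simp add: y vec.scale_scale)
  ultimately show "x \<in> scale_set d L" unfolding scale_set_def by blast
qed

text \<open>Values are discrete, so a strict inequality leaves room for a whole factor
  \<open>p\<close>.\<close>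

lemma scale_set_less:
  assumes "submodule L" "d \<noteq> 0" "v c < v d" shows "scale_set c L \<subseteq> scale_set p (scale_set d L)"
proof -
  have "v (c / d) < 1" using assms(2,3) v_pos[OF assms(2)] by (simp add: v_divide)
  then have "v (c / d) \<le> v p" by (rule v_less_1_imp_le)
  then have "v c \<le> v (p * d)" using assms(2) v_pos[OF assms(2)] by (simp add: v_divide v_mult field_simps)
  then show ?thesis unfolding scale_set_scale_set using assms p_nonzero by (intro scale_set_le) auto
qed

lemma scale_set_p_subset: "submodule L \<Longrightarrow> scale_set p L \<subseteq> L"
  using scale_set_le[of L 1 p] v_p_less_1 by simp

lemma is_lattice_scale_set:
  assumes "is_lattice v L" "c \<noteq> 0" shows "is_lattice v (scale_set c L)"
proof -
  obtain b where b: "L = lin b ` box" "\<forall>y. lin b y = 0 \<longrightarrow> y = 0" using assms(1) by (auto simp: is_lattice_iff)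
  have lin: "lin (\<lambda>i. c *s b i) y = c *s lin b y" for y
    by (simp add: lin_def vec.scale_sum_right vec.scale_scale mult.commute)
  then have "scale_set c L = lin (\<lambda>i. c *s b i) ` box" by (simp add: b(1) scale_set_def image_image)
  moreover have "\<forall>y. lin (\<lambda>i. c *s b i) y = 0 \<longrightarrow> y = 0" using b(2) assms(2) by (simp add: lin)
  ultimately show ?thesis unfolding is_lattice_iff by blast
qed

lemma is_lattice_box: "is_lattice v (box :: ('k^'n) set)"
proof -
  have "lin (\<lambda>i. axis i 1) y = y" for y :: "'k^'n"
    by (simp add: lin_def vec_eq_iff axis_def if_distrib cong: if_cong)
  then show ?thesis unfolding is_lattice_iff by (intro exI[of _ "\<lambda>i. axis i 1"]) auto
qed

text \<open>Divide by the largest coordinate of \<open>a\<close> with respect to a basis of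
  \<open>L\<close>: one coordinate becomes 1, and all are integral.\<close>

lemma unimodular_multiple:
  fixes a :: "'k^'n"
  assumes L: "is_lattice v L" and a: "a \<noteq> 0"
  obtains c where "c \<noteq> 0" "c *s a \<in> L" "c *s a \<notin> scale_set p L"
proof -
  obtain b where b: "L = lin b ` box" "inj (lin b)" "surj (lin b)"
    using L by (rule lattice_basis)
  obtain y where y: "a = lin b y" using b(3) by (metis surjD)
  obtain j where j: "\<And>i. v (y $ i) \<le> v (y $ j)" using v_max_component[of y] by blast
  have "y \<noteq> 0" using y a by auto
  have yj: "y $ j \<noteq> 0"
  proof
    assume "y $ j = 0"
    then have "v (y $ i) \<le> 0" for i using j[of i] by simp
    then have "y $ i = 0" for i using v_nonneg[of "y $ i"] v_eq_0[of "y $ i"] by (metis order_antisym)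
    then show False using \<open>y \<noteq> 0\<close> by (simp add: vec_eq_iff)
  qed
  let ?c = "1 / y $ j"
  have ca: "?c *s a = lin b (?c *s y)" by (simp add: y lin_scale)
  have "?c *s y \<in> box" using j v_pos[OF yj] by (simp add: box_def v_divide)
  then have "?c *s a \<in> L" using ca b(1) by blast
  moreover have "?c *s a \<notin> scale_set p L"
  proof
    assume "?c *s a \<in> scale_set p L"
    then obtain z where z: "z \<in> box" "?c *s a = p *s lin b z" using b(1) by (auto simp: scale_set_def)
    then have "lin b (?c *s y) = lin b (p *s z)" using ca by (simp add: lin_scale)
    then have "?c *s y = p *s z" using b(2) by (simp add: inj_eq)
    then have "(?c *s y) $ j = p * z $ j" by simp
    then have "1 = v (p * z $ j)" using yj by simp
    moreover have "v (p * z $ j) < 1" using z(1) v_less_1_iff[of "p * z $ j"] by (auto simp: box_def)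
    ultimately show False by simp
  qed
  ultimately show thesis using yj by (intro that[of ?c]) auto
qed

lemma lattice_commensurable:
  fixes L M :: "('k^'n) set"
  assumes L: "is_lattice v L" and M: "is_lattice v M"
  obtains c where "c \<noteq> 0" "v c \<le> 1" "scale_set c L \<subseteq> M"
proof -
  obtain b where b: "L = lin b ` box" "\<forall>y. lin b y = 0 \<longrightarrow> y = 0" using L by (auto simp: is_lattice_iff)
  have sM: "submodule M" by (rule submodule_lattice[OF M])
  have "\<exists>c. c \<noteq> 0 \<and> c *s b i \<in> M" for i
  proof (cases "b i = 0")
    case True
    then show ?thesis using submodule_zero[OF sM] by (intro exI[of _ 1]) simp
  next
    case False
    then show ?thesis using unimodular_multiple[OF M] by metis
  qed
  then obtain c where c: "\<And>i. c i \<noteq> 0" "\<And>i. c i *s b i \<in> M" by metis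
  have "0 < Min (range (\<lambda>i. v (c i)))" using c(1) v_pos by simp
  then obtain d where d: "d \<noteq> 0" "v d < Min (range (\<lambda>i. v (c i)))" "v d \<le> 1" using exists_small by blast
  have db: "d *s b i \<in> M" for i
  proof -
    have "v d \<le> v (c i)" using d(2) by (simp add: less_imp_le)
    then have "v (d / c i) \<le> 1" using v_pos[OF c(1)] by (simp add: v_divide)
    then have "(d / c i) *s (c i *s b i) \<in> M" using submodule_scale[OF sM c(2)] by blast
    then show ?thesis using c(1) by (simp add: vec.scale_scale)
  qed
  have "scale_set d L \<subseteq> M"
  proof
    fix x assume "x \<in> scale_set d L"
    then obtain y where y: "y \<in> box" "x = d *s lin b y" using b(1) by (auto simp: scale_set_def)
    have "x = (\<Sum>i\<in>UNIV. y $ i *s (d *s b i))"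
      unfolding y(2) lin_def vec.scale_sum_right vec.scale_scale by (simp add: mult.commute)
    moreover have "y $ i *s (d *s b i) \<in> M" for i
      using submodule_scale[OF sM db] y(1) by (auto simp: box_def)
    ultimately show "x \<in> M" by (simp only: submodule_sum[OF sM])
  qed
  with d show thesis using that by blast
qed

section \<open>Submodules between commensurable lattices are lattices\<close>

definition basis_of :: "('k^'n) set \<Rightarrow> 'n set \<Rightarrow> ('n \<Rightarrow> 'k^'n) \<Rightarrow> bool" where
  "basis_of N J m \<longleftrightarrow> (\<forall>j\<in>J. m j \<in> N) \<and>
    (\<forall>y\<in>N. (\<forall>i. i \<notin> J \<longrightarrow> y $ i = 0) \<longrightarrow> (\<exists>x. (\<forall>j. v (x j) \<le> 1) \<and> y = (\<Sum>j\<in>J. x j *s m j))) \<and>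
    (\<forall>j\<in>J. \<forall>i. i \<notin> J \<longrightarrow> m j $ i = 0) \<and>
    (\<forall>x. (\<Sum>j\<in>J. x j *s m j) = 0 \<longrightarrow> (\<forall>j\<in>J. x j = 0))"

text \<open>As in the Hermite normal form, take in \<open>N\<close> a vector \<open>w\<close>
  supported on \<open>insert k J\<close> whose coordinate \<open>k\<close> has largest value. It
  divides the coordinate \<open>k\<close> of all others, and subtracting a multiple of
  \<open>w\<close> leads back to \<open>J\<close>. The multiples of unit vectors ensure that a
  nonzero such coordinate exists.\<close>

lemma submodule_box_basis:
  fixes N :: "('k^'n) set"
  assumes N: "submodule N" "N \<subseteq> box" and c: "c \<noteq> 0" "\<And>i. c *s axis i 1 \<in> N" and "finite J"
  shows "\<exists>m. basis_of N J m"
  using \<open>finite J\<close>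
proof (induction J rule: finite_induct)
  case empty
  have "\<exists>x. (\<forall>j. v (x j) \<le> 1) \<and> y = (\<Sum>j\<in>{}. x j *s (m j :: 'k^'n))" if "\<forall>i. y $ i = 0" for y and m :: "'n \<Rightarrow> 'k^'n"
    using that by (intro exI[of _ "\<lambda>_. 0"]) (simp add: vec_eq_iff)
  then show ?case unfolding basis_of_def by (intro exI[of _ "\<lambda>_. 0"]) simp
next
  case (insert k J)
  from insert.IH obtain m where "basis_of N J m" ..
  then have m: "j \<in> J \<Longrightarrow> m j \<in> N"
    "\<lbrakk>y \<in> N; \<And>i. i \<notin> J \<Longrightarrow> y $ i = 0\<rbrakk> \<Longrightarrow> \<exists>x. (\<forall>j. v (x j) \<le> 1) \<and> y = (\<Sum>j\<in>J. x j *s m j)"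
    "\<lbrakk>j \<in> J; i \<notin> J\<rbrakk> \<Longrightarrow> m j $ i = 0"
    "\<lbrakk>(\<Sum>j\<in>J. x j *s m j) = 0; j \<in> J\<rbrakk> \<Longrightarrow> x j = 0" for j i y x
    by (simp_all add: basis_of_def)
  let ?X = "{y \<in> N. (\<forall>i. i \<notin> insert k J \<longrightarrow> y $ i = 0) \<and> y $ k \<noteq> 0}"
  have "c *s axis k 1 \<in> ?X" using c by (auto simp: axis_def)
  then have "?X \<noteq> {}" by blast
  then obtain w where w: "w \<in> ?X" "\<And>y. y \<in> ?X \<Longrightarrow> v (y $ k) \<le> v (w $ k)"
    by (rule v_maximal_ex[of ?X "\<lambda>y. y $ k"]) (use N(2) in \<open>auto simp: box_def\<close>)
  define m' where "m' = m(k := w)"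
  have sum_m': "(\<Sum>j\<in>insert k J. x j *s m' j) = x k *s w + (\<Sum>j\<in>J. x j *s m j)" for x
  proof -
    have "(\<Sum>j\<in>J. x j *s m' j) = (\<Sum>j\<in>J. x j *s m j)"
      by (rule sum.cong) (use insert.hyps in \<open>auto simp: m'_def\<close>)
    then show ?thesis using insert.hyps by (simp add: m'_def)
  qed
  show ?case
    unfolding basis_of_def
  proof (intro exI[of _ m'] conjI ballI allI impI)
    fix j assume "j \<in> insert k J"
    then show "m' j \<in> N" using m(1) w(1) by (auto simp: m'_def)
    fix i assume "i \<notin> insert k J"
    then show "m' j $ i = 0" using m(3) w(1) \<open>j \<in> insert k J\<close> by (auto simp: m'_def)
  next
    fix y assume y: "y \<in> N" "\<forall>i. i \<notin> insert k J \<longrightarrow> y $ i = 0"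
    define t where "t = y $ k / w $ k"
    have wk: "w $ k \<noteq> 0" using w(1) by simp
    have t: "v t \<le> 1"
    proof (cases "y $ k = 0")
      case False
      then have "v (y $ k) \<le> v (w $ k)" using w(2) y by blast
      then show ?thesis using v_pos[OF wk] by (simp add: t_def v_divide)
    qed (simp add: t_def)
    have "y - t *s w \<in> N" using y(1) w(1) t by (intro submodule_diff submodule_scale N(1)) auto
    moreover have "(y - t *s w) $ i = 0" if "i \<notin> J" for i
      using that y(2) w(1) wk by (cases "i = k") (auto simp: t_def)
    ultimately obtain x where x: "\<forall>j. v (x j) \<le> 1" "y - t *s w = (\<Sum>j\<in>J. x j *s m j)"
      using m(2)[of "y - t *s w"] by blast
    let ?x = "x(k := t)"
    have "(\<Sum>j\<in>J. ?x j *s m j) = (\<Sum>j\<in>J. x j *s m j)"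
      by (rule sum.cong) (use insert.hyps in auto)
    then have "y = (\<Sum>j\<in>insert k J. ?x j *s m' j)"
      unfolding sum_m' using x(2) by (simp add: algebra_simps)
    then show "\<exists>x. (\<forall>j. v (x j) \<le> 1) \<and> y = (\<Sum>j\<in>insert k J. x j *s m' j)"
      using x(1) t by (intro exI[of _ ?x]) auto
  next
    fix x j assume "(\<Sum>j\<in>insert k J. x j *s m' j) = 0" and j: "j \<in> insert k J"
    then have eq: "x k *s w + (\<Sum>j\<in>J. x j *s m j) = 0" by (simp add: sum_m')
    then have "(x k *s w + (\<Sum>j\<in>J. x j *s m j)) $ k = 0" by simp
    moreover have "(\<Sum>j\<in>J. x j *s m j) $ k = 0"
      using m(3) insert.hyps by (simp add: sum_component)
    ultimately have "x k = 0" using w(1) by simp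
    then show "x j = 0" using m(4)[of x j] eq j by auto
  qed
qed

lemma is_lattice_if_between:
  fixes L N :: "('k^'n) set"
  assumes L: "is_lattice v L" and N: "submodule N" and c: "c \<noteq> 0" and sub: "scale_set c L \<subseteq> N" "N \<subseteq> L"
  shows "is_lattice v N"
proof -
  obtain b where b: "L = lin b ` box" "\<forall>y. lin b y = 0 \<longrightarrow> y = 0" "inj (lin b)"
    using L by (rule lattice_basis)
  let ?N = "{y \<in> box. lin b y \<in> N}"
  have "v c \<le> 1 \<or> 1 < v c" by linarith
  \<comment> \<open>Small enough for \<open>d *s axis i 1\<close> to lie in \<open>box\<close> and
    for its image to lie in \<open>N\<close>, whether or not \<open>c\<close> is integral.\<close>
  obtain d where d: "d \<noteq> 0" "v d \<le> v c" "v d \<le> 1"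
    using exists_small[OF v_pos[OF c]] by (metis less_imp_le)
  have sN: "submodule ?N"
    using N submodule_box unfolding submodule_def by (auto simp: lin_add lin_scale)
  have axis: "d *s axis i 1 \<in> ?N" for i
  proof -
    have bi: "axis i 1 \<in> box" by (simp add: box_def axis_def)
    then have "lin b (axis i 1) \<in> L" using b(1) by blast
    then have "d *s lin b (axis i 1) \<in> scale_set d L" unfolding scale_set_def by (rule imageI)
    then have "d *s lin b (axis i 1) \<in> N"
      using scale_set_le[OF submodule_lattice[OF L] c d(2)] sub(1) by blast
    moreover have "d *s axis i 1 \<in> box" using submodule_scale[OF submodule_box bi d(3)] .
    ultimately show ?thesis by (simp add: lin_scale)
  qed
  obtain m :: "'n \<Rightarrow> 'k^'n" where m: "\<And>j. m j \<in> ?N"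
    "\<And>y. y \<in> ?N \<Longrightarrow> \<exists>x. (\<forall>j. v (x j) \<le> 1) \<and> y = (\<Sum>j\<in>UNIV. x j *s m j)"
    "\<And>x j. (\<Sum>j\<in>UNIV. x j *s m j) = 0 \<Longrightarrow> x j = 0"
  proof -
    obtain m where "basis_of ?N UNIV m"
      using submodule_box_basis[OF sN _ d(1) axis finite] by blast
    then show thesis by (intro that[of m]) (simp_all add: basis_of_def)
  qed
  let ?b = "\<lambda>j. lin b (m j)"
  have lin: "lin ?b y = lin b (\<Sum>j\<in>UNIV. y $ j *s m j)" for y
    by (simp only: lin_sum lin_scale lin_def[of ?b])
  have "N = lin ?b ` box"
  proof
    show "lin ?b ` box \<subseteq> N"
    proof
      fix z assume "z \<in> lin ?b ` box"
      then obtain y where y: "y \<in> box" "z = lin ?b y" by blast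
      have "(\<Sum>j\<in>UNIV. y $ j *s m j) \<in> ?N"
        using y(1) by (intro submodule_sum[OF sN] submodule_scale[OF sN m(1)]) (auto simp: box_def)
      then show "z \<in> N" by (simp add: y(2) lin)
    qed
    show "N \<subseteq> lin ?b ` box"
    proof
      fix z assume z: "z \<in> N"
      then obtain y where "y \<in> box" "z = lin b y" using sub(2) b(1) by blast
      then obtain x where x: "\<forall>j. v (x j) \<le> 1" "y = (\<Sum>j\<in>UNIV. x j *s m j)" using m(2)[of y] z by blast
      then have "z = lin ?b (vec_lambda x)" by (simp add: lin \<open>z = lin b y\<close>)
      moreover have "vec_lambda x \<in> box" using x(1) by (simp add: box_def)
      ultimately show "z \<in> lin ?b ` box" by blast
    qed
  qed
  moreover have "y = 0" if "lin ?b y = 0" for y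
  proof -
    have "(\<Sum>j\<in>UNIV. y $ j *s m j) = 0" using that b(2) unfolding lin by blast
    then have "y $ j = 0" for j using m(3)[of "\<lambda>j. y $ j" j] by blast
    then show ?thesis by (simp add: vec_eq_iff)
  qed
  ultimately show ?thesis unfolding is_lattice_iff by blast
qed

lemma is_lattice_Int:
  fixes L M :: "('k^'n) set"
  assumes "is_lattice v L" "is_lattice v M" shows "is_lattice v (L \<inter> M)"
proof -
  obtain c where c: "c \<noteq> 0" "v c \<le> 1" "scale_set c L \<subseteq> M" using lattice_commensurable[OF assms] by blast
  have sL: "submodule L" by (rule submodule_lattice[OF assms(1)])
  have "scale_set c L \<subseteq> L" using scale_set_le[OF sL, of 1 c] c(2) by simp
  then show ?thesis
    using c submodule_Int[OF sL submodule_lattice[OF assms(2)]]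
    by (intro is_lattice_if_between[OF assms(1) _ c(1)]) auto
qed

end

section \<open>Finiteness from local compactness\<close>

locale local_field = valued_field v p for v :: "'k::field \<Rightarrow> real" and p :: 'k +
  assumes locally_compact: "nonarch_locally_compact_field v"
begin

text \<open>The integral multiples of a small \<open>a\<close> fit into a compact neighbourhood of
  0, which is covered by finitely many balls of radius \<open>v (a * c)\<close>; dividing by
  \<open>a\<close> gives the classes of integers modulo \<open>c\<close>.\<close>

lemma finite_representatives:
  assumes c: "c \<noteq> 0"
  obtains Q where "finite Q" "\<And>x. v x \<le> 1 \<Longrightarrow> \<exists>q\<in>Q. \<exists>y. v y \<le> 1 \<and> x = q + c * y"
proof -
  interpret M: Metric_space UNIV "\<lambda>x y. v (x - y)"
  proof
    show "v (x - y) = v (y - x)" for x y using v_minus[of "x - y"] by simp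
    show "v (x - z) \<le> v (x - y) + v (y - z)" for x y z
    proof -
      have "v (x - z) \<le> max (v (x - y)) (v (y - z))" using v_add[of "x - y" "y - z"] by simp
      then show ?thesis using v_nonneg[of "x - y"] v_nonneg[of "y - z"] by linarith
    qed
  qed auto
  obtain U K where UK: "openin M.mtopology U" "compactin M.mtopology K" "0 \<in> U" "U \<subseteq> K"
    using locally_compact unfolding nonarch_locally_compact_field_def locally_compact_space_def by force
  then obtain r where r: "0 < r" "M.mball 0 r \<subseteq> U" unfolding M.openin_mtopology by blast
  obtain a where a: "a \<noteq> 0" "v a < r" using exists_small[OF r(1)] by blast
  have \<epsilon>: "0 < v (a * c)" using a c by (intro v_pos) simp
  have "M.mtotally_bounded K" by (rule M.compactin_imp_mtotally_bounded[OF UK(2)])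
  then obtain P where P: "finite P" "K \<subseteq> (\<Union>x\<in>P. M.mball x (v (a * c)))"
    unfolding M.mtotally_bounded_def using \<epsilon> by blast
  \<comment> \<open>A centre need not be an integral multiple of \<open>a\<close>; it is replaced by
    an integer \<open>x\<close> with \<open>a * x\<close> in its ball, if there is one.\<close>
  define rep where "rep q = (SOME x. v x \<le> 1 \<and> v (q - a * x) < v (a * c))" for q
  show thesis
  proof (rule that[of "rep ` P"])
    show "finite (rep ` P)" using P(1) by simp
    fix x assume x: "v x \<le> 1"
    have "v (a * x) \<le> v a" using x by (simp add: v_mult mult_left_le)
    then have "a * x \<in> M.mball 0 r" using a(2) by (simp add: M.mball_def)
    then have "a * x \<in> (\<Union>x\<in>P. M.mball x (v (a * c)))" using r(2) UK(4) P(2) by blast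
    then obtain q where q: "q \<in> P" "v (q - a * x) < v (a * c)" unfolding M.mball_def by blast
    have "v (rep q) \<le> 1 \<and> v (q - a * rep q) < v (a * c)"
      unfolding rep_def by (rule someI[of _ x]) (use x q in blast)
    moreover have "v (a * (x - rep q)) \<le> max (v (q - a * rep q)) (v (q - a * x))"
      using v_diff[of "q - a * rep q" "q - a * x"] by (simp add: algebra_simps)
    ultimately have "v (a * (x - rep q)) < v (a * c)" using q(2) by linarith
    then have "v (x - rep q) < v c" using v_pos[OF a(1)] by (simp add: v_mult)
    then have "v ((x - rep q) / c) \<le> 1" using v_pos[OF c] by (simp add: v_divide)
    moreover have "x = rep q + c * ((x - rep q) / c)" using c by simp
    ultimately show "\<exists>q\<in>rep ` P. \<exists>y. v y \<le> 1 \<and> x = q + c * y" using q(1) by blast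
  qed
qed

text \<open>A lattice that contains \<open>N\<close> contains \<open>c\<close> times
  \<open>L\<close>, so inside \<open>L\<close> it is determined by which of the finitely many
  representatives modulo \<open>c\<close> it contains.\<close>

lemma finite_lattices_between:
  fixes L N :: "('k^'n) set"
  assumes N: "is_lattice v N" and L: "is_lattice v L"
  shows "finite {M. is_lattice v M \<and> N \<subseteq> M \<and> M \<subseteq> L}"
proof -
  obtain c where c: "c \<noteq> 0" "v c \<le> 1" "scale_set c L \<subseteq> N" using lattice_commensurable[OF L N] by blast
  obtain b where b: "L = lin b ` box" using L by (auto simp: is_lattice_iff)
  obtain Q where Q: "finite Q" "\<And>x. v x \<le> 1 \<Longrightarrow> \<exists>q\<in>Q. \<exists>y. v y \<le> 1 \<and> x = q + c * y"
    using finite_representatives[OF c(1)] by blast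
  let ?B = "{y :: 'k^'n. \<forall>i. y $ i \<in> Q}"
  have "?B \<subseteq> vec_lambda ` (UNIV \<rightarrow>\<^sub>E Q)"
  proof
    fix y :: "'k^'n" assume "y \<in> ?B"
    then show "y \<in> vec_lambda ` (UNIV \<rightarrow>\<^sub>E Q)" by (intro image_eqI[of _ _ "vec_nth y"]) auto
  qed
  then have finB: "finite ?B"
    by (rule finite_subset[OF _ finite_imageI[OF finite_PiE[OF finite]]]) (rule Q(1))
  let ?X = "{M. is_lattice v M \<and> N \<subseteq> M \<and> M \<subseteq> L}"
  have "inj_on (\<lambda>M. {q \<in> ?B. lin b q \<in> M}) ?X"
  proof (rule inj_onI)
    have sub: "M \<subseteq> M'" if M: "M \<in> ?X" "M' \<in> ?X" and eq: "{q \<in> ?B. lin b q \<in> M} = {q \<in> ?B. lin b q \<in> M'}" for M M'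
    proof
      fix x assume x: "x \<in> M"
      then obtain y where y: "y \<in> box" "x = lin b y" using M(1) b by blast
      have "\<exists>q z. q \<in> Q \<and> v z \<le> 1 \<and> y $ i = q + c * z" for i
      proof -
        have "v (y $ i) \<le> 1" using y(1) by (simp add: box_def)
        then show ?thesis using Q(2)[of "y $ i"] by blast
      qed
      then obtain q z where qz: "\<And>i. q i \<in> Q" "\<And>i. v (z i) \<le> 1" "\<And>i. y $ i = q i + c * z i" by metis
      let ?q = "vec_lambda q" and ?z = "vec_lambda z"
      have "y = ?q + c *s ?z" using qz(3) by (simp add: vec_eq_iff)
      then have x_eq: "x = lin b ?q + c *s lin b ?z" by (simp add: y(2) lin_add lin_scale)
      have "?z \<in> box" using qz(2) by (simp add: box_def)
      then have "c *s lin b ?z \<in> N" using c(3) b unfolding scale_set_def by blast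
      then have cz: "c *s lin b ?z \<in> M" "c *s lin b ?z \<in> M'" using M by blast+
      have "lin b ?q = x - c *s lin b ?z" using x_eq by simp
      then have "lin b ?q \<in> M" using submodule_diff[OF submodule_lattice x cz(1)] M(1) by simp
      then have "lin b ?q \<in> M'" using eq qz(1) by auto
      then show "x \<in> M'" using submodule_add[OF submodule_lattice _ cz(2)] M(2) x_eq by simp
    qed
    fix M M' assume "M \<in> ?X" "M' \<in> ?X" "{q \<in> ?B. lin b q \<in> M} = {q \<in> ?B. lin b q \<in> M'}"
    then show "M = M'" using sub[of M M'] sub[of M' M] by auto
  qed
  moreover have "(\<lambda>M. {q \<in> ?B. lin b q \<in> M}) ` ?X \<subseteq> Pow ?B" by auto
  ultimately show ?thesis using finB by (meson finite_Pow_iff finite_imageD finite_subset)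
qed

end

section \<open>Simplices of the building and normalised lattices\<close>

context valued_field
begin

lemma homothety_class_self: "L \<in> homothety_class L"
  unfolding homothety_class_def by (intro CollectI exI[of _ 1]) simp

lemma homothety_class_scale_set: "c \<noteq> 0 \<Longrightarrow> homothety_class (scale_set c L) = homothety_class L"
proof
  assume c: "c \<noteq> 0"
  show "homothety_class (scale_set c L) \<subseteq> homothety_class L"
  proof
    fix M assume "M \<in> homothety_class (scale_set c L)"
    then obtain d where "d \<noteq> 0" "M = scale_set d (scale_set c L)" by (auto simp: homothety_class_def)
    then have "M = scale_set (d * c) L" "d * c \<noteq> 0" using c by (simp_all add: scale_set_scale_set)
    then show "M \<in> homothety_class L" unfolding homothety_class_def by blast
  qed
  show "homothety_class L \<subseteq> homothety_class (scale_set c L)"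
  proof
    fix M assume "M \<in> homothety_class L"
    then obtain d where "d \<noteq> 0" "M = scale_set d L" by (auto simp: homothety_class_def)
    then have "M = scale_set (d / c) (scale_set c L)" "d / c \<noteq> 0"
      using c by (simp_all add: scale_set_scale_set)
    then show "M \<in> homothety_class (scale_set c L)" unfolding homothety_class_def by blast
  qed
qed

lemma homothety_class_memE:
  assumes "M \<in> homothety_class L"
  obtains c where "c \<noteq> 0" "M = scale_set c L"
  using assms by (auto simp: homothety_class_def)

lemma homothety_class_eqD:
  assumes "homothety_class M = homothety_class L"
  obtains c where "c \<noteq> 0" "M = scale_set c L"
  using homothety_class_memE[of M L] homothety_class_self[of M] assms by auto

lemma homothety_class_mem_eq: "M \<in> homothety_class L \<Longrightarrow> homothety_class M = homothety_class L"
  by (erule homothety_class_memE) (simp add: homothety_class_scale_set)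

definition vertices :: "('k^'n) set set set" where
  "vertices = homothety_class ` {L. is_lattice v L}"

text \<open>Each vertex is represented by its smallest lattice containing \<open>box\<close>. A neighbour of \<open>[L]\<close> whose
  normalised lattice is smaller than the normalised \<open>L\<close> is given by a lattice between
  \<open>box + p L\<close> and \<open>L\<close>.\<close>

definition normal :: "('k^'n) set \<Rightarrow> bool" where
  "normal L \<longleftrightarrow> is_lattice v L \<and> box \<subseteq> L \<and> \<not> box \<subseteq> scale_set p L"

lemma normalD: "normal L \<Longrightarrow> is_lattice v L" "normal L \<Longrightarrow> box \<subseteq> L" "normal L \<Longrightarrow> \<not> box \<subseteq> scale_set p L"
  "normal L \<Longrightarrow> submodule L"
  by (simp_all add: normal_def submodule_lattice)

lemma normal_unique:
  assumes L: "normal L" and M: "normal M" and eq: "homothety_class L = homothety_class M" shows "L = M"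
proof -
  obtain c where c: "c \<noteq> 0" "L = scale_set c M" using eq by (rule homothety_class_eqD)
  then have M_eq: "M = scale_set (1 / c) L" by (simp add: scale_set_scale_set)
  have "\<not> v c < 1"
    using scale_set_less[OF normalD(4)[OF M], of 1 c] c(2) normalD(3)[OF M] normalD(2)[OF L] by auto
  moreover have "\<not> 1 < v c"
  proof
    assume "1 < v c"
    then have "scale_set (1 / c) L \<subseteq> scale_set p L"
      using scale_set_less[OF normalD(4)[OF L], of 1 "1 / c"] by (simp add: v_divide)
    then show False using normalD(3)[OF L] normalD(2)[OF M] unfolding M_eq by blast
  qed
  ultimately have vc: "v c = 1" by linarith
  have "L \<subseteq> M" using scale_set_le[OF normalD(4)[OF M], of 1 c] c vc by simp
  moreover have "scale_set (1 / c) L \<subseteq> scale_set 1 L"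
    using c vc by (intro scale_set_le[OF normalD(4)[OF L]]) (simp_all add: v_divide)
  then have "M \<subseteq> L" using M_eq by simp
  ultimately show ?thesis by blast
qed

text \<open>A unit vector is not divisible by all powers of \<open>p\<close> in \<open>M\<close>, so
  some \<open>p ^ n\<close> times \<open>M\<close> fails to contain \<open>box\<close>; the last
  power before that happens is normal.\<close>

lemma normal_exists:
  fixes L :: "('k^'n) set"
  assumes L: "is_lattice v L"
  obtains c where "c \<noteq> 0" "normal (scale_set c L)"
proof -
  obtain d where d: "d \<noteq> 0" "scale_set d (box :: ('k^'n) set) \<subseteq> L"
    by (rule lattice_commensurable[OF is_lattice_box L])
  define M where "M = scale_set (1 / d) L"
  have M: "is_lattice v M" unfolding M_def using L d(1) by (intro is_lattice_scale_set) auto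
  have "scale_set d box \<subseteq> scale_set d M" using d by (simp add: M_def scale_set_scale_set)
  then have box: "box \<subseteq> M" using scale_set_subset_iff[OF d(1)] by blast
  have pn: "p ^ n \<noteq> 0" for n using p_nonzero by simp
  have "\<exists>n. \<not> box \<subseteq> scale_set (p ^ n) M"
  proof -
    define a :: "'k^'n" where "a = axis undefined 1"
    have "a \<noteq> 0" by (simp add: a_def axis_eq_0_iff)
    then obtain c where c: "c \<noteq> 0" "c *s a \<in> M" "c *s a \<notin> scale_set p M"
      using unimodular_multiple[OF M] by blast
    have "0 < v p / v c" using v_p_pos v_pos[OF c(1)] by simp
    then obtain n where "v p ^ n < v p / v c"
      using real_arch_pow_inv[OF _ v_p_less_1] by blast
    then have n: "v (c * p ^ n) \<le> v p" using v_pos[OF c(1)] by (simp add: v_mult v_power field_simps)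
    have "a \<in> box" by (simp add: a_def box_def axis_def)
    moreover have "a \<notin> scale_set (p ^ n) M"
    proof
      assume "a \<in> scale_set (p ^ n) M"
      then have "c *s a \<in> scale_set c (scale_set (p ^ n) M)" unfolding scale_set_def by (rule imageI)
      then have "c *s a \<in> scale_set (c * p ^ n) M" by (simp only: scale_set_scale_set)
      then have "c *s a \<in> scale_set p M"
        using scale_set_le[OF submodule_lattice[OF M] p_nonzero n] by blast
      then show False using c(3) by blast
    qed
    ultimately show ?thesis by blast
  qed
  then have n: "\<not> box \<subseteq> scale_set (p ^ (LEAST n. \<not> box \<subseteq> scale_set (p ^ n) M)) M"
    by (rule LeastI_ex)
  define n where "n = (LEAST n. \<not> box \<subseteq> scale_set (p ^ n) M)"
  have "n \<noteq> 0" using n box by (auto simp: n_def[symmetric])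
  then obtain m where m: "n = Suc m" by (cases n) auto
  have "box \<subseteq> scale_set (p ^ m) M"
    using not_less_Least[of m "\<lambda>n. \<not> box \<subseteq> scale_set (p ^ n) M"] m n_def by auto
  moreover have "scale_set p (scale_set (p ^ m) M) = scale_set (p ^ n) M" by (simp add: m scale_set_scale_set)
  ultimately have "normal (scale_set (p ^ m) M)"
    using n is_lattice_scale_set[OF M pn] by (simp add: normal_def n_def)
  moreover have "scale_set (p ^ m) M = scale_set (p ^ m * (1 / d)) L"
    unfolding M_def scale_set_scale_set ..
  ultimately show thesis using that[of "p ^ m * (1 / d)"] pn d(1) by simp
qed

definition nr :: "('k^'n) set set \<Rightarrow> ('k^'n) set" where
  "nr x = (THE L. normal L \<and> homothety_class L = x)"

lemma nr_homothety_class: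
  assumes "normal L" shows "nr (homothety_class L) = L"
  unfolding nr_def
proof (rule the_equality)
  fix M assume "normal M \<and> homothety_class M = homothety_class L"
  then show "M = L" using normal_unique[of M L] assms by blast
qed (simp add: assms)

lemma nr_vertex:
  assumes "x \<in> vertices" shows "normal (nr x)" "homothety_class (nr x) = x"
proof -
  obtain L where L: "is_lattice v L" "x = homothety_class L" using assms by (auto simp: vertices_def)
  obtain c where c: "c \<noteq> 0" "normal (scale_set c L)" using normal_exists[OF L(1)] by blast
  have x: "x = homothety_class (scale_set c L)" using homothety_class_scale_set[OF c(1), of L] L(2) by simp
  show "normal (nr x)" "homothety_class (nr x) = x"
    unfolding x nr_homothety_class[OF c(2)] by (simp_all add: c(2))
qed

lemma normal_vertex: "normal L \<Longrightarrow> homothety_class L \<in> vertices"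
  using normalD(1) by (auto simp: vertices_def)

lemma nr_eqD:
  assumes "x \<in> vertices" "y \<in> vertices" "nr x = nr y" shows "x = y"
proof -
  have "homothety_class (nr x) = homothety_class (nr y)" using assms(3) by (rule arg_cong)
  then show ?thesis unfolding nr_vertex(2)[OF assms(1)] nr_vertex(2)[OF assms(2)] .
qed

text \<open>The neighbour relation of the building, seen on normalised representatives. Equality is
  allowed, so that a simplex is a set of pairwise related vertices.\<close>

definition adj :: "('k^'n) set \<Rightarrow> ('k^'n) set \<Rightarrow> bool" where
  "adj L M \<longleftrightarrow> (L \<subseteq> M \<or> M \<subseteq> L) \<and> scale_set p L \<subseteq> M \<and> scale_set p M \<subseteq> L"

lemma adj_sym: "adj L M \<Longrightarrow> adj M L"
  by (auto simp: adj_def)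

text \<open>Scale so that \<open>L\<close> becomes a normal \<open>N\<close>. The image of
  \<open>M\<close> lies between \<open>scale_set p N\<close> and \<open>N\<close>; if it contains
  \<open>box\<close> it is normal too, and otherwise it becomes normal after division by
  \<open>p\<close>.\<close>

lemma adj_nr:
  assumes L: "is_lattice v L" and M: "is_lattice v M" and sub: "scale_set p L \<subseteq> M" "M \<subseteq> L"
  shows "adj (nr (homothety_class L)) (nr (homothety_class M))"
proof -
  obtain c where c: "c \<noteq> 0" "normal (scale_set c L)" using normal_exists[OF L] by blast
  define N where "N = scale_set c L"
  define M' where "M' = scale_set c M"
  have N: "normal N" using c(2) by (simp add: N_def)
  have nrN: "nr (homothety_class L) = N"
    using nr_homothety_class[OF N] homothety_class_scale_set[OF c(1), of L] by (simp add: N_def)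
  have M': "is_lattice v M'" unfolding M'_def by (rule is_lattice_scale_set[OF M c(1)])
  have hM': "homothety_class M' = homothety_class M"
    unfolding M'_def by (rule homothety_class_scale_set[OF c(1)])
  have "scale_set p N = scale_set c (scale_set p L)" by (simp add: N_def scale_set_scale_set mult.commute)
  then have s1: "scale_set p N \<subseteq> M'" using scale_set_mono[OF sub(1), of c] by (simp add: M'_def)
  have s2: "M' \<subseteq> N" using scale_set_mono[OF sub(2), of c] by (simp add: M'_def N_def)
  have pN: "scale_set p N \<subseteq> N" by (rule scale_set_p_subset[OF normalD(4)[OF N]])
  have pM': "scale_set p M' \<subseteq> scale_set p N" by (rule scale_set_mono[OF s2])
  show ?thesis
  proof (cases "box \<subseteq> M'")
    case True
    then have "normal M'" using M' pM' normalD(3)[OF N] by (auto simp: normal_def)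
    then have "nr (homothety_class M) = M'" using nr_homothety_class[of M'] hM' by simp
    then show ?thesis using nrN s1 s2 pM' pN by (auto simp: adj_def)
  next
    case False
    define M'' where "M'' = scale_set (1 / p) M'"
    have pM'': "scale_set p M'' = M'" using p_nonzero by (simp add: M''_def scale_set_scale_set)
    have "scale_set p N \<subseteq> scale_set p M''" using s1 pM'' by simp
    then have NM'': "N \<subseteq> M''" using scale_set_subset_iff[OF p_nonzero] by blast
    have "is_lattice v M''" unfolding M''_def using M' p_nonzero by (intro is_lattice_scale_set) auto
    then have "normal M''" using NM'' normalD(2)[OF N] False pM'' by (auto simp: normal_def)
    moreover have "homothety_class M'' = homothety_class M"
      unfolding M''_def using hM' homothety_class_scale_set[of "1 / p" M'] p_nonzero by simp
    ultimately have "nr (homothety_class M) = M''" using nr_homothety_class[of M''] by simp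
    then show ?thesis using nrN NM'' pM'' s2 pN by (auto simp: adj_def)
  qed
qed

text \<open>The building is a flag complex, so pairwise adjacency suffices. The empty simplex is
  included, which augments the cochain complexes of links.\<close>

definition simplices :: "('k^'n) set set set set" where
  "simplices = {\<sigma>. finite \<sigma> \<and> \<sigma> \<subseteq> vertices \<and> (\<forall>x\<in>\<sigma>. \<forall>y\<in>\<sigma>. adj (nr x) (nr y))}"

lemma simplices_subset: "\<sigma> \<in> simplices \<Longrightarrow> \<tau> \<subseteq> \<sigma> \<Longrightarrow> \<tau> \<in> simplices"
  unfolding simplices_def by (auto dest: finite_subset)

end

lemma finite_chain_enumeration:
  assumes "card T = Suc k" "\<And>L M. L \<in> T \<Longrightarrow> M \<in> T \<Longrightarrow> L \<subseteq> M \<or> M \<subseteq> L"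
  shows "\<exists>L :: nat \<Rightarrow> 'b set. T = L ` {..k} \<and> (\<forall>i<k. L i \<subset> L (Suc i))"
  using assms
proof (induction k arbitrary: T)
  case 0
  then obtain L where "T = {L}" by (metis One_nat_def card_1_singletonE)
  then show ?case by (intro exI[of _ "\<lambda>_. L"]) auto
next
  case (Suc k)
  have fin: "finite T" using Suc.prems(1) by (intro card_ge_0_finite) simp
  have "T \<noteq> {}" using Suc.prems(1) by auto
  then obtain M where M: "M \<in> T" "\<forall>L\<in>T. M \<subseteq> L \<longrightarrow> M = L"
    using finite_has_maximal[OF fin] by blast
  have top: "L \<subseteq> M" if "L \<in> T" for L using M Suc.prems(2)[OF that M(1)] that by auto
  have "card (T - {M}) = Suc k" using Suc.prems(1) M(1) fin by simp
  moreover have "L \<subseteq> K \<or> K \<subseteq> L" if "L \<in> T - {M}" "K \<in> T - {M}" for L K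
    using Suc.prems(2) that by simp
  ultimately obtain L where L: "T - {M} = L ` {..k}" "\<forall>i<k. L i \<subset> L (Suc i)"
    using Suc.IH[of "T - {M}"] by blast
  let ?L = "L(Suc k := M)"
  have "?L ` {..k} = L ` {..k}" by (rule image_cong) auto
  then have "?L ` {..Suc k} = insert M (T - {M})" unfolding atMost_Suc image_insert L(1) by simp
  also have "\<dots> = T" using M(1) by (rule insert_Diff)
  finally have T: "T = ?L ` {..Suc k}" by (rule sym)
  have "L k \<in> T - {M}" unfolding L(1) by simp
  then have "L k \<subset> M" using top[of "L k"] by blast
  then have "?L i \<subset> ?L (Suc i)" if "i < Suc k" for i
    using L(2) that by (cases "i = k") simp_all
  with T show ?case by (intro exI[of _ ?L] conjI allI impI)
qed

section \<open>Simplices as chains of normalised lattices\<close>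

context valued_field
begin

text \<open>The normalised lattices of pairwise adjacent vertices form a chain. The last inclusion
  of the periodic chain is strict because \<open>box\<close> lies in the smallest lattice but not in
  \<open>p\<close> times the largest.\<close>

theorem building_eq: "building v p k = {\<sigma> \<in> simplices. card \<sigma> = Suc k}"
proof
  show "building v p k \<subseteq> {\<sigma> \<in> simplices. card \<sigma> = Suc k}"
  proof
    fix \<sigma> :: "('k^'b) set set set" assume "\<sigma> \<in> building v p k"
    then obtain L where \<sigma>: "\<sigma> = (\<lambda>i. homothety_class (L i)) ` {..k}" and lat: "\<And>i. i \<le> k \<Longrightarrow> is_lattice v (L i)"
      and p: "scale_set p (L k) \<subset> L 0" and step: "\<And>i. i < k \<Longrightarrow> L i \<subset> L (Suc i)"
      unfolding building_def by blast
    have less: "L i \<subset> L j" if "i < j" "j \<le> k" for i j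
      using that
    proof (induction j)
      case (Suc j)
      have "L j \<subset> L (Suc j)" using Suc.prems(2) step by simp
      then show ?case using Suc by (cases "i = j") auto
    qed simp
    have le: "L i \<subseteq> L j" if "i \<le> j" "j \<le> k" for i j
      using less[of i j] that by (cases "i = j") auto
    have p': "scale_set p (L j) \<subset> L i" if "i \<le> k" "j \<le> k" for i j
      using p le[of 0 i] scale_set_mono[OF le[of j k], of p] that by auto
    have adj_le: "adj (nr (homothety_class (L j))) (nr (homothety_class (L i)))" if "i \<le> j" "j \<le> k" for i j
      using adj_nr[OF lat[of j] lat[of i]] p'[of i j] le[of i j] that by auto
    have "adj (nr (homothety_class (L i))) (nr (homothety_class (L j)))" if "i \<le> k" "j \<le> k" for i j
    proof (cases "i \<le> j")
      case True
      then show ?thesis using adj_sym[OF adj_le[of i j]] that by blast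
    next
      case False
      then show ?thesis using adj_le[of j i] that by simp
    qed
    then have "\<sigma> \<in> simplices" using lat by (auto simp: \<sigma> simplices_def vertices_def)
    moreover have ne: "homothety_class (L i) \<noteq> homothety_class (L j)" if ij: "i < j" "j \<le> k" for i j
    proof
      assume "homothety_class (L i) = homothety_class (L j)"
      then obtain c where c: "c \<noteq> 0" "L i = scale_set c (L j)" by (rule homothety_class_eqD)
      have sj: "submodule (L j)" using lat ij submodule_lattice by blast
      show False
      proof (cases "v c < 1")
        case True
        then have "L i \<subseteq> scale_set p (L j)" using scale_set_less[OF sj, of 1 c] c by simp
        then show False using p'[of i j] ij by auto
      next
        case False
        then have "L j \<subseteq> L i" using scale_set_le[OF sj, of c 1] c by simp
        then show False using less[OF ij] by auto
      qed
    qed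
    have "inj_on (\<lambda>i. homothety_class (L i)) {..k}"
    proof (rule inj_onI)
      fix i j assume "i \<in> {..k}" "j \<in> {..k}" "homothety_class (L i) = homothety_class (L j)"
      then show "i = j" using ne[of i j] ne[of j i] by (cases i j rule: linorder_cases) auto
    qed
    then have "card \<sigma> = Suc k" unfolding \<sigma> by (simp add: card_image)
    ultimately show "\<sigma> \<in> {\<sigma> \<in> simplices. card \<sigma> = Suc k}" by blast
  qed
  show "{\<sigma> \<in> simplices. card \<sigma> = Suc k} \<subseteq> building v p k"
  proof
    fix \<sigma> :: "('k^'b) set set set" assume "\<sigma> \<in> {\<sigma> \<in> simplices. card \<sigma> = Suc k}"
    then have card: "card \<sigma> = Suc k" and vert: "\<sigma> \<subseteq> vertices" and ad: "\<And>x y. x \<in> \<sigma> \<Longrightarrow> y \<in> \<sigma> \<Longrightarrow> adj (nr x) (nr y)"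
      by (auto simp: simplices_def)
    have "inj_on nr \<sigma>" by (rule inj_onI, rule nr_eqD) (use vert in auto)
    then have "card (nr ` \<sigma>) = Suc k" using card by (simp add: card_image)
    moreover have "L \<subseteq> M \<or> M \<subseteq> L" if LM: "L \<in> nr ` \<sigma>" "M \<in> nr ` \<sigma>" for L M
    proof -
      obtain x y where "x \<in> \<sigma>" "L = nr x" "y \<in> \<sigma>" "M = nr y" using LM by blast
      then show ?thesis using ad[of x y] by (simp add: adj_def)
    qed
    ultimately obtain L where L: "nr ` \<sigma> = L ` {..k}" "\<forall>i<k. L i \<subset> L (Suc i)"
      using finite_chain_enumeration[of "nr ` \<sigma>" k] by blast
    have mem: "\<exists>x\<in>\<sigma>. L i = nr x" if "i \<le> k" for i
    proof -
      have "L i \<in> nr ` \<sigma>" unfolding L(1) using that by simp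
      then show ?thesis by blast
    qed
    have norm: "normal (L i)" if "i \<le> k" for i
    proof -
      obtain x where "x \<in> \<sigma>" "L i = nr x" using mem[OF \<open>i \<le> k\<close>] by blast
      then show ?thesis using nr_vertex(1)[of x] vert by auto
    qed
    have "homothety_class (nr x) = x" if "x \<in> \<sigma>" for x
      using nr_vertex(2)[of x] that vert by blast
    then have "(\<lambda>x. homothety_class (nr x)) ` \<sigma> = \<sigma>" by simp
    then have "homothety_class ` (nr ` \<sigma>) = \<sigma>" by (simp add: image_image)
    then have "\<sigma> = (\<lambda>i. homothety_class (L i)) ` {..k}" using L(1) by (simp add: image_image)
    moreover have "scale_set p (L k) \<subseteq> L 0"
    proof -
      obtain x y where "x \<in> \<sigma>" "L k = nr x" "y \<in> \<sigma>" "L 0 = nr y" using mem[of k] mem[of 0] by blast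
      then show ?thesis using ad[of x y] by (simp add: adj_def)
    qed
    moreover have "scale_set p (L k) \<noteq> L 0"
      using normalD(2)[OF norm[of 0]] normalD(3)[OF norm[of k]] by auto
    moreover have "\<forall>i\<le>k. is_lattice v (L i)" using norm normalD(1) by blast
    ultimately show "\<sigma> \<in> building v p k" unfolding building_def using L(2) by blast
  qed
qed

lemma simplices_memD:
  assumes "\<sigma> \<in> simplices" "x \<in> \<sigma>"
  shows "x \<in> vertices" "normal (nr x)" "homothety_class (nr x) = x"
proof -
  show x: "x \<in> vertices" using assms by (auto simp: simplices_def)
  show "normal (nr x)" "homothety_class (nr x) = x" using nr_vertex[OF x] by blast+
qed

lemma simplices_adj: "\<sigma> \<in> simplices \<Longrightarrow> x \<in> \<sigma> \<Longrightarrow> y \<in> \<sigma> \<Longrightarrow> adj (nr x) (nr y)"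
  by (simp add: simplices_def)

text \<open>If \<open>v c\<close> exceeds \<open>v d\<close>, discreteness provides an additional
  factor \<open>p\<close> on the side of \<open>d\<close>, and this factor carries \<open>B\<close>
  into \<open>A\<close>.\<close>

lemma scaled_adjacent_comparable:
  assumes "A \<subseteq> B" "scale_set p B \<subseteq> A" "submodule A" "submodule B" "c \<noteq> 0" "d \<noteq> 0"
  shows "scale_set c A \<subseteq> scale_set d B \<or> scale_set d B \<subseteq> scale_set c A"
proof (cases "v c \<le> v d")
  case True
  then have "scale_set c A \<subseteq> scale_set d A" using assms by (intro scale_set_le)
  then show ?thesis using scale_set_mono[OF assms(1), of d] by blast
next
  case False
  then have "scale_set d B \<subseteq> scale_set p (scale_set c B)" using assms by (intro scale_set_less) auto
  also have "\<dots> = scale_set c (scale_set p B)" by (simp add: scale_set_scale_set mult.commute)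
  also have "\<dots> \<subseteq> scale_set c A" by (rule scale_set_mono[OF assms(2)])
  finally show ?thesis by blast
qed

lemma lattice_chain_Union_simplex:
  fixes \<sigma> :: "('k^'n) set set set"
  assumes \<sigma>: "\<sigma> \<in> simplices" "\<sigma> \<noteq> {}"
  shows "lattice_chain (\<Union>\<sigma>)"
proof -
  have rep: "\<exists>x c. x \<in> \<sigma> \<and> L \<in> x \<and> c \<noteq> 0 \<and> L = scale_set c (nr x) \<and> normal (nr x)" if L: "L \<in> \<Union>\<sigma>" for L
  proof -
    obtain x where x: "x \<in> \<sigma>" "L \<in> x" using L by blast
    note n = simplices_memD[OF \<sigma>(1) x(1)]
    have "L \<in> homothety_class (nr x)" using n(3) x(2) by simp
    then obtain c where "c \<noteq> 0" "L = scale_set c (nr x)" by (rule homothety_class_memE)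
    then show ?thesis using x n(2) by blast
  qed
  have sub: "submodule L" if "L \<in> \<Union>\<sigma>" for L
  proof -
    obtain x c where "c \<noteq> 0" "L = scale_set c (nr x)" "normal (nr x)" using rep[OF \<open>L \<in> \<Union>\<sigma>\<close>] by blast
    then show ?thesis using is_lattice_scale_set[of "nr x" c] normalD(1) submodule_lattice by blast
  qed
  have scaled: "scale_set c L \<in> \<Union>\<sigma>" if L: "L \<in> \<Union>\<sigma>" and c: "c \<noteq> 0" for L c
  proof -
    obtain x where x: "x \<in> \<sigma>" "L \<in> x" using L by blast
    have "homothety_class (nr x) = x" by (rule simplices_memD(3)[OF \<sigma>(1) x(1)])
    then have "homothety_class L = x" using x(2) homothety_class_mem_eq[of L "nr x"] by simp
    then have "homothety_class (scale_set c L) = x" using homothety_class_scale_set[OF c, of L] by simp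
    then show ?thesis using homothety_class_self[of "scale_set c L"] x(1) by blast
  qed
  show ?thesis
  proof
    fix L assume L: "L \<in> \<Union>\<sigma>"
    note sL = sub[OF L]
    show "0 \<in> L" by (rule submodule_zero[OF sL])
    show "x + y \<in> L" if "x \<in> L" "y \<in> L" for x y by (rule submodule_add[OF sL that])
    show "- x \<in> L" if "x \<in> L" for x by (rule submodule_uminus[OF sL that])
    show "scale_set c L \<in> \<Union>\<sigma>" if "c \<noteq> 0" for c by (rule scaled[OF L that])
  next
    fix L M assume LM: "L \<in> \<Union>\<sigma>" "M \<in> \<Union>\<sigma>"
    obtain x c where x: "x \<in> \<sigma>" "c \<noteq> 0" "L = scale_set c (nr x)" "normal (nr x)" using rep[OF LM(1)] by blast
    obtain y d where y: "y \<in> \<sigma>" "d \<noteq> 0" "M = scale_set d (nr y)" "normal (nr y)" using rep[OF LM(2)] by blast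
    have ad: "adj (nr x) (nr y)" by (rule simplices_adj[OF \<sigma>(1) x(1) y(1)])
    show "L \<subseteq> M \<or> M \<subseteq> L"
    proof (cases "nr x \<subseteq> nr y")
      case True
      then show ?thesis
        using scaled_adjacent_comparable[OF True _ normalD(4)[OF x(4)] normalD(4)[OF y(4)] x(2) y(2)] ad
        by (simp add: x(3) y(3) adj_def)
    next
      case False
      then have "nr y \<subseteq> nr x" using ad by (auto simp: adj_def)
      then show ?thesis
        using scaled_adjacent_comparable[OF _ _ normalD(4)[OF y(4)] normalD(4)[OF x(4)] y(2) x(2)] ad
        by (auto simp: x(3) y(3) adj_def)
    qed
  next
    fix a :: "'k^'n" assume a: "a \<noteq> 0"
    obtain x where x: "x \<in> \<sigma>" using \<sigma>(2) by blast
    note n = simplices_memD[OF \<sigma>(1) x]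
    obtain c where c: "c \<noteq> 0" "c *s a \<notin> scale_set p (nr x)"
      using unimodular_multiple[OF normalD(1)[OF n(2)] a] by blast
    have "a \<notin> scale_set (p / c) (nr x)"
    proof
      assume "a \<in> scale_set (p / c) (nr x)"
      then have "c *s a \<in> scale_set c (scale_set (p / c) (nr x))" unfolding scale_set_def by (rule imageI)
      then show False using c by (simp add: scale_set_scale_set)
    qed
    moreover have "nr x \<in> \<Union>\<sigma>" using homothety_class_self[of "nr x"] n(3) x by auto
    then have "scale_set (p / c) (nr x) \<in> \<Union>\<sigma>" using p_nonzero c(1) by (intro scaled) simp_all
    ultimately show "\<exists>L\<in>\<Union>\<sigma>. a \<notin> L" by blast
  qed
qed

end

section \<open>Heights and descending links\<close>

context local_field
begin

text \<open>Any function of \<open>nr x\<close> strictly increasing under inclusion would serve;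
  counting lattices is one, finite by local compactness. Distinct vertices may have equal height,
  but not inside one simplex.\<close>

definition height :: "('k^'n) set set \<Rightarrow> nat" where
  "height x = card {M. is_lattice v M \<and> box \<subseteq> M \<and> M \<subseteq> nr x}"

lemma height_less:
  assumes "x \<in> vertices" "y \<in> vertices" "nr x \<subset> nr y" shows "height x < height y"
  unfolding height_def
proof (rule psubset_card_mono)
  have y: "normal (nr y)" using nr_vertex assms(2) by blast
  show "finite {M. is_lattice v M \<and> box \<subseteq> M \<and> M \<subseteq> nr y}"
    by (rule finite_lattices_between[OF is_lattice_box normalD(1)[OF y]])
  have "nr y \<in> {M. is_lattice v M \<and> box \<subseteq> M \<and> M \<subseteq> nr y}" using normalD[OF y] by blast
  moreover have "nr y \<notin> {M. is_lattice v M \<and> box \<subseteq> M \<and> M \<subseteq> nr x}" using assms(3) by blast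
  ultimately show "{M. is_lattice v M \<and> box \<subseteq> M \<and> M \<subseteq> nr x} \<subset> {M. is_lattice v M \<and> box \<subseteq> M \<and> M \<subseteq> nr y}"
    using assms(3) by blast
qed

lemma simplex_height:
  assumes "\<sigma> \<in> simplices" "x \<in> \<sigma>" "y \<in> \<sigma>"
  shows "height x < height y \<longleftrightarrow> nr x \<subset> nr y" "height x = height y \<longleftrightarrow> x = y"
proof -
  have v: "x \<in> vertices" "y \<in> vertices" using assms simplices_memD(1) by blast+
  have ad: "adj (nr x) (nr y)" by (rule simplices_adj[OF assms])
  consider "nr x \<subset> nr y" | "nr y \<subset> nr x" | "x = y"
    using nr_eqD[OF v] ad by (auto simp: adj_def)
  then have "(height x < height y \<longleftrightarrow> nr x \<subset> nr y) \<and> (height x = height y \<longleftrightarrow> x = y)"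
  proof cases
    case 1
    then show ?thesis using height_less[OF v 1] by auto
  next
    case 2
    then show ?thesis using height_less[OF v(2,1) 2] by auto
  qed simp
  then show "height x < height y \<longleftrightarrow> nr x \<subset> nr y" "height x = height y \<longleftrightarrow> x = y" by blast+
qed

lemma finite_lower_vertices:
  fixes z :: "('k^'n) set set"
  assumes "z \<in> vertices" shows "finite {y \<in> vertices. nr y \<subseteq> nr z}"
proof -
  have "nr ` {y \<in> vertices. nr y \<subseteq> nr z} \<subseteq> {M. is_lattice v M \<and> box \<subseteq> M \<and> M \<subseteq> nr z}"
  proof
    fix M assume "M \<in> nr ` {y \<in> vertices. nr y \<subseteq> nr z}"
    then obtain y where y: "y \<in> vertices" "nr y \<subseteq> nr z" "M = nr y" by blast
    then show "M \<in> {M. is_lattice v M \<and> box \<subseteq> M \<and> M \<subseteq> nr z}"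
      using normalD(1,2)[OF nr_vertex(1)[OF y(1)]] by blast
  qed
  then have "finite (nr ` {y \<in> vertices. nr y \<subseteq> nr z})"
    by (rule finite_subset) (rule finite_lattices_between[OF is_lattice_box normalD(1)[OF nr_vertex(1)[OF assms]]])
  moreover have "inj_on nr {y \<in> vertices. nr y \<subseteq> nr z}" by (rule inj_onI, rule nr_eqD) auto
  ultimately show ?thesis by (rule finite_imageD)
qed

text \<open>A property of lattices that is stable under intersection cuts out of a descending link a set of
  lattices with a smallest element, hence a cone (or the empty set).\<close>

lemma descending_link_apex:
  fixes z :: "('k^'n) set set"
  assumes z: "z \<in> vertices" and Q: "\<And>L M. Q L \<Longrightarrow> Q M \<Longrightarrow> Q (L \<inter> M)"
    and y: "y \<in> vertices" "nr y \<subset> nr z" "scale_set p (nr z) \<subseteq> nr y" "Q (nr y)"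
  obtains m where "m \<in> vertices" "Q (nr m)" "height m < height z"
    "\<And>\<tau>. \<lbrakk>insert z \<tau> \<in> simplices; \<And>x. x \<in> \<tau> \<Longrightarrow> height x < height z \<and> Q (nr x)\<rbrakk>
      \<Longrightarrow> insert z (insert m \<tau>) \<in> simplices"
proof -
  let ?F = "{L. normal L \<and> L \<subset> nr z \<and> scale_set p (nr z) \<subseteq> L \<and> Q L}"
  have nz: "normal (nr z)" by (rule nr_vertex(1)[OF z])
  have "?F \<subseteq> {M. is_lattice v M \<and> box \<subseteq> M \<and> M \<subseteq> nr z}" using normalD(1,2) by blast
  then have "finite ?F"
    by (rule finite_subset) (rule finite_lattices_between[OF is_lattice_box normalD(1)[OF nz]])
  moreover have yF: "nr y \<in> ?F" using y nr_vertex(1) by blast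
  ultimately obtain K where K: "K \<in> ?F" "\<forall>L\<in>?F. L \<subseteq> K \<longrightarrow> K = L"
    using finite_has_minimal[of ?F] by blast
  have least: "K \<subseteq> L" if L: "L \<in> ?F" for L
  proof -
    \<comment> \<open>\<open>box\<close> lies in both lattices, and \<open>p\<close> times the
      intersection is too small to contain it. So the intersection is a candidate, and the minimal
      \<open>K\<close> is the least one.\<close>
    have "is_lattice v (K \<inter> L)" using K(1) L by (intro is_lattice_Int) (auto simp: normal_def)
    moreover have "scale_set p (K \<inter> L) \<subseteq> scale_set p K" by (rule scale_set_mono) blast
    ultimately have "normal (K \<inter> L)" using K(1) L by (auto simp: normal_def)
    then have "K \<inter> L \<in> ?F" using K(1) L Q[of K L] by blast
    then have "K = K \<inter> L" using K(2) by blast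
    then show ?thesis by blast
  qed
  let ?m = "homothety_class K"
  have Kn: "normal K" using K(1) by blast
  have m: "?m \<in> vertices" "nr ?m = K" using normal_vertex[OF Kn] nr_homothety_class[OF Kn] by blast+
  show thesis
  proof (rule that[of ?m])
    show "?m \<in> vertices" "Q (nr ?m)" using m K(1) by auto
    show "height ?m < height z" using height_less[OF m(1) z] m(2) K(1) by simp
    fix \<tau> assume \<tau>: "insert z \<tau> \<in> simplices" and h: "\<And>x. x \<in> \<tau> \<Longrightarrow> height x < height z \<and> Q (nr x)"
    have pK: "scale_set p K \<subseteq> K" by (rule scale_set_p_subset[OF normalD(4)[OF Kn]])
    have 1: "adj (nr ?m) (nr x)" if x: "x \<in> insert z \<tau>" for x
    proof (cases "x = z")
      case True
      then show ?thesis using m(2) K(1) pK by (auto simp: adj_def)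
    next
      case False
      then have "x \<in> \<tau>" using x by blast
      then have less: "nr x \<subset> nr z" using simplex_height(1)[OF \<tau>, of x z] h by auto
      have "adj (nr z) (nr x)" by (rule simplices_adj[OF \<tau>]) (use x in auto)
      then have "scale_set p (nr z) \<subseteq> nr x" by (auto simp: adj_def)
      moreover have "normal (nr x)" by (rule simplices_memD(2)[OF \<tau> x])
      ultimately have "nr x \<in> ?F" using h[OF \<open>x \<in> \<tau>\<close>] less by blast
      then have Kx: "K \<subseteq> nr x" by (rule least)
      have "scale_set p (nr x) \<subseteq> scale_set p (nr z)" using less by (intro scale_set_mono) blast
      then have "scale_set p (nr x) \<subseteq> K" using K(1) by blast
      then show ?thesis using Kx pK m(2) by (auto simp: adj_def)
    qed
    moreover have "adj (nr ?m) (nr ?m)" using pK m(2) by (auto simp: adj_def)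
    moreover have "adj (nr x) (nr ?m)" if "x \<in> insert z \<tau>" for x by (rule adj_sym[OF 1[OF that]])
    ultimately have "\<forall>x\<in>insert ?m (insert z \<tau>). \<forall>y\<in>insert ?m (insert z \<tau>). adj (nr x) (nr y)"
      using simplices_adj[OF \<tau>] by auto
    moreover have "finite (insert ?m (insert z \<tau>))" "insert ?m (insert z \<tau>) \<subseteq> vertices"
      using \<tau> m(1) by (auto simp: simplices_def)
    ultimately have "insert ?m (insert z \<tau>) \<in> simplices" unfolding simplices_def by blast
    then show "insert z (insert ?m \<tau>) \<in> simplices" by (simp only: insert_commute)
  qed
qed

end

section \<open>Coboundaries with signs\<close>

text \<open>Removing two vertices in either order gives opposite signs. Stated for one set
  \<open>X\<close>, the rule passes to links that use the signs of the larger simplex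
  \<open>insert z \<tau>\<close>.\<close>

definition sign_rule :: "('v set \<Rightarrow> 'v \<Rightarrow> nat) \<Rightarrow> 'v set \<Rightarrow> bool" where
  "sign_rule e X \<longleftrightarrow> (\<forall>x\<in>X. \<forall>y\<in>X. x \<noteq> y \<longrightarrow> even (e X x + e (X - {x}) y) \<noteq> even (e X y + e (X - {y}) x))"

definition cob :: "('v set \<Rightarrow> 'v \<Rightarrow> nat) \<Rightarrow> ('v set \<Rightarrow> 'm::ab_group_add) \<Rightarrow> 'v set \<Rightarrow> 'm" where
  "cob e c X = (\<Sum>x\<in>X. signed (e X x) (c (X - {x})))"

lemma sign_ruleD:
  assumes "sign_rule e X" "x \<in> X" "y \<in> X" "x \<noteq> y"
  shows "signed (e X x + e (X - {x}) y) a = - signed (e X y + e (X - {y}) x) a"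
  using assms unfolding sign_rule_def by (intro signed_opposite_parity) blast

lemma cob_zero: "cob e (\<lambda>_. 0) X = 0"
  by (simp add: cob_def)

lemma cob_add: "cob e (\<lambda>\<rho>. b \<rho> + c \<rho>) X = cob e b X + cob e c X"
  by (simp add: cob_def signed_add sum.distrib)

lemma cob_diff: "cob e (\<lambda>\<rho>. b \<rho> - c \<rho>) X = cob e b X - cob e c X"
  by (simp add: cob_def signed_diff sum_subtractf)

lemma cob_cong: "(\<And>x. x \<in> X \<Longrightarrow> b (X - {x}) = c (X - {x})) \<Longrightarrow> cob e b X = cob e c X"
  by (simp add: cob_def)

lemma cob_cob:
  assumes X: "finite X" and e: "sign_rule e X"
  shows "cob e (cob e c) X = 0"
proof -
  let ?F = "\<lambda>x y. if x = y then 0 else signed (e X x + e (X - {x}) y) (c (X - {x} - {y}))"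
  have anti: "?F y x = - ?F x y" if "x \<in> X" "y \<in> X" for x y
    using sign_ruleD[OF e that(2,1)] by (auto simp: Diff_insert2[symmetric] insert_commute)
  have "cob e (cob e c) X = (\<Sum>x\<in>X. \<Sum>y\<in>X. ?F x y)"
  proof (unfold cob_def[of e "cob e c"], intro sum.cong refl)
    fix x assume "x \<in> X"
    have "signed (e X x) (cob e c (X - {x})) = (\<Sum>y\<in>X - {x}. ?F x y)"
      unfolding cob_def signed_sum by (intro sum.cong) auto
    also have "\<dots> = (\<Sum>y\<in>X. ?F x y)"
      using X by (intro sum.mono_neutral_left) auto
    finally show "signed (e X x) (cob e c (X - {x})) = (\<Sum>y\<in>X. ?F x y)" .
  qed
  \<comment> \<open>The cancellation in pairs is organised by a total order, since the group may
    have 2-torsion.\<close>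
  also have "\<dots> = (\<Sum>x\<in>X. \<Sum>y\<in>X. (if gen_less x y then ?F x y else 0)) +
      (\<Sum>x\<in>X. \<Sum>y\<in>X. (if gen_less y x then ?F x y else 0))"
  proof -
    have "?F x y = (if gen_less x y then ?F x y else 0) + (if gen_less y x then ?F x y else 0)" for x y
    proof (cases "x = y")
      case False
      then consider "gen_less x y" "\<not> gen_less y x" | "gen_less y x" "\<not> gen_less x y"
        using gen_less_linear[OF False] gen_less_asym[of x y] by blast
      then show ?thesis by cases simp_all
    qed simp
    then show ?thesis unfolding sum.distrib[symmetric] by (intro sum.cong refl)
  qed
  also have "(\<Sum>x\<in>X. \<Sum>y\<in>X. (if gen_less y x then ?F x y else 0)) =
      (\<Sum>x\<in>X. \<Sum>y\<in>X. (if gen_less x y then ?F y x else 0))"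
    by (rule sum.swap)
  also have "\<dots> = (\<Sum>x\<in>X. \<Sum>y\<in>X. - (if gen_less x y then ?F x y else 0))"
  proof (intro sum.cong refl)
    fix x y assume "x \<in> X" "y \<in> X"
    then show "(if gen_less x y then ?F y x else 0) = - (if gen_less x y then ?F x y else 0)"
      by (subst anti) simp_all
  qed
  finally show ?thesis by (simp add: sum_negf)
qed


section \<open>Acyclicity of a link by induction on the leading monomial\<close>

text \<open>\<open>NB S \<tau>\<close> means that the monomial of \<open>S\<close> belongs to the
  monomial basis at \<tau>; \<open>reduction\<close> and \<open>leading\<close> are the spanning and
  the independence half of that statement. \<open>apex\<close> makes the simplices where the
  monomial survives a cone as soon as one of them is non-empty.\<close>

locale filtered_link = monomial_order less
  for less :: "'l \<Rightarrow> 'l \<Rightarrow> bool" +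
  fixes A :: "'l set"
    and Lk :: "'v set set"
    and e :: "'v set \<Rightarrow> 'v \<Rightarrow> nat"
    and J :: "'v set \<Rightarrow> ('l set \<Rightarrow> 'r::{comm_ring, comm_monoid_mult}) set"
    and NB :: "'l set \<Rightarrow> 'v set \<Rightarrow> bool"
  assumes finite_Lk: "finite Lk"
    and finite_in_Lk: "\<tau> \<in> Lk \<Longrightarrow> finite \<tau>"
    and Lk_subset: "\<tau> \<in> Lk \<Longrightarrow> \<rho> \<subseteq> \<tau> \<Longrightarrow> \<rho> \<in> Lk"
    and sign: "\<tau> \<in> Lk \<Longrightarrow> sign_rule e \<tau>"
    and J_zero: "\<tau> \<in> Lk \<Longrightarrow> 0 \<in> J \<tau>"
    and J_add: "\<tau> \<in> Lk \<Longrightarrow> f \<in> J \<tau> \<Longrightarrow> g \<in> J \<tau> \<Longrightarrow> f + g \<in> J \<tau>"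
    and J_uminus: "\<tau> \<in> Lk \<Longrightarrow> f \<in> J \<tau> \<Longrightarrow> - f \<in> J \<tau>"
    and J_mono: "\<tau> \<in> Lk \<Longrightarrow> \<rho> \<subseteq> \<tau> \<Longrightarrow> J \<rho> \<subseteq> J \<tau>"
    and NB_subset: "\<tau> \<in> Lk \<Longrightarrow> NB S \<tau> \<Longrightarrow> \<rho> \<subseteq> \<tau> \<Longrightarrow> NB S \<rho>"
    and reduction: "\<lbrakk>\<tau> \<in> Lk; finite S; S \<subseteq> A; \<not> NB S \<tau>\<rbrakk> \<Longrightarrow>
      \<exists>h\<in>carrier (ext_alg A). (\<forall>T. h T \<noteq> 0 \<longrightarrow> colex T S) \<and> ext_mon S r - h \<in> J \<tau>"
    and leading: "\<lbrakk>\<tau> \<in> Lk; finite S; S \<subseteq> A; NB S \<tau>; f \<in> J \<tau>; \<And>T. f T \<noteq> 0 \<Longrightarrow> T = S \<or> colex T S\<rbrakk> \<Longrightarrow> f S = 0"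
    and apex: "\<lbrakk>\<tau> \<in> Lk; \<tau> \<noteq> {}; finite S; S \<subseteq> A; NB S \<tau>\<rbrakk> \<Longrightarrow>
      \<exists>m. \<forall>\<tau>\<in>Lk. NB S \<tau> \<longrightarrow> insert m \<tau> \<in> Lk \<and> NB S (insert m \<tau>)"
begin

lemma J_diff: "\<tau> \<in> Lk \<Longrightarrow> f \<in> J \<tau> \<Longrightarrow> g \<in> J \<tau> \<Longrightarrow> f - g \<in> J \<tau>"
  using J_add[of \<tau> f "- g"] J_uminus[of \<tau> g] by simp

lemma J_signed: "\<tau> \<in> Lk \<Longrightarrow> f \<in> J \<tau> \<Longrightarrow> signed n f \<in> J \<tau>"
  using J_uminus[of \<tau> f] by (cases "even n") (simp_all only: signed_def if_True if_False)

lemma J_sum: "\<tau> \<in> Lk \<Longrightarrow> (\<And>i. i \<in> I \<Longrightarrow> f i \<in> J \<tau>) \<Longrightarrow> sum f I \<in> J \<tau>"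
proof (induction I rule: infinite_finite_induct)
  case (insert i I)
  then show ?case unfolding sum.insert[OF insert.hyps] by (intro J_add) auto
next
  case empty
  then show ?case by (simp only: sum.empty J_zero)
next
  case (infinite I)
  then show ?case unfolding sum.infinite[OF infinite.hyps] by (intro J_zero)
qed

lemma cob_in_J:
  assumes "\<tau> \<in> Lk" "\<And>x. x \<in> \<tau> \<Longrightarrow> c (\<tau> - {x}) \<in> J (\<tau> - {x})"
  shows "cob e c \<tau> \<in> J \<tau>"
  unfolding cob_def
proof (intro J_sum J_signed assms(1))
  fix x assume "x \<in> \<tau>"
  then show "c (\<tau> - {x}) \<in> J \<tau>" using assms J_mono[of \<tau> "\<tau> - {x}"] by blast
qed

lemma cob_in_carrier:
  "(\<And>\<rho>. c \<rho> \<in> carrier (ext_alg A)) \<Longrightarrow> cob e c \<tau> \<in> carrier (ext_alg A)"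
  unfolding cob_def by (intro sum_in_carrier signed_in_carrier)

text \<open>Degrees count vertices, so the empty simplex sits in degree 0. Values are
  representatives, and the condition holds only modulo \<open>J\<close>.\<close>

definition cocycle :: "nat \<Rightarrow> ('v set \<Rightarrow> 'l set \<Rightarrow> 'r) \<Rightarrow> bool" where
  "cocycle k g \<longleftrightarrow> (\<forall>\<rho>. g \<rho> \<in> carrier (ext_alg A)) \<and> (\<forall>\<tau>\<in>Lk. card \<tau> = Suc k \<longrightarrow> cob e g \<tau> \<in> J \<tau>)"

definition bounding :: "nat \<Rightarrow> ('v set \<Rightarrow> 'l set \<Rightarrow> 'r) \<Rightarrow> bool" where
  "bounding k g \<longleftrightarrow> (\<exists>u. (\<forall>\<rho>. u \<rho> \<in> carrier (ext_alg A)) \<and> (\<forall>\<tau>\<in>Lk. card \<tau> = k \<longrightarrow> g \<tau> - cob e u \<tau> \<in> J \<tau>))"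

lemma sum_fun_apply: "(\<Sum>i\<in>I. f i) x = (\<Sum>i\<in>I. f i x)" for f :: "'i \<Rightarrow> 'a \<Rightarrow> 'b::comm_monoid_add"
  by (induction I rule: infinite_finite_induct) simp_all

lemma cob_ext_mon: "cob e (\<lambda>\<rho>. ext_mon S (w \<rho>)) \<tau> = ext_mon S (cob e w \<tau>)"
proof
  fix T
  show "cob e (\<lambda>\<rho>. ext_mon S (w \<rho>)) \<tau> T = ext_mon S (cob e w \<tau>) T"
    by (simp add: cob_def sum_fun_apply signed_fun ext_mon_def)
qed

lemma cob_apply: "cob e g \<tau> S = cob e (\<lambda>\<rho>. g \<rho> S) \<tau>"
  by (simp add: cob_def sum_fun_apply signed_fun)

text \<open>The contraction of the simplices on which \<open>e\<^sub>S\<close> survives towards the apex \<open>m\<close>.\<close>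

lemma cone_contraction:
  assumes k: "k \<ge> 1" and S: "finite S" "S \<subseteq> A"
    and a: "\<And>\<tau>. \<lbrakk>\<tau> \<in> Lk; card \<tau> = Suc k; NB S \<tau>\<rbrakk> \<Longrightarrow> cob e a \<tau> = (0 :: 'r)"
  shows "\<exists>w. \<forall>\<tau>\<in>Lk. card \<tau> = k \<longrightarrow> NB S \<tau> \<longrightarrow> cob e w \<tau> = a \<tau>"
proof (cases "\<exists>\<tau>\<in>Lk. card \<tau> = k \<and> NB S \<tau>")
  case True
  then obtain \<tau>0 where "\<tau>0 \<in> Lk" "card \<tau>0 = k" "NB S \<tau>0" by blast
  moreover then have "\<tau>0 \<noteq> {}" using k by auto
  ultimately obtain m where m: "\<And>\<tau>. \<tau> \<in> Lk \<Longrightarrow> NB S \<tau> \<Longrightarrow> insert m \<tau> \<in> Lk \<and> NB S (insert m \<tau>)"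
    using apex[of \<tau>0 S] S by blast
  define w where "w \<rho> = (if m \<in> \<rho> then 0 else signed (e (insert m \<rho>) m) (a (insert m \<rho>)))" for \<rho>
  have "cob e w \<tau> = a \<tau>" if \<tau>: "\<tau> \<in> Lk" "card \<tau> = k" "NB S \<tau>" for \<tau>
  proof (cases "m \<in> \<tau>")
    case True
    have "cob e w \<tau> = (\<Sum>x\<in>\<tau>. if x = m then a \<tau> else 0)"
      unfolding cob_def by (intro sum.cong refl) (use True in \<open>auto simp: w_def insert_absorb\<close>)
    then show ?thesis using True finite_in_Lk[OF \<tau>(1)] by simp
  next
    case False
    let ?\<sigma> = "insert m \<tau>"
    have fin: "finite \<tau>" by (rule finite_in_Lk[OF \<tau>(1)])
    have \<sigma>: "?\<sigma> \<in> Lk" "NB S ?\<sigma>" using m[OF \<tau>(1,3)] by blast+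
    have face: "?\<sigma> - {x} = insert m (\<tau> - {x})" if "x \<in> \<tau>" for x using that False by auto
    have "card ?\<sigma> = Suc k" using False fin \<tau>(2) by simp
    then have "cob e a ?\<sigma> = 0" by (intro a \<sigma>)
    moreover have "?\<sigma> - {m} = \<tau>" using False by auto
    ultimately have zero: "signed (e ?\<sigma> m) (a \<tau>) + (\<Sum>x\<in>\<tau>. signed (e ?\<sigma> x) (a (?\<sigma> - {x}))) = 0"
      using False fin by (simp add: cob_def)
    have "cob e w \<tau> = (\<Sum>x\<in>\<tau>. - signed (e ?\<sigma> m + e ?\<sigma> x) (a (?\<sigma> - {x})))"
      unfolding cob_def
    proof (intro sum.cong refl)
      fix x assume x: "x \<in> \<tau>"
      have "signed (e ?\<sigma> m + e (?\<sigma> - {m}) x) b = - signed (e ?\<sigma> x + e (?\<sigma> - {x}) m) b" for b :: 'r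
        by (rule sign_ruleD[OF sign[OF \<sigma>(1)]]) (use x False in auto)
      then have *: "even (e ?\<sigma> m + e \<tau> x) \<noteq> even (e ?\<sigma> x + e (?\<sigma> - {x}) m)"
        using sign[OF \<sigma>(1)] x False \<open>?\<sigma> - {m} = \<tau>\<close> unfolding sign_rule_def by (metis insertCI)
      have "w (\<tau> - {x}) = signed (e (?\<sigma> - {x}) m) (a (?\<sigma> - {x}))"
        using False face[OF x] by (simp add: w_def)
      then have "signed (e \<tau> x) (w (\<tau> - {x})) = signed (e \<tau> x + e (?\<sigma> - {x}) m) (a (?\<sigma> - {x}))"
        by simp
      also have "\<dots> = - signed (e ?\<sigma> m + e ?\<sigma> x) (a (?\<sigma> - {x}))"
        by (rule signed_opposite_parity) (use * in auto)
      finally show "signed (e \<tau> x) (w (\<tau> - {x})) = - signed (e ?\<sigma> m + e ?\<sigma> x) (a (?\<sigma> - {x}))" .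
    qed
    also have "\<dots> = - signed (e ?\<sigma> m) (\<Sum>x\<in>\<tau>. signed (e ?\<sigma> x) (a (?\<sigma> - {x})))"
      by (simp add: signed_sum sum_negf)
    also have "(\<Sum>x\<in>\<tau>. signed (e ?\<sigma> x) (a (?\<sigma> - {x}))) = - signed (e ?\<sigma> m) (a \<tau>)"
      using zero by (simp add: eq_neg_iff_add_eq_0 add.commute)
    finally show ?thesis by (simp add: signed_minus)
  qed
  then show ?thesis by blast
qed blast

text \<open>On the simplices with \<open>NB S\<close> the coefficients at \<open>S\<close> form an
  honest cocycle, since by \<open>leading\<close> an element of \<open>J\<close> has no such leading
  term. The cone bounds this cocycle; elsewhere the monomial of \<open>S\<close> is traded for
  smaller ones, and the leading monomial drops.\<close>

lemma bounding_if_leading_le: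
  assumes k: "k \<ge> 1"
  shows "finite S \<Longrightarrow> S \<subseteq> A \<Longrightarrow> cocycle k g \<Longrightarrow>
    (\<And>\<tau> T. \<lbrakk>\<tau> \<in> Lk; card \<tau> = k; g \<tau> T \<noteq> 0\<rbrakk> \<Longrightarrow> T = S \<or> colex T S) \<Longrightarrow> bounding k g"
proof (induction S arbitrary: g rule: wf_induct_rule[OF wf_colex])
  case (1 S)
  note S = 1(2,3) and g = 1(4) and lead = 1(5)
  have gc: "g \<rho> \<in> carrier (ext_alg A)" for \<rho> using g by (simp add: cocycle_def)
  have "cob e (\<lambda>\<rho>. g \<rho> S) \<tau> = 0" if \<tau>: "\<tau> \<in> Lk" "card \<tau> = Suc k" "NB S \<tau>" for \<tau>
  proof -
    have "cob e g \<tau> S = 0"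
    proof (rule leading[OF \<tau>(1) S \<tau>(3)])
      show "cob e g \<tau> \<in> J \<tau>" using g \<tau> by (simp add: cocycle_def)
      fix T assume "cob e g \<tau> T \<noteq> 0"
      then obtain x where x: "x \<in> \<tau>" "g (\<tau> - {x}) T \<noteq> 0"
        unfolding cob_apply by (auto simp: cob_def elim!: sum.not_neutral_contains_not_neutral)
      moreover have "card (\<tau> - {x}) = k" using \<tau>(2) x(1) finite_in_Lk[OF \<tau>(1)] by simp
      ultimately show "T = S \<or> colex T S" using lead[of "\<tau> - {x}" T] Lk_subset[OF \<tau>(1)] by blast
    qed
    then show ?thesis by (simp add: cob_apply)
  qed
  then obtain w where w: "\<And>\<tau>. \<lbrakk>\<tau> \<in> Lk; card \<tau> = k; NB S \<tau>\<rbrakk> \<Longrightarrow> cob e w \<tau> = g \<tau> S"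
    using cone_contraction[OF k S, of "\<lambda>\<rho>. g \<rho> S"] by blast
  \<comment> \<open>Corrects the coefficient at \<open>S\<close> and leaves all others
    untouched.\<close>
  define u1 where "u1 \<rho> = ext_mon S (w \<rho>)" for \<rho>
  have u1c: "u1 \<rho> \<in> carrier (ext_alg A)" for \<rho> unfolding u1_def by (rule ext_mon_in_carrier[OF S])
  define g1 where "g1 \<tau> = g \<tau> - cob e u1 \<tau>" for \<tau>
  have g1c: "g1 \<tau> \<in> carrier (ext_alg A)" for \<tau>
    unfolding g1_def by (intro diff_in_carrier gc cob_in_carrier u1c)
  have g1_eq: "g1 \<tau> T = g \<tau> T" if "T \<noteq> S" for \<tau> T
    using that unfolding g1_def u1_def cob_ext_mon by (simp add: ext_mon_def)
  have g1_S: "g1 \<tau> S = g \<tau> S - cob e w \<tau>" for \<tau>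
    unfolding g1_def u1_def cob_ext_mon by (simp add: ext_mon_def)
  have "\<exists>h\<in>carrier (ext_alg A). (\<forall>T. h T \<noteq> 0 \<longrightarrow> colex T S) \<and> ext_mon S (g1 \<tau> S) - h \<in> J \<tau>"
    if \<tau>: "\<tau> \<in> Lk" "card \<tau> = k" for \<tau>
  proof (cases "NB S \<tau>")
    case True
    then have "ext_mon S (g1 \<tau> S) = 0" using w[OF \<tau>] by (simp add: g1_S)
    then have "ext_mon S (g1 \<tau> S) - 0 \<in> J \<tau>" using J_zero[OF \<tau>(1)] by (simp only: diff_0_right)
    then show ?thesis using zero_in_carrier by (intro bexI[of _ 0]) auto
  next
    case False
    then show ?thesis using reduction[OF \<tau>(1) S] by blast
  qed
  then obtain h where h: "\<And>\<tau>. \<lbrakk>\<tau> \<in> Lk; card \<tau> = k\<rbrakk> \<Longrightarrow> h \<tau> \<in> carrier (ext_alg A) \<and>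
      (\<forall>T. h \<tau> T \<noteq> 0 \<longrightarrow> colex T S) \<and> ext_mon S (g1 \<tau> S) - h \<tau> \<in> J \<tau>"
    by metis
  \<comment> \<open>The subtracted term lies in \<open>J \<tau>\<close>, so the class is unchanged,
    while the monomial of \<open>S\<close> gives way to the smaller ones in
    \<open>h\<close>.\<close>
  define g2 where "g2 \<tau> = (if \<tau> \<in> Lk \<and> card \<tau> = k then g1 \<tau> - (ext_mon S (g1 \<tau> S) - h \<tau>) else 0)" for \<tau>
  have g2c: "g2 \<tau> \<in> carrier (ext_alg A)" for \<tau>
    unfolding g2_def using h g1c S
    by (auto simp: zero_in_carrier intro!: diff_in_carrier ext_mon_in_carrier)
  have g12: "g1 \<tau> - g2 \<tau> \<in> J \<tau>" if "\<tau> \<in> Lk" "card \<tau> = k" for \<tau>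
  proof -
    have "g1 \<tau> - g2 \<tau> = ext_mon S (g1 \<tau> S) - h \<tau>" using that by (simp add: g2_def)
    then show ?thesis using h[OF that] by (simp only:)
  qed
  have small: "colex T S" if \<tau>: "\<tau> \<in> Lk" "card \<tau> = k" and T: "g2 \<tau> T \<noteq> 0" for \<tau> T
  proof (rule ccontr)
    assume "\<not> colex T S"
    then have "h \<tau> T = 0" using h[OF \<tau>] by blast
    then have "g1 \<tau> T - ext_mon S (g1 \<tau> S) T \<noteq> 0" using T \<tau> by (simp add: g2_def)
    then have "T \<noteq> S" "g1 \<tau> T \<noteq> 0" by (auto simp: ext_mon_def split: if_splits)
    then have "g \<tau> T \<noteq> 0" by (simp add: g1_eq)
    then show False using lead[OF \<tau>] \<open>T \<noteq> S\<close> \<open>\<not> colex T S\<close> by blast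
  qed
  have "cocycle k g2"
    unfolding cocycle_def
  proof (intro conjI allI ballI impI g2c)
    fix \<tau> assume \<tau>: "\<tau> \<in> Lk" "card \<tau> = Suc k"
    have "cob e (\<lambda>\<rho>. g1 \<rho> - g2 \<rho>) \<tau> \<in> J \<tau>"
    proof (rule cob_in_J[OF \<tau>(1)])
      fix x assume "x \<in> \<tau>"
      then show "g1 (\<tau> - {x}) - g2 (\<tau> - {x}) \<in> J (\<tau> - {x})"
        using \<tau> Lk_subset[OF \<tau>(1)] finite_in_Lk[OF \<tau>(1)] by (intro g12) auto
    qed
    moreover have "cob e g1 \<tau> = cob e g \<tau> - cob e (cob e u1) \<tau>" unfolding g1_def by (rule cob_diff)
    then have "cob e g1 \<tau> \<in> J \<tau>"
      using g \<tau> cob_cob[OF finite_in_Lk[OF \<tau>(1)] sign[OF \<tau>(1)], of u1] by (simp add: cocycle_def)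
    ultimately have "cob e g1 \<tau> - cob e (\<lambda>\<rho>. g1 \<rho> - g2 \<rho>) \<tau> \<in> J \<tau>" by (intro J_diff[OF \<tau>(1)])
    then show "cob e g2 \<tau> \<in> J \<tau>" unfolding cob_diff by simp
  qed
  \<comment> \<open>Since the link is finite, only finitely many monomials occur in
    \<open>g2\<close>; the greatest of them is the next \<open>S\<close>.\<close>
  have "bounding k g2"
  proof (cases "{T. \<exists>\<tau>\<in>Lk. card \<tau> = k \<and> g2 \<tau> T \<noteq> 0} = {}")
    case True
    then have "g2 \<tau> = 0" if "\<tau> \<in> Lk" "card \<tau> = k" for \<tau> using that by (auto simp: fun_eq_iff)
    then have "\<forall>\<tau>\<in>Lk. card \<tau> = k \<longrightarrow> g2 \<tau> - cob e (\<lambda>_. 0) \<tau> \<in> J \<tau>"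
      unfolding cob_zero diff_0_right using J_zero by metis
    then show ?thesis
      unfolding bounding_def by (intro exI[of _ "\<lambda>_. 0"] conjI allI zero_in_carrier)
  next
    case False
    let ?X = "{T. \<exists>\<tau>\<in>Lk. card \<tau> = k \<and> g2 \<tau> T \<noteq> 0}"
    have "finite (\<Union>\<tau>\<in>Lk. {T. g2 \<tau> T \<noteq> 0})"
      using finite_Lk g2c by (simp add: carrier_ext_alg)
    then have fX: "finite ?X" by (rule rev_finite_subset) blast
    have X: "finite T \<and> T \<subseteq> A" if "T \<in> ?X" for T using that g2c by (auto simp: carrier_ext_alg)
  have fT: "finite T" if "T \<in> ?X" for T using X[OF that] ..
    have "\<exists>M\<in>?X. \<forall>T\<in>?X. T = M \<or> colex T M"
      by (rule colex_greatest_ex[OF fX False], erule fT, intro bexI ballI; blast)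
    then obtain S' where S': "S' \<in> ?X" and "\<forall>T\<in>?X. T = S' \<or> colex T S'" ..
    then have max: "T = S' \<or> colex T S'" if "T \<in> ?X" for T using that by blast
    have "colex S' S" using S' small by blast
    show ?thesis
    proof (rule 1(1)[of S'])
      show "(S', S) \<in> {(T, S). finite T \<and> finite S \<and> colex T S}"
        using X[OF S'] S(1) \<open>colex S' S\<close> by blast
      show "finite S'" "S' \<subseteq> A" using X[OF S'] by blast+
      show "cocycle k g2" by fact
      show "T = S' \<or> colex T S'" if "\<tau> \<in> Lk" "card \<tau> = k" "g2 \<tau> T \<noteq> 0" for \<tau> T
        using max[of T] that by blast
    qed
  qed
  then obtain u2 where u2: "\<And>\<rho>. u2 \<rho> \<in> carrier (ext_alg A)" "\<And>\<tau>. \<lbrakk>\<tau> \<in> Lk; card \<tau> = k\<rbrakk> \<Longrightarrow> g2 \<tau> - cob e u2 \<tau> \<in> J \<tau>"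
    unfolding bounding_def by blast
  have "g \<tau> - cob e (\<lambda>\<rho>. u1 \<rho> + u2 \<rho>) \<tau> \<in> J \<tau>" if \<tau>: "\<tau> \<in> Lk" "card \<tau> = k" for \<tau>
  proof -
    have "g \<tau> - cob e (\<lambda>\<rho>. u1 \<rho> + u2 \<rho>) \<tau> = (g1 \<tau> - g2 \<tau>) + (g2 \<tau> - cob e u2 \<tau>)"
      unfolding cob_add g1_def by (simp only: algebra_simps)
    then show ?thesis using J_add[OF \<tau>(1) g12[OF \<tau>] u2(2)[OF \<tau>]] by (simp only:)
  qed
  then show "bounding k g"
    unfolding bounding_def using add_in_carrier[OF u1c u2(1)] by (intro exI[of _ "\<lambda>\<rho>. u1 \<rho> + u2 \<rho>"]) blast
qed

theorem cocycle_bounding: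
  assumes k: "k \<ge> 1" and g: "cocycle k g"
  shows "bounding k g"
proof (cases "{T. \<exists>\<tau>\<in>Lk. card \<tau> = k \<and> g \<tau> T \<noteq> 0} = {}")
  case True
  then have "g \<tau> = 0" if "\<tau> \<in> Lk" "card \<tau> = k" for \<tau> using that by (auto simp: fun_eq_iff)
  then have "\<forall>\<tau>\<in>Lk. card \<tau> = k \<longrightarrow> g \<tau> - cob e (\<lambda>_. 0) \<tau> \<in> J \<tau>"
    unfolding cob_zero diff_0_right using J_zero by metis
  then show ?thesis
      unfolding bounding_def by (intro exI[of _ "\<lambda>_. 0"] conjI allI zero_in_carrier)
next
  case False
  let ?X = "{T. \<exists>\<tau>\<in>Lk. card \<tau> = k \<and> g \<tau> T \<noteq> 0}"
  have gc: "g \<rho> \<in> carrier (ext_alg A)" for \<rho> using g by (simp add: cocycle_def)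
  have "finite (\<Union>\<tau>\<in>Lk. {T. g \<tau> T \<noteq> 0})"
    using finite_Lk gc by (simp add: carrier_ext_alg)
  then have fX: "finite ?X" by (rule rev_finite_subset) blast
  have X: "finite T \<and> T \<subseteq> A" if "T \<in> ?X" for T using that gc by (auto simp: carrier_ext_alg)
  have fT: "finite T" if "T \<in> ?X" for T using X[OF that] ..
  have "\<exists>M\<in>?X. \<forall>T\<in>?X. T = M \<or> colex T M"
    by (rule colex_greatest_ex[OF fX False], erule fT, intro bexI ballI; blast)
  then obtain S where S: "S \<in> ?X" and "\<forall>T\<in>?X. T = S \<or> colex T S" ..
  then have max: "T = S \<or> colex T S" if "T \<in> ?X" for T using that by blast
  show ?thesis
  proof (rule bounding_if_leading_le[OF k _ _ g])
    show "finite S" "S \<subseteq> A" using X[OF S] by blast+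
    show "T = S \<or> colex T S" if "\<tau> \<in> Lk" "card \<tau> = k" "g \<tau> T \<noteq> 0" for \<tau> T
      using max[of T] that by blast
  qed
qed

end


section \<open>Acyclicity of a complex filtered by a height function\<close>

locale height_complex =
  fixes Smp :: "'v set set" and ht :: "'v \<Rightarrow> nat" and e :: "'v set \<Rightarrow> 'v \<Rightarrow> nat"
    and J :: "'v set \<Rightarrow> 'm::ab_group_add set" and E :: "'m set"
  assumes finite_in_Smp: "\<sigma> \<in> Smp \<Longrightarrow> finite \<sigma>"
    and Smp_subset: "\<sigma> \<in> Smp \<Longrightarrow> \<tau> \<subseteq> \<sigma> \<Longrightarrow> \<tau> \<in> Smp"
    and ht_inj: "\<sigma> \<in> Smp \<Longrightarrow> x \<in> \<sigma> \<Longrightarrow> y \<in> \<sigma> \<Longrightarrow> ht x = ht y \<Longrightarrow> x = y"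
    and sign: "\<sigma> \<in> Smp \<Longrightarrow> sign_rule e \<sigma>"
    and J_add: "\<sigma> \<in> Smp \<Longrightarrow> f \<in> J \<sigma> \<Longrightarrow> g \<in> J \<sigma> \<Longrightarrow> f + g \<in> J \<sigma>"
    and J_uminus: "\<sigma> \<in> Smp \<Longrightarrow> f \<in> J \<sigma> \<Longrightarrow> - f \<in> J \<sigma>"
    and J_mono: "\<sigma> \<in> Smp \<Longrightarrow> \<tau> \<subseteq> \<sigma> \<Longrightarrow> J \<tau> \<subseteq> J \<sigma>"
    and E_zero: "0 \<in> E" and E_add: "f \<in> E \<Longrightarrow> g \<in> E \<Longrightarrow> f + g \<in> E" and E_uminus: "f \<in> E \<Longrightarrow> - f \<in> E"
begin

definition link :: "'v \<Rightarrow> 'v set set" where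
  "link z = {\<tau>. z \<notin> \<tau> \<and> insert z \<tau> \<in> Smp \<and> (\<forall>y\<in>\<tau>. ht y < ht z)}"

lemma J_signed: "\<sigma> \<in> Smp \<Longrightarrow> f \<in> J \<sigma> \<Longrightarrow> signed n f \<in> J \<sigma>"
  using J_uminus[of \<sigma> f] by (simp add: signed_def)

lemma J_diff: "\<sigma> \<in> Smp \<Longrightarrow> f \<in> J \<sigma> \<Longrightarrow> g \<in> J \<sigma> \<Longrightarrow> f - g \<in> J \<sigma>"
  using J_add[of \<sigma> f "- g"] J_uminus[of \<sigma> g] by simp

lemma E_diff: "f \<in> E \<Longrightarrow> g \<in> E \<Longrightarrow> f - g \<in> E"
  using E_add[of f "- g"] E_uminus[of g] by simp

lemma E_signed: "f \<in> E \<Longrightarrow> signed n f \<in> E"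
  using E_uminus[of f] by (simp add: signed_def)

context
  fixes k :: nat and c :: "'v set \<Rightarrow> 'm"
  assumes local_exact: "\<And>z g. \<lbrakk>\<And>\<rho>. g \<rho> \<in> E;
      \<And>\<tau>. \<lbrakk>\<tau> \<in> link z; card \<tau> = Suc k\<rbrakk> \<Longrightarrow> cob (\<lambda>\<tau>. e (insert z \<tau>)) g \<tau> \<in> J (insert z \<tau>)\<rbrakk> \<Longrightarrow>
      \<exists>u. (\<forall>\<rho>. u \<rho> \<in> E) \<and> (\<forall>\<tau>\<in>link z. card \<tau> = k \<longrightarrow> g \<tau> - cob (\<lambda>\<tau>. e (insert z \<tau>)) u \<tau> \<in> J (insert z \<tau>))"
    and c_E: "\<And>\<rho>. c \<rho> \<in> E"
    and c_cocycle: "\<And>\<sigma>. \<lbrakk>\<sigma> \<in> Smp; card \<sigma> = Suc (Suc k)\<rbrakk> \<Longrightarrow> cob e c \<sigma> \<in> J \<sigma>"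
begin

definition solves :: "nat \<Rightarrow> ('v set \<Rightarrow> 'm) \<Rightarrow> bool" where
  "solves n b \<longleftrightarrow> (\<forall>\<rho>. b \<rho> \<in> E) \<and>
    (\<forall>\<sigma>\<in>Smp. card \<sigma> = Suc k \<longrightarrow> (\<forall>x\<in>\<sigma>. ht x < n) \<longrightarrow> c \<sigma> - cob e b \<sigma> \<in> J \<sigma>)"

lemma cob_insert:
  assumes "finite \<tau>" "z \<notin> \<tau>"
  shows "cob e b (insert z \<tau>) =
    signed (e (insert z \<tau>) z) (b \<tau>) + (\<Sum>x\<in>\<tau>. signed (e (insert z \<tau>) x) (b (insert z (\<tau> - {x}))))"
proof -
  have "insert z \<tau> - {z} = \<tau>" using assms(2) by auto
  moreover have "(\<Sum>x\<in>\<tau>. signed (e (insert z \<tau>) x) (b (insert z \<tau> - {x}))) =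
      (\<Sum>x\<in>\<tau>. signed (e (insert z \<tau>) x) (b (insert z (\<tau> - {x}))))"
    by (intro sum.cong refl arg_cong[where f = "signed _"] arg_cong[where f = b]) (use assms(2) in auto)
  ultimately show ?thesis using assms by (simp add: cob_def)
qed

text \<open>A simplex whose top vertex \<open>z\<close> has height \<open>n\<close> is the join of
  \<open>z\<close> with a simplex of its descending link. What the values already fixed leave over
  is a cocycle on that link, and bounding it there prescribes the values on the simplices through
  \<open>z\<close>.\<close>

lemma extend_solution:
  assumes b: "solves n b"
  shows "\<exists>b'. solves (Suc n) b' \<and> (\<forall>\<rho>. (\<forall>x\<in>\<rho>. ht x < n) \<longrightarrow> b' \<rho> = b \<rho>)"
proof -
  have bE: "b \<rho> \<in> E" for \<rho> using b by (simp add: solves_def)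
  \<comment> \<open>The part of the equation on \<open>insert z \<tau>\<close> still to be matched,
    once the face \<tau> opposite to \<open>z\<close> has contributed.\<close>
  define g where "g z \<tau> = c (insert z \<tau>) - signed (e (insert z \<tau>) z) (b \<tau>)" for z \<tau>
  have gE: "g z \<tau> \<in> E" for z \<tau> unfolding g_def by (intro E_diff E_signed c_E bE)
  have "cob (\<lambda>\<tau>. e (insert z \<tau>)) (g z) \<tau> \<in> J (insert z \<tau>)"
    if z: "ht z = n" and \<tau>: "\<tau> \<in> link z" "card \<tau> = Suc k" for z \<tau>
  proof -
    let ?\<sigma> = "insert z \<tau>"
    have \<sigma>: "?\<sigma> \<in> Smp" "z \<notin> \<tau>" "\<forall>y\<in>\<tau>. ht y < n" using \<tau>(1) z by (auto simp: link_def)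
    have fin: "finite \<tau>" using finite_in_Smp[OF \<sigma>(1)] by simp
    have \<tau>S: "\<tau> \<in> Smp" by (rule Smp_subset[OF \<sigma>(1)]) auto
    have "cob (\<lambda>\<tau>. e (insert z \<tau>)) (g z) \<tau> =
        (\<Sum>x\<in>\<tau>. signed (e ?\<sigma> x) (c (insert z (\<tau> - {x}))) + signed (e ?\<sigma> z) (signed (e \<tau> x) (b (\<tau> - {x}))))"
      unfolding cob_def
    proof (intro sum.cong refl)
      fix x assume x: "x \<in> \<tau>"
      have "?\<sigma> - {z} = \<tau>" "?\<sigma> - {x} = insert z (\<tau> - {x})" using x \<sigma>(2) by auto
      then have "signed (e ?\<sigma> x + e (insert z (\<tau> - {x})) z) a = - signed (e ?\<sigma> z + e \<tau> x) a" for a :: 'm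
        using sign_ruleD[OF sign[OF \<sigma>(1)], of x z] x \<sigma>(2) by auto
      then show "signed (e ?\<sigma> x) (g z (\<tau> - {x})) =
          signed (e ?\<sigma> x) (c (insert z (\<tau> - {x}))) + signed (e ?\<sigma> z) (signed (e \<tau> x) (b (\<tau> - {x})))"
        by (simp add: g_def signed_diff)
    qed
    also have "\<dots> = (\<Sum>x\<in>\<tau>. signed (e ?\<sigma> x) (c (insert z (\<tau> - {x})))) + signed (e ?\<sigma> z) (cob e b \<tau>)"
      by (simp only: sum.distrib cob_def signed_sum)
    also have "\<dots> = cob e c ?\<sigma> - signed (e ?\<sigma> z) (c \<tau> - cob e b \<tau>)"
      unfolding cob_insert[OF fin \<sigma>(2)] signed_diff by (simp only: algebra_simps)
    also have "\<dots> \<in> J ?\<sigma>"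
    proof (rule J_diff[OF \<sigma>(1) _ J_signed[OF \<sigma>(1)]])
      show "cob e c ?\<sigma> \<in> J ?\<sigma>" using \<sigma> fin \<tau>(2) by (intro c_cocycle) auto
      have "c \<tau> - cob e b \<tau> \<in> J \<tau>" using b \<tau>S \<tau>(2) \<sigma>(3) by (simp add: solves_def)
      then show "c \<tau> - cob e b \<tau> \<in> J ?\<sigma>" using J_mono[OF \<sigma>(1), of \<tau>] by blast
    qed
    finally show ?thesis .
  qed
  then have "\<exists>u. (\<forall>\<rho>. u \<rho> \<in> E) \<and>
      (\<forall>\<tau>\<in>link z. card \<tau> = k \<longrightarrow> g z \<tau> - cob (\<lambda>\<tau>. e (insert z \<tau>)) u \<tau> \<in> J (insert z \<tau>))" if "ht z = n" for z
    using local_exact[of "g z" z] gE that by blast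
  then obtain U where U: "\<And>z \<rho>. ht z = n \<Longrightarrow> U z \<rho> \<in> E"
    "\<And>z \<tau>. \<lbrakk>ht z = n; \<tau> \<in> link z; card \<tau> = k\<rbrakk> \<Longrightarrow> g z \<tau> - cob (\<lambda>\<tau>. e (insert z \<tau>)) (U z) \<tau> \<in> J (insert z \<tau>)"
    by metis
  \<comment> \<open>Distinct vertices of equal height never share a simplex, so \<open>top\<close>
    is unambiguous there and the choices for different \<open>z\<close> do not interfere.\<close>
  define top where "top \<rho> = (SOME z. z \<in> \<rho> \<and> ht z = n)" for \<rho>
  define b' where "b' \<rho> = (if \<exists>z\<in>\<rho>. ht z = n then U (top \<rho>) (\<rho> - {top \<rho>}) else b \<rho>)" for \<rho>
  have top: "top \<rho> \<in> \<rho> \<and> ht (top \<rho>) = n" if "\<exists>z\<in>\<rho>. ht z = n" for \<rho>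
    unfolding top_def by (rule someI_ex) (use that in blast)
  have "solves (Suc n) b'"
    unfolding solves_def
  proof (intro conjI allI ballI impI)
    show "b' \<rho> \<in> E" for \<rho> unfolding b'_def using top[of \<rho>] U(1) bE by auto
    fix \<sigma> assume \<sigma>: "\<sigma> \<in> Smp" "card \<sigma> = Suc k" "\<forall>x\<in>\<sigma>. ht x < Suc n"
    show "c \<sigma> - cob e b' \<sigma> \<in> J \<sigma>"
    proof (cases "\<exists>z\<in>\<sigma>. ht z = n")
      case False
      then have "cob e b' \<sigma> = cob e b \<sigma>" by (intro cob_cong) (auto simp: b'_def)
      moreover have "\<forall>x\<in>\<sigma>. ht x < n" using \<sigma>(3) False less_SucE by blast
      ultimately show ?thesis using b \<sigma>(1,2) by (simp add: solves_def)
    next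
      case True
      then obtain z where z: "z \<in> \<sigma>" "ht z = n" by blast
      define \<tau> where "\<tau> = \<sigma> - {z}"
      have \<tau>: "\<sigma> = insert z \<tau>" "z \<notin> \<tau>" using z(1) by (auto simp: \<tau>_def)
      have fin: "finite \<tau>" using finite_in_Smp[OF \<sigma>(1)] by (simp add: \<tau>_def)
      have uniq: "y = z" if "y \<in> \<sigma>" "ht y = n" for y using ht_inj[OF \<sigma>(1) that(1) z(1)] that(2) z(2) by simp
      have less: "ht y < n" if "y \<in> \<tau>" for y
        using that uniq[of y] \<sigma>(3) \<tau> by (auto simp: less_Suc_eq)
      have "\<tau> \<in> link z" unfolding link_def using \<tau> \<sigma>(1) less z(2) by blast
      moreover have "card \<tau> = k" using \<sigma>(2) z(1) by (simp add: \<tau>_def)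
      ultimately have "g z \<tau> - cob (\<lambda>\<tau>. e (insert z \<tau>)) (U z) \<tau> \<in> J \<sigma>"
        using U(2)[OF z(2)] \<tau>(1) by blast
      moreover have "b' \<tau> = b \<tau>" using less by (auto simp: b'_def)
      moreover have "b' (insert z (\<tau> - {x})) = U z (\<tau> - {x})" if "x \<in> \<tau>" for x
      proof -
        have ex: "\<exists>y\<in>insert z (\<tau> - {x}). ht y = n" using z(2) by blast
        have "top (insert z (\<tau> - {x})) = z" using top[OF ex] uniq[of "top (insert z (\<tau> - {x}))"] \<tau>(1) by auto
        moreover have "insert z (\<tau> - {x}) - {z} = \<tau> - {x}" using \<tau>(2) by auto
        ultimately show ?thesis using ex by (simp add: b'_def)
      qed
      then have "(\<Sum>x\<in>\<tau>. signed (e \<sigma> x) (b' (insert z (\<tau> - {x})))) = cob (\<lambda>\<tau>. e (insert z \<tau>)) (U z) \<tau>"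
        unfolding cob_def \<tau>(1) by (intro sum.cong refl) simp
      ultimately have "c \<sigma> - (signed (e \<sigma> z) (b' \<tau>) + (\<Sum>x\<in>\<tau>. signed (e \<sigma> x) (b' (insert z (\<tau> - {x}))))) \<in> J \<sigma>"
        by (simp only: g_def \<tau>(1)[symmetric] diff_diff_eq)
      then show ?thesis using cob_insert[OF fin \<tau>(2), of b'] \<tau>(1) by simp
    qed
  qed
  moreover have "\<forall>\<rho>. (\<forall>x\<in>\<rho>. ht x < n) \<longrightarrow> b' \<rho> = b \<rho>" by (auto simp: b'_def)
  ultimately show ?thesis by blast
qed

text \<open>The partial solutions extend each other, so the value at each finite set of vertices is
  constant from some stage on, and these limits solve all equations.\<close>

theorem cochain_is_coboundary:
  "\<exists>b. (\<forall>\<rho>. b \<rho> \<in> E) \<and> (\<forall>\<sigma>\<in>Smp. card \<sigma> = Suc k \<longrightarrow> c \<sigma> - cob e b \<sigma> \<in> J \<sigma>)"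
proof -
  \<comment> \<open>A simplex with \<open>Suc k\<close> vertices cannot have all its heights below
    0, so there is no equation at stage 0.\<close>
  have "solves 0 (\<lambda>_. 0)" unfolding solves_def using E_zero by (auto simp: card_Suc_eq)
  then have "\<exists>b. solves 0 b" by (rule exI[of "solves 0"])
  then have "\<exists>B. \<forall>n. solves n (B n) \<and> (\<forall>\<rho>. (\<forall>x\<in>\<rho>. ht x < n) \<longrightarrow> B (Suc n) \<rho> = B n \<rho>)"
    by (rule dependent_nat_choice) (rule extend_solution)
  then obtain B where all: "\<forall>n. solves n (B n) \<and> (\<forall>\<rho>. (\<forall>x\<in>\<rho>. ht x < n) \<longrightarrow> B (Suc n) \<rho> = B n \<rho>)" ..
  have B: "solves n (B n)" "\<forall>x\<in>\<rho>. ht x < n \<Longrightarrow> B (Suc n) \<rho> = B n \<rho>" for n \<rho>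
    using all[THEN spec, of n] by blast+
  have stable: "B (N + i) \<rho> = B N \<rho>" if "\<forall>x\<in>\<rho>. ht x < N" for N i \<rho>
  proof (induction i)
    case (Suc i)
    have "\<forall>x\<in>\<rho>. ht x < N + i" using that by auto
    then show ?case using B(2)[of \<rho> "N + i"] Suc by simp
  qed simp
  \<comment> \<open>A bound above all heights in \<rho> that is monotone in \<rho> and makes sense
    for the empty set.\<close>
  define N where "N \<rho> = Suc (sum ht \<rho>)" for \<rho>
  define b where "b \<rho> = B (N \<rho>) \<rho>" for \<rho>
  have N: "ht x < N \<rho>" if "finite \<rho>" "x \<in> \<rho>" for \<rho> x
    using member_le_sum[of x \<rho> ht] that by (simp add: N_def)
  have "c \<sigma> - cob e b \<sigma> \<in> J \<sigma>" if \<sigma>: "\<sigma> \<in> Smp" "card \<sigma> = Suc k" for \<sigma>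
  proof -
    have fin: "finite \<sigma>" by (rule finite_in_Smp[OF \<sigma>(1)])
    have "cob e b \<sigma> = cob e (B (N \<sigma>)) \<sigma>"
    proof (rule cob_cong)
      fix x assume "x \<in> \<sigma>"
      have "N (\<sigma> - {x}) \<le> N \<sigma>" unfolding N_def using fin by (simp add: sum_mono2)
      then obtain i where "N \<sigma> = N (\<sigma> - {x}) + i" using le_Suc_ex by blast
      then show "b (\<sigma> - {x}) = B (N \<sigma>) (\<sigma> - {x})"
        unfolding b_def using stable[of "\<sigma> - {x}" "N (\<sigma> - {x})" i] N[of "\<sigma> - {x}"] fin by simp
    qed
    then show ?thesis using B(1)[of "N \<sigma>"] \<sigma> N[OF fin] by (simp add: solves_def)
  qed
  moreover have "b \<rho> \<in> E" for \<rho> using B(1) by (simp add: b_def solves_def)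
  ultimately show ?thesis by blast
qed

end

end

section \<open>Cohomology of systems of quotient groups\<close>

lemma (in group) trivial_group_Mod_self: "trivial_group (G Mod carrier G)"
proof -
  have sub: "subgroup (carrier G) G" by (rule subgroup_self)
  have cosets: "rcosets (carrier G) = {carrier G}"
    using coset_join2[OF _ sub] one_closed unfolding RCOSETS_def by blast
  have "carrier G <#> carrier G = carrier G" by (rule group.set_mult_carrier_idem[OF is_group sub])
  then have "group (G Mod carrier G)"
    by (intro groupI) (simp_all add: FactGroup_def cosets)
  then show ?thesis by (simp add: trivial_group_def FactGroup_def cosets)
qed

section \<open>Quotients of abelian groups by subgroups\<close>

definition coset :: "'m::ab_group_add set \<Rightarrow> 'm \<Rightarrow> 'm set" where
  "coset J f = {a + f | a. a \<in> J}"

definition add_sets :: "'m::ab_group_add set \<Rightarrow> 'm set \<Rightarrow> 'm set" where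
  "add_sets C D = {a + b | a b. a \<in> C \<and> b \<in> D}"

text \<open>Shaped like the additive group of a ring quotient: setwise sums, with the subgroup
  itself as unit.\<close>

definition quotient_group :: "'m::ab_group_add set \<Rightarrow> 'm set \<Rightarrow> 'm set monoid" where
  "quotient_group E J = \<lparr>carrier = coset J ` E, mult = add_sets, one = J\<rparr>"

definition add_subgroup :: "'m::ab_group_add set \<Rightarrow> bool" where
  "add_subgroup J \<longleftrightarrow> 0 \<in> J \<and> (\<forall>a\<in>J. \<forall>b\<in>J. a + b \<in> J) \<and> (\<forall>a\<in>J. - a \<in> J)"

lemma add_subgroupD:
  assumes "add_subgroup J"
  shows "0 \<in> J" "a \<in> J \<Longrightarrow> b \<in> J \<Longrightarrow> a + b \<in> J" "a \<in> J \<Longrightarrow> - a \<in> J" "a \<in> J \<Longrightarrow> b \<in> J \<Longrightarrow> a - b \<in> J"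
    "a \<in> J \<Longrightarrow> signed n a \<in> J"
proof -
  show *: "0 \<in> J" "a \<in> J \<Longrightarrow> b \<in> J \<Longrightarrow> a + b \<in> J" "a \<in> J \<Longrightarrow> - a \<in> J" for a b
    using assms by (simp_all add: add_subgroup_def)
  show "a \<in> J \<Longrightarrow> b \<in> J \<Longrightarrow> a - b \<in> J" using *(2)[of a "- b"] *(3)[of b] by simp
  show "a \<in> J \<Longrightarrow> signed n a \<in> J" using *(3) by (simp add: signed_def)
qed

lemma add_subgroup_sum: "add_subgroup J \<Longrightarrow> (\<And>i. i \<in> I \<Longrightarrow> f i \<in> J) \<Longrightarrow> sum f I \<in> J"
  by (induction I rule: infinite_finite_induct) (auto simp: add_subgroupD)

lemma add_subgroup_cob:
  "add_subgroup E \<Longrightarrow> (\<And>\<rho>. c \<rho> \<in> E) \<Longrightarrow> cob e c \<sigma> \<in> E"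
  unfolding cob_def by (intro add_subgroup_sum add_subgroupD(5))

context
  fixes J :: "'m::ab_group_add set"
  assumes J: "add_subgroup J"
begin

lemma coset_eq_iff: "coset J f = coset J g \<longleftrightarrow> f - g \<in> J"
proof
  assume "coset J f = coset J g"
  moreover have "f \<in> coset J f" unfolding coset_def using add_subgroupD(1)[OF J] by force
  ultimately obtain a where "a \<in> J" "f = a + g" by (auto simp: coset_def)
  then show "f - g \<in> J" by simp
next
  assume fg: "f - g \<in> J"
  have sub: "coset J f \<subseteq> coset J g" if "f - g \<in> J" for f g
  proof
    fix x assume "x \<in> coset J f"
    then obtain a where a: "a \<in> J" "x = a + f" by (auto simp: coset_def)
    then have "x = (a + (f - g)) + g" by simp
    moreover have "a + (f - g) \<in> J" using add_subgroupD(2)[OF J a(1) that] .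
    ultimately show "x \<in> coset J g" unfolding coset_def by blast
  qed
  have "g - f \<in> J" using add_subgroupD(3)[OF J fg] by simp
  then show "coset J f = coset J g" using sub[OF fg] sub[of g f] by blast
qed

lemma coset_zero: "coset J 0 = J"
  by (auto simp: coset_def)

lemma add_sets_coset: "add_sets (coset J f) (coset J g) = coset J (f + g)"
proof
  show "add_sets (coset J f) (coset J g) \<subseteq> coset J (f + g)"
  proof
    fix x assume "x \<in> add_sets (coset J f) (coset J g)"
    then obtain a b where ab: "a \<in> J" "b \<in> J" "x = (a + f) + (b + g)" by (auto simp: add_sets_def coset_def)
    then have "x = (a + b) + (f + g)" by (simp only: ac_simps)
    then show "x \<in> coset J (f + g)" unfolding coset_def using add_subgroupD(2)[OF J ab(1,2)] by blast
  qed
  show "coset J (f + g) \<subseteq> add_sets (coset J f) (coset J g)"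
  proof
    fix x assume "x \<in> coset J (f + g)"
    then obtain a where a: "a \<in> J" "x = a + (f + g)" by (auto simp: coset_def)
    then have "x = (a + f) + (0 + g)" by (simp add: ac_simps)
    then show "x \<in> add_sets (coset J f) (coset J g)"
      unfolding add_sets_def coset_def using a(1) add_subgroupD(1)[OF J] by blast
  qed
qed

lemma add_sets_coset_mono:
  assumes "add_subgroup I" "I \<subseteq> J" shows "add_sets J (coset I f) = coset J f"
proof
  show "add_sets J (coset I f) \<subseteq> coset J f"
  proof
    fix x assume "x \<in> add_sets J (coset I f)"
    then obtain a b where ab: "a \<in> J" "b \<in> I" "x = a + (b + f)" by (auto simp: add_sets_def coset_def)
    then have "x = (a + b) + f" "b \<in> J" using assms(2) by (auto simp: ac_simps)
    then show "x \<in> coset J f" unfolding coset_def using add_subgroupD(2)[OF J ab(1)] by blast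
  qed
  show "coset J f \<subseteq> add_sets J (coset I f)"
  proof
    fix x assume "x \<in> coset J f"
    then obtain a where "a \<in> J" "x = a + (0 + f)" by (auto simp: coset_def)
    then show "x \<in> add_sets J (coset I f)"
      unfolding add_sets_def coset_def using add_subgroupD(1)[OF assms(1)] by blast
  qed
qed

context
  fixes E :: "'m set"
  assumes E: "add_subgroup E"
begin

lemma comm_group_quotient_group: "comm_group (quotient_group E J)"
proof (rule comm_groupI)
  fix C assume "C \<in> carrier (quotient_group E J)"
  then obtain f where f: "C = coset J f" "f \<in> E" by (auto simp: quotient_group_def)
  show "\<exists>D\<in>carrier (quotient_group E J). D \<otimes>\<^bsub>quotient_group E J\<^esub> C = \<one>\<^bsub>quotient_group E J\<^esub>"
    by (rule bexI[of _ "coset J (- f)"])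
       (use f E in \<open>auto simp: quotient_group_def add_sets_coset coset_zero add_subgroupD\<close>)
next
  show "\<one>\<^bsub>quotient_group E J\<^esub> \<in> carrier (quotient_group E J)"
    using coset_zero add_subgroupD(1)[OF E] by (force simp: quotient_group_def)
next
  fix C assume "C \<in> carrier (quotient_group E J)"
  then obtain f where f: "C = coset J f" "f \<in> E" by (auto simp: quotient_group_def)
  have "add_sets (coset J 0) C = C" unfolding f(1) add_sets_coset by simp
  then show "\<one>\<^bsub>quotient_group E J\<^esub> \<otimes>\<^bsub>quotient_group E J\<^esub> C = C"
    by (simp add: quotient_group_def coset_zero)
qed (use E in \<open>auto simp: quotient_group_def add_sets_coset add_subgroupD ac_simps\<close>)

lemma coset_int_pow_sign:
  assumes "f \<in> E"
  shows "coset J f [^]\<^bsub>quotient_group E J\<^esub> ((-1) ^ n :: int) = coset J (signed n f)"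
proof -
  interpret comm_group "quotient_group E J" by (rule comm_group_quotient_group)
  have mem: "coset J g \<in> carrier (quotient_group E J)" if "g \<in> E" for g
    using that by (simp add: quotient_group_def)
  have "inv\<^bsub>quotient_group E J\<^esub> (coset J f) = coset J (- f)"
    by (rule inv_equality)
       (use assms E in \<open>simp_all add: quotient_group_def add_sets_coset coset_zero add_subgroupD\<close>)
  then show ?thesis
    using int_pow_1[OF mem[OF assms]] int_pow_neg[OF mem[OF assms], of 1]
    by (cases "even n") (simp_all add: signed_def)
qed

lemma finprod_coset:
  assumes "finite I" "\<And>i. i \<in> I \<Longrightarrow> f i \<in> E"
  shows "finprod (quotient_group E J) (\<lambda>i. coset J (f i)) I = coset J (\<Sum>i\<in>I. f i)"
proof -
  interpret comm_group "quotient_group E J" by (rule comm_group_quotient_group)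
  show ?thesis using assms
  proof (induction I rule: finite_induct)
    case empty
    show ?case unfolding finprod_empty sum.empty coset_zero by (simp add: quotient_group_def)
  next
    case (insert i I)
    have "finprod (quotient_group E J) (\<lambda>i. coset J (f i)) (insert i I) =
        coset J (f i) \<otimes>\<^bsub>quotient_group E J\<^esub> finprod (quotient_group E J) (\<lambda>i. coset J (f i)) I"
      by (rule finprod_insert) (use insert in \<open>auto simp: quotient_group_def\<close>)
    also have "\<dots> = add_sets (coset J (f i)) (coset J (\<Sum>i\<in>I. f i))"
      using insert by (simp add: quotient_group_def)
    also have "\<dots> = coset J (\<Sum>i\<in>insert i I. f i)"
      unfolding add_sets_coset sum.insert[OF insert.hyps] ..
    finally show ?case .
  qed
qed

end

end

definition label_sign :: "('v \<Rightarrow> nat) \<Rightarrow> 'v set \<Rightarrow> 'v \<Rightarrow> nat" where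
  "label_sign lab \<sigma> x = card {y \<in> \<sigma>. lab y < lab x}"

lemma incidence_face: "x \<in> \<sigma> \<Longrightarrow> incidence lab \<sigma> (\<sigma> - {x}) = (-1) ^ label_sign lab \<sigma> x"
proof -
  assume "x \<in> \<sigma>"
  then have "\<sigma> - (\<sigma> - {x}) = {x}" by auto
  then show ?thesis by (simp add: incidence_def label_sign_def)
qed

text \<open>Removing \<open>x\<close> lowers the position of \<open>y\<close> by one exactly when
  \<open>lab x < lab y\<close>, and of two distinct labels exactly one is smaller.\<close>

lemma sign_rule_label_sign:
  assumes fin: "finite \<sigma>" and inj: "inj_on lab \<sigma>"
  shows "sign_rule (label_sign lab) \<sigma>"
proof -
  have remove: "label_sign lab \<sigma> y = label_sign lab (\<sigma> - {x}) y + (if lab x < lab y then 1 else 0)"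
    if "x \<in> \<sigma>" for x y
  proof -
    have "{z \<in> \<sigma>. lab z < lab y} =
        (if lab x < lab y then insert x {z \<in> \<sigma> - {x}. lab z < lab y} else {z \<in> \<sigma> - {x}. lab z < lab y})"
      using that by auto
    then show ?thesis using fin by (simp add: label_sign_def)
  qed
  show ?thesis
    unfolding sign_rule_def
  proof (intro ballI impI)
    fix x y assume xy: "x \<in> \<sigma>" "y \<in> \<sigma>" "x \<noteq> y"
    then have "lab x < lab y \<or> lab y < lab x" using inj by (meson inj_onD linorder_neqE_nat)
    then show "even (label_sign lab \<sigma> x + label_sign lab (\<sigma> - {x}) y) \<noteq>
        even (label_sign lab \<sigma> y + label_sign lab (\<sigma> - {y}) x)"
      using remove[OF xy(1), of y] remove[OF xy(2), of x] by auto
  qed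
qed

text \<open>A cochain of a system of quotients \<open>E / J \<sigma>\<close> is the class of a function with values in \<open>E\<close>, so
  exactness can be checked on representatives.\<close>

locale quotient_system =
  fixes X :: "nat \<Rightarrow> 'v set set" and lab :: "'v \<Rightarrow> nat" and F :: "('v, 'm::ab_group_add set) ccs"
    and E :: "'m set" and J :: "'v set \<Rightarrow> 'm set"
  assumes E: "add_subgroup E"
    and J: "\<sigma> \<in> X k \<Longrightarrow> add_subgroup (J \<sigma>)"
    and J_subset: "\<sigma> \<in> X k \<Longrightarrow> J \<sigma> \<subseteq> E"
    and J_mono: "\<sigma> \<in> X (Suc k) \<Longrightarrow> x \<in> \<sigma> \<Longrightarrow> J (\<sigma> - {x}) \<subseteq> J \<sigma>"
    and group_F: "\<sigma> \<in> X k \<Longrightarrow> ccs_group F \<sigma> = quotient_group E (J \<sigma>)"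
    and map_F: "\<sigma> \<in> X (Suc k) \<Longrightarrow> x \<in> \<sigma> \<Longrightarrow> ccs_map F (\<sigma> - {x}) \<sigma> C = add_sets (J \<sigma>) C"
    and finite_X: "\<sigma> \<in> X k \<Longrightarrow> finite \<sigma>"
    and faces: "\<sigma> \<in> X (Suc k) \<Longrightarrow> {\<tau> \<in> X k. \<tau> \<subseteq> \<sigma>} = (\<lambda>x. \<sigma> - {x}) ` \<sigma>"
    and inj_lab: "\<sigma> \<in> X k \<Longrightarrow> inj_on lab \<sigma>"
begin

abbreviation "C k \<equiv> cochains X F k"

definition cls :: "nat \<Rightarrow> ('v set \<Rightarrow> 'm) \<Rightarrow> 'v set \<Rightarrow> 'm set" where
  "cls k c = (\<lambda>\<sigma>\<in>X k. coset (J \<sigma>) (c \<sigma>))"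

abbreviation "\<delta> \<equiv> cob (label_sign lab)"

lemma comm_group_F: "\<sigma> \<in> X k \<Longrightarrow> comm_group (ccs_group F \<sigma>)"
  using comm_group_quotient_group[OF J E] group_F by metis

lemma group_C: "group (C k)"
  unfolding cochains_def using comm_group_F comm_group.axioms(2) by (intro product_group) blast

lemma carrier_C: "carrier (C k) = cls k ` {c. \<forall>\<rho>. c \<rho> \<in> E}"
proof
  show "cls k ` {c. \<forall>\<rho>. c \<rho> \<in> E} \<subseteq> carrier (C k)"
    by (auto simp: cochains_def cls_def group_F quotient_group_def PiE_iff)
  show "carrier (C k) \<subseteq> cls k ` {c. \<forall>\<rho>. c \<rho> \<in> E}"
  proof
    fix d assume "d \<in> carrier (C k)"
    then have d: "d \<in> (\<Pi>\<^sub>E \<sigma>\<in>X k. coset (J \<sigma>) ` E)"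
      by (auto simp: cochains_def PiE_iff group_F quotient_group_def)
    define c where "c \<sigma> = (if \<sigma> \<in> X k then SOME f. f \<in> E \<and> d \<sigma> = coset (J \<sigma>) f else 0)" for \<sigma>
    have c: "c \<sigma> \<in> E \<and> d \<sigma> = coset (J \<sigma>) (c \<sigma>)" if "\<sigma> \<in> X k" for \<sigma>
    proof -
      have "\<exists>f. f \<in> E \<and> d \<sigma> = coset (J \<sigma>) f" using d that by (auto simp: PiE_iff)
      then have "(SOME f. f \<in> E \<and> d \<sigma> = coset (J \<sigma>) f) \<in> E \<and> d \<sigma> = coset (J \<sigma>) (SOME f. f \<in> E \<and> d \<sigma> = coset (J \<sigma>) f)"
        by (rule someI_ex)
      then show ?thesis using that by (simp add: c_def)
    qed
    have "c \<sigma> \<in> E" for \<sigma> using c[of \<sigma>] add_subgroupD(1)[OF E] by (cases "\<sigma> \<in> X k") (auto simp: c_def)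
    moreover have "d = cls k c"
    proof
      fix \<sigma>
      show "d \<sigma> = cls k c \<sigma>" using c[of \<sigma>] d by (cases "\<sigma> \<in> X k") (auto simp: cls_def PiE_iff extensional_def)
    qed
    ultimately show "d \<in> cls k ` {c. \<forall>\<rho>. c \<rho> \<in> E}" by blast
  qed
qed

lemma cls_eq_iff: "cls k c = cls k c' \<longleftrightarrow> (\<forall>\<sigma>\<in>X k. c \<sigma> - c' \<sigma> \<in> J \<sigma>)"
proof -
  have "cls k c = cls k c' \<longleftrightarrow> (\<forall>\<sigma>\<in>X k. coset (J \<sigma>) (c \<sigma>) = coset (J \<sigma>) (c' \<sigma>))"
  proof
    assume eq: "cls k c = cls k c'"
    show "\<forall>\<sigma>\<in>X k. coset (J \<sigma>) (c \<sigma>) = coset (J \<sigma>) (c' \<sigma>)"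
    proof
      fix \<sigma> assume "\<sigma> \<in> X k"
      then show "coset (J \<sigma>) (c \<sigma>) = coset (J \<sigma>) (c' \<sigma>)" using fun_cong[OF eq, of \<sigma>] by (simp add: cls_def)
    qed
  qed (auto simp: cls_def intro: restrict_ext)
  then show ?thesis using coset_eq_iff[OF J] by blast
qed

lemma one_C: "\<one>\<^bsub>C k\<^esub> = cls k (\<lambda>_. 0)"
  unfolding cochains_def cls_def one_product_group
  by (intro restrict_ext) (simp add: group_F quotient_group_def coset_zero[OF J])

lemma mult_C: "cls k c \<otimes>\<^bsub>C k\<^esub> cls k c' = cls k (\<lambda>\<rho>. c \<rho> + c' \<rho>)"
  unfolding cochains_def cls_def mult_product_group
  by (intro restrict_ext) (simp add: group_F quotient_group_def add_sets_coset[OF J])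

text \<open>Faces of codimension one are indexed by the omitted vertex, which turns the
  multiplicative product with incidence numbers as exponents into the signed sum
  \<open>cob\<close>.\<close>

lemma coboundary_cls:
  assumes c: "\<And>\<rho>. c \<rho> \<in> E"
  shows "coboundary X lab F k (cls k c) = cls (Suc k) (\<delta> c)"
  unfolding coboundary_def cls_def
proof (rule restrict_ext)
  fix \<sigma> assume \<sigma>: "\<sigma> \<in> X (Suc k)"
  let ?G = "quotient_group E (J \<sigma>)"
  interpret G: comm_group ?G by (rule comm_group_quotient_group[OF J[OF \<sigma>] E])
  let ?t = "\<lambda>\<tau>'. ccs_map F \<tau>' \<sigma> ((\<lambda>\<tau>\<in>X k. coset (J \<tau>) (c \<tau>)) \<tau>') [^]\<^bsub>?G\<^esub> incidence lab \<sigma> \<tau>'"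
  have t: "?t (\<sigma> - {x}) = coset (J \<sigma>) (signed (label_sign lab \<sigma> x) (c (\<sigma> - {x})))" if x: "x \<in> \<sigma>" for x
  proof -
    have face: "\<sigma> - {x} \<in> X k" using faces[OF \<sigma>] x by blast
    have "ccs_map F (\<sigma> - {x}) \<sigma> (coset (J (\<sigma> - {x})) (c (\<sigma> - {x}))) = coset (J \<sigma>) (c (\<sigma> - {x}))"
      unfolding map_F[OF \<sigma> x] by (rule add_sets_coset_mono[OF J[OF \<sigma>] J[OF face] J_mono[OF \<sigma> x]])
    then show ?thesis
      using face coset_int_pow_sign[OF J[OF \<sigma>] E c] by (simp add: incidence_face[OF x])
  qed
  have "finprod ?G ?t ((\<lambda>x. \<sigma> - {x}) ` \<sigma>) = finprod ?G (\<lambda>x. ?t (\<sigma> - {x})) \<sigma>"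
  proof (rule G.finprod_reindex)
    show "inj_on (\<lambda>x. \<sigma> - {x}) \<sigma>" by (rule inj_onI) blast
    show "?t \<in> (\<lambda>x. \<sigma> - {x}) ` \<sigma> \<rightarrow> carrier ?G"
      using t add_subgroupD(5)[OF E c] by (auto simp: quotient_group_def)
  qed
  also have "\<dots> = finprod ?G (\<lambda>x. coset (J \<sigma>) (signed (label_sign lab \<sigma> x) (c (\<sigma> - {x})))) \<sigma>"
    by (rule G.finprod_cong') (use t add_subgroupD(5)[OF E c] in \<open>auto simp: quotient_group_def\<close>)
  also have "\<dots> = coset (J \<sigma>) (\<delta> c \<sigma>)"
    unfolding cob_def by (rule finprod_coset[OF J[OF \<sigma>] E finite_X[OF \<sigma>] add_subgroupD(5)[OF E c]])
  finally show "(\<Otimes>\<^bsub>ccs_group F \<sigma>\<^esub>\<tau>'\<in>{\<tau>' \<in> X k. \<tau>' \<subseteq> \<sigma>}.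
      ccs_map F \<tau>' \<sigma> ((\<lambda>\<sigma>\<in>X k. coset (J \<sigma>) (c \<sigma>)) \<tau>') [^]\<^bsub>ccs_group F \<sigma>\<^esub> incidence lab \<sigma> \<tau>') = coset (J \<sigma>) (\<delta> c \<sigma>)"
    unfolding group_F[OF \<sigma>] faces[OF \<sigma>] .
qed

lemma cocycles_eq:
  "cocycles X lab F k = cls k ` {c. (\<forall>\<rho>. c \<rho> \<in> E) \<and> (\<forall>\<sigma>\<in>X (Suc k). \<delta> c \<sigma> \<in> J \<sigma>)}"
proof -
  have "coboundary X lab F k (cls k c) = \<one>\<^bsub>C (Suc k)\<^esub> \<longleftrightarrow> (\<forall>\<sigma>\<in>X (Suc k). \<delta> c \<sigma> \<in> J \<sigma>)"
    if "\<And>\<rho>. c \<rho> \<in> E" for c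
    unfolding coboundary_cls[OF that] one_C cls_eq_iff by simp
  then show ?thesis unfolding cocycles_def kernel_def carrier_C by auto
qed

text \<open>Exactness on representatives gives the inclusion of cocycles in coboundaries, the other
  one being \<open>cob_cob\<close>; the cohomology is then a group modulo its own carrier.\<close>

theorem trivial_cohomology:
  assumes exact: "\<And>c. \<lbrakk>\<And>\<rho>. c \<rho> \<in> E; \<And>\<sigma>. \<sigma> \<in> X (Suc (Suc j)) \<Longrightarrow> \<delta> c \<sigma> \<in> J \<sigma>\<rbrakk> \<Longrightarrow>
    \<exists>b. (\<forall>\<rho>. b \<rho> \<in> E) \<and> (\<forall>\<sigma>\<in>X (Suc j). c \<sigma> - \<delta> b \<sigma> \<in> J \<sigma>)"
  shows "trivial_group (cohomology X lab F (Suc j))"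
proof -
  let ?Z = "cocycles X lab F (Suc j)"
  have dE: "\<delta> b \<rho> \<in> E" if "\<And>\<rho>. b \<rho> \<in> E" for b \<rho> using add_subgroup_cob[OF E that] .
  have B: "coboundaries X lab F (Suc j) = cls (Suc j) ` {\<delta> b | b. \<forall>\<rho>. b \<rho> \<in> E}"
    unfolding coboundaries_def nat.case carrier_C using coboundary_cls by (auto simp: image_iff) blast+
  have "?Z = coboundaries X lab F (Suc j)"
  proof
    show "?Z \<subseteq> coboundaries X lab F (Suc j)"
    proof
      fix d assume "d \<in> ?Z"
      then obtain c where c: "d = cls (Suc j) c" "\<And>\<rho>. c \<rho> \<in> E" "\<And>\<sigma>. \<sigma> \<in> X (Suc (Suc j)) \<Longrightarrow> \<delta> c \<sigma> \<in> J \<sigma>"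
        unfolding cocycles_eq by blast
      obtain b where b: "\<forall>\<rho>. b \<rho> \<in> E" "\<forall>\<sigma>\<in>X (Suc j). c \<sigma> - \<delta> b \<sigma> \<in> J \<sigma>" using exact[OF c(2,3)] by blast
      then have "d = cls (Suc j) (\<delta> b)" unfolding c(1) cls_eq_iff by blast
      then show "d \<in> coboundaries X lab F (Suc j)" unfolding B using b(1) by blast
    qed
    show "coboundaries X lab F (Suc j) \<subseteq> ?Z"
    proof
      fix d assume "d \<in> coboundaries X lab F (Suc j)"
      then obtain b where b: "d = cls (Suc j) (\<delta> b)" "\<And>\<rho>. b \<rho> \<in> E" unfolding B by blast
      have "\<delta> (\<delta> b) \<sigma> \<in> J \<sigma>" if \<sigma>: "\<sigma> \<in> X (Suc (Suc j))" for \<sigma>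
      proof -
        have "\<delta> (\<delta> b) \<sigma> = 0"
          by (rule cob_cob[OF finite_X[OF \<sigma>] sign_rule_label_sign[OF finite_X[OF \<sigma>] inj_lab[OF \<sigma>]]])
        then show ?thesis using add_subgroupD(1)[OF J[OF \<sigma>]] by simp
      qed
      then show "d \<in> ?Z" unfolding cocycles_eq b(1) using dE[of b, OF b(2)] by blast
    qed
  qed
  moreover have "subgroup ?Z (C (Suc j))"
  proof (rule group.subgroupI[OF group_C])
    show "?Z \<subseteq> carrier (C (Suc j))" unfolding cocycles_eq carrier_C by blast
    have "\<delta> (\<lambda>_. 0) \<sigma> \<in> J \<sigma>" if "\<sigma> \<in> X (Suc (Suc j))" for \<sigma>
      unfolding cob_zero using add_subgroupD(1)[OF J[OF that]] .
    then have "cls (Suc j) (\<lambda>_. 0) \<in> ?Z"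
      unfolding cocycles_eq by (intro imageI CollectI conjI allI ballI add_subgroupD(1)[OF E])
    then show "?Z \<noteq> {}" by blast
    fix d assume "d \<in> ?Z"
    then obtain c where c: "d = cls (Suc j) c" "\<And>\<rho>. c \<rho> \<in> E" "\<And>\<sigma>. \<sigma> \<in> X (Suc (Suc j)) \<Longrightarrow> \<delta> c \<sigma> \<in> J \<sigma>"
      unfolding cocycles_eq by blast
    have neg: "\<delta> (\<lambda>\<rho>. - c \<rho>) \<sigma> = - \<delta> c \<sigma>" for \<sigma> by (simp add: cob_def signed_minus sum_negf)
    have cE: "- c \<rho> \<in> E" for \<rho> by (rule add_subgroupD(3)[OF E c(2)])
    have "inv\<^bsub>C (Suc j)\<^esub> d = cls (Suc j) (\<lambda>\<rho>. - c \<rho>)"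
    proof (rule group.inv_equality[OF group_C])
      show "cls (Suc j) (\<lambda>\<rho>. - c \<rho>) \<otimes>\<^bsub>C (Suc j)\<^esub> d = \<one>\<^bsub>C (Suc j)\<^esub>"
        unfolding c(1) mult_C one_C by simp
    qed (use c cE in \<open>auto simp: carrier_C\<close>)
    moreover have "\<delta> (\<lambda>\<rho>. - c \<rho>) \<sigma> \<in> J \<sigma>" if "\<sigma> \<in> X (Suc (Suc j))" for \<sigma>
      unfolding neg using add_subgroupD(3)[OF J[OF that] c(3)[OF that]] .
    ultimately show "inv\<^bsub>C (Suc j)\<^esub> d \<in> ?Z" unfolding cocycles_eq using cE by blast
    fix d' assume "d' \<in> ?Z"
    then obtain c' where c': "d' = cls (Suc j) c'" "\<And>\<rho>. c' \<rho> \<in> E" "\<And>\<sigma>. \<sigma> \<in> X (Suc (Suc j)) \<Longrightarrow> \<delta> c' \<sigma> \<in> J \<sigma>"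
      unfolding cocycles_eq by blast
    have "\<delta> (\<lambda>\<rho>. c \<rho> + c' \<rho>) \<sigma> \<in> J \<sigma>" if "\<sigma> \<in> X (Suc (Suc j))" for \<sigma>
      unfolding cob_add using add_subgroupD(2)[OF J[OF that] c(3)[OF that] c'(3)[OF that]] .
    moreover have "c \<rho> + c' \<rho> \<in> E" for \<rho> by (rule add_subgroupD(2)[OF E c(2) c'(2)])
    ultimately show "d \<otimes>\<^bsub>C (Suc j)\<^esub> d' \<in> ?Z"
      unfolding cocycles_eq c(1) c'(1) mult_C by blast
  qed
  then have "group (C (Suc j)\<lparr>carrier := ?Z\<rparr>)"
    by (rule subgroup.subgroup_is_group[OF _ group_C])
  then have "trivial_group (C (Suc j)\<lparr>carrier := ?Z\<rparr> Mod carrier (C (Suc j)\<lparr>carrier := ?Z\<rparr>))"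
    by (rule group.trivial_group_Mod_self)
  ultimately show ?thesis unfolding cohomology_def by simp
qed

end

section \<open>The ideals of the building as spans of dependent monomials\<close>

text \<open>Quantifying over all lattices in \<open>x\<close> avoids a choice; homothetic lattices
  agree by \<open>indep_scale\<close>. The same formula serves for a union of classes.\<close>

definition dependent_at :: "('k::field^'n) set set \<Rightarrow> ('k^'n) set set \<Rightarrow> bool" where
  "dependent_at x T \<longleftrightarrow> (\<exists>L\<in>x. \<not> indep L T)"

lemma dependence_dependent_at:
  assumes "A \<subseteq> lines" shows "dependence A (dependent_at x)"
proof
  show "dependent_at x U" if "dependent_at x T" "T \<subseteq> U" "finite U" "U \<subseteq> A" for T U
    using that assms indep_subset[of _ U T] unfolding dependent_at_def by blast
qed (simp add: dependent_at_def indep_empty)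

lemma line_eq_span:
  assumes "l \<in> lines" "a \<in> l" "a \<noteq> 0" shows "vec.span {a} = l"
proof
  obtain x where x: "l = vec.span {x}" using assms(1) by (auto simp: lines_def)
  show "vec.span {a} \<subseteq> l" using assms(2) unfolding x by (intro vec.span_minimal) auto
  show "l \<subseteq> vec.span {a}"
  proof
    fix b assume "b \<in> l"
    then obtain k where "b = k *s a" using lines_proportional[OF assms(1,2) _ assms(3)] by blast
    then show "b \<in> vec.span {a}" by (simp add: vec.span_base vec.span_scale)
  qed
qed

context valued_field
begin

lemma dependent_at_iff:
  assumes x: "x \<in> vertices" "L \<in> x" and T: "T \<subseteq> lines"
  shows "dependent_at x T \<longleftrightarrow> \<not> indep L T"
proof -
  have "homothety_class (nr x) = x" by (rule nr_vertex(2)[OF x(1)])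
  then have "homothety_class L = x" using x(2) homothety_class_mem_eq[of L "nr x"] by simp
  then have "indep M T \<longleftrightarrow> indep L T" if "M \<in> x" for M
    using that homothety_class_memE[of M L] indep_scale[OF _ T, of _ L] by metis
  then show ?thesis using x(2) unfolding dependent_at_def by blast
qed

lemma dependent_at_nr:
  assumes "x \<in> vertices" "T \<subseteq> lines" shows "dependent_at x T \<longleftrightarrow> \<not> indep (nr x) T"
proof (rule dependent_at_iff[OF assms(1) _ assms(2)])
  show "nr x \<in> x" using homothety_class_self[of "nr x"] nr_vertex(2)[OF assms(1)] by simp
qed

text \<open>A coefficient not divisible by \<open>p\<close> is a unit, so independence would force
  the corresponding vector into \<open>p\<close> times \<open>L\<close>.\<close>

lemma dependent_if_dependent_mod:
  assumes L: "is_lattice v L" and a: "\<And>i. i \<le> m \<Longrightarrow> a i \<notin> scale_set p L"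
    and inj: "inj_on (\<lambda>i. vec.span {a i}) {..m}" and dep: "dependent_mod v p L m a"
  shows "\<not> indep (scale_set p L) ((\<lambda>i. vec.span {a i}) ` {..m})"
proof
  let ?s = "\<lambda>i. vec.span {a i}"
  assume ind: "indep (scale_set p L) (?s ` {..m})"
  obtain c j where c: "(\<Sum>i\<le>m. c i *s a i) \<in> scale_set p L" and j: "j \<le> m" "c j \<in> integer_ring v"
    "c j \<notin> (\<lambda>y. p * y) ` integer_ring v"
    using dep unfolding dependent_mod_def by blast
  have "\<not> v (c j) < 1" using j(3) v_less_1_iff[of "c j"] by (auto simp: integer_ring_def)
  then have vc: "v (c j) = 1" using j(2) by (simp add: integer_ring_def)
  define f where "f l = (let i = inv_into {..m} ?s l in c i *s a i)" for l
  have f: "f (?s i) = c i *s a i" if "i \<le> m" for i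
    using inv_into_f_f[OF inj, of i] that by (simp add: f_def)
  have "f (?s j) \<in> scale_set p L"
  proof (rule indepD[OF ind])
    show "f l \<in> l" if l: "l \<in> ?s ` {..m}" for l
    proof -
      obtain i where "i \<le> m" "l = ?s i" using l by blast
      moreover have "a i \<in> ?s i" by (simp add: vec.span_base)
      ultimately show ?thesis using f[of i] vec.span_scale[of "a i" "{a i}" "c i"] by simp
    qed
    have "(\<Sum>l\<in>?s ` {..m}. f l) = (\<Sum>i\<le>m. f (?s i))" using sum.reindex[OF inj, of f] by simp
    also have "\<dots> = (\<Sum>i\<le>m. c i *s a i)" by (intro sum.cong refl f) simp
    finally show "(\<Sum>l\<in>?s ` {..m}. f l) \<in> scale_set p L" using c by simp
    show "?s j \<in> ?s ` {..m}" using j(1) by simp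
  qed
  then have "c j *s a j \<in> scale_set p L" by (simp add: f[OF j(1)])
  moreover have "submodule (scale_set p L)" using submodule_lattice is_lattice_scale_set[OF L p_nonzero] by blast
  ultimately have "(1 / c j) *s (c j *s a j) \<in> scale_set p L"
    using submodule_scale[of "scale_set p L" "c j *s a j" "1 / c j"] vc by (simp add: v_divide)
  moreover have "c j \<noteq> 0" using vc by auto
  ultimately show False using a[OF j(1)] by (simp add: vec.scale_scale)
qed

text \<open>Divide by a coefficient of largest value. That value exceeds 1, because one summand lies
  outside \<open>L\<close>; so the division pushes the sum from \<open>L\<close> into
  \<open>p\<close> times \<open>L\<close>, while one coefficient becomes 1.\<close>

lemma dependent_mod_if_dependent:
  assumes L: "is_lattice v L" and a: "\<And>i. i \<le> m \<Longrightarrow> a i \<in> L"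
    and sum: "(\<Sum>i\<le>m. c i *s a i) \<in> L" and j0: "j0 \<le> m" "c j0 *s a j0 \<notin> L"
  shows "dependent_mod v p L m a"
proof -
  have sL: "submodule L" by (rule submodule_lattice[OF L])
  have "Max ((\<lambda>i. v (c i)) ` {..m}) \<in> (\<lambda>i. v (c i)) ` {..m}" by (rule Max_in) auto
  then obtain j where j: "j \<le> m" "Max ((\<lambda>i. v (c i)) ` {..m}) = v (c j)" by blast
  then have max: "v (c i) \<le> v (c j)" if "i \<le> m" for i
    using Max_ge[of "(\<lambda>i. v (c i)) ` {..m}" "v (c i)"] that by simp
  have "\<not> v (c j0) \<le> 1" using submodule_scale[OF sL a[OF j0(1)]] j0(2) by blast
  then have "1 < v (c j)" using max[OF j0(1)] by linarith
  then have cj: "c j \<noteq> 0" by auto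
  let ?c = "\<lambda>i. c i / c j"
  have "(\<Sum>i\<le>m. ?c i *s a i) = (1 / c j) *s (\<Sum>i\<le>m. c i *s a i)"
    by (simp add: vec.scale_sum_right vec.scale_scale)
  then have "(\<Sum>i\<le>m. ?c i *s a i) \<in> scale_set (1 / c j) L" using sum unfolding scale_set_def by blast
  moreover have "scale_set (1 / c j) L \<subseteq> scale_set p L"
    using scale_set_less[OF sL, of 1 "1 / c j"] \<open>1 < v (c j)\<close> by (simp add: v_divide)
  ultimately have 1: "(\<Sum>i\<le>m. ?c i *s a i) \<in> scale_set p L" by blast
  have 2: "\<forall>i\<le>m. ?c i \<in> integer_ring v"
    using max v_pos[OF cj] by (simp add: integer_ring_def v_divide)
  have "1 \<notin> (\<lambda>y. p * y) ` integer_ring v"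
    using v_less_1_iff[of 1] by (auto simp: integer_ring_def)
  then have 3: "\<exists>i\<le>m. ?c i \<notin> (\<lambda>y. p * y) ` integer_ring v" using j(1) cj by (intro exI[of _ j]) simp
  show ?thesis unfolding dependent_mod_def using 1 2 3 by (intro exI[of _ ?c]) blast
qed

text \<open>Translates linear dependence over the residue field into failure of
  \<open>indep\<close>. One direction tests at \<open>p\<close> times \<open>L\<close>, the other at
  the normalised lattice; both represent the vertex.\<close>

lemma vertex_ideal_eq:
  fixes A :: "('k^'n) set set"
  assumes A: "A \<subseteq> lines" and x: "x \<in> vertices"
  shows "(vertex_ideal v p A x :: (('k^'n) set set \<Rightarrow> 'r::{comm_ring, comm_monoid_mult}) set) =
    dep_ideal A (dependent_at x)"
proof -
  interpret dependence A "dependent_at x" by (rule dependence_dependent_at[OF A])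
  let ?G = "standard_generators v p A x :: (('k^'n) set set \<Rightarrow> 'r) set"
  have "?G \<subseteq> dep_ideal A (dependent_at x)"
  proof
    fix g assume "g \<in> ?G"
    then obtain L m a where g: "g = ext_der (ext_prod A (map (\<lambda>i. vec.span {a i}) [0..<Suc m]))"
      and L: "is_lattice v L" "homothety_class L = x"
      and a: "\<forall>i\<le>m. a i \<in> L - scale_set p L \<and> vec.span {a i} \<in> A" and dep: "dependent_mod v p L m a"
      unfolding standard_generators_def by blast
    let ?ls = "map (\<lambda>i. vec.span {a i}) [0..<Suc m]"
    obtain n where n: "(ext_prod A ?ls :: ('k^'n) set set \<Rightarrow> 'r) = (if distinct ?ls then ext_mon (set ?ls) (signed n 1) else 0)"
      using ext_prod_eq_ext_mon[of A ?ls] by (elim exE)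
    have range: "{0..<Suc m} = {..m}" by auto
    show "g \<in> dep_ideal A (dependent_at x)"
    proof (cases "distinct ?ls")
      case True
      then have "inj_on (\<lambda>i. vec.span {a i}) {..m}" by (simp only: distinct_map set_upt range)
      then have "\<not> indep (scale_set p L) ((\<lambda>i. vec.span {a i}) ` {..m})"
        using a by (intro dependent_if_dependent_mod[OF L(1) _ _ dep]) auto
      moreover have "scale_set p L \<in> x" unfolding L(2)[symmetric] homothety_class_def using p_nonzero by blast
      moreover have T: "set ?ls = (\<lambda>i. vec.span {a i}) ` {..m}" by (simp only: set_map set_upt range)
      ultimately have "dependent_at x (set ?ls)" unfolding dependent_at_def by metis
      moreover have "(ext_mon (set ?ls) (signed n 1) :: ('k^'n) set set \<Rightarrow> 'r) \<in> carrier (ext_alg A)"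
        using a unfolding T by (intro ext_mon_in_carrier) auto
      ultimately have "(ext_mon (set ?ls) (signed n 1) :: ('k^'n) set set \<Rightarrow> 'r) \<in> dep_part A (dependent_at x)"
        unfolding dep_part_def by (auto simp: ext_mon_def)
      then show ?thesis unfolding g n if_P[OF True] by (rule ext_der_in_dep_ideal)
    next
      case False
      show ?thesis unfolding g n if_not_P[OF False] ext_der_contr contr_0 by (rule dep_ideal_zero)
    qed
  qed
  moreover have "\<exists>n. (ext_der (ext_mon T (signed n 1)) :: ('k^'n) set set \<Rightarrow> 'r) \<in> ?G"
    if T: "finite T" "T \<subseteq> A" "dependent_at x T" for T
  proof -
    define L where "L = nr x"
    have L: "is_lattice v L" "homothety_class L = x" using normalD(1) nr_vertex[OF x] by (auto simp: L_def)
    have "\<not> indep L T" using dependent_at_nr[OF x, of T] T A by (auto simp: L_def)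
    then obtain f l0 where f: "\<And>l. l \<in> T \<Longrightarrow> f l \<in> l" "(\<Sum>l\<in>T. f l) \<in> L" "l0 \<in> T" "f l0 \<notin> L"
      unfolding indep_def by blast
    \<comment> \<open>A unimodular vector on each line turns the family \<open>f\<close> into a list
      of coefficients.\<close>
    have "\<exists>a. a \<in> l \<and> a \<in> L \<and> a \<notin> scale_set p L \<and> a \<noteq> 0" if l: "l \<in> T" for l
    proof -
      have ll: "l \<in> lines" using l T A by blast
      then obtain b where b: "b \<in> l" "b \<noteq> 0" using lines_nonzero by blast
      obtain c where c: "c \<noteq> 0" "c *s b \<in> L" "c *s b \<notin> scale_set p L" by (rule unimodular_multiple[OF L(1) b(2)])
      moreover have "c *s b \<noteq> 0" using b(2) c(1) by simp
      ultimately show ?thesis using lines_scale[OF ll b(1)] by blast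
    qed
    then obtain u where u: "\<And>l. l \<in> T \<Longrightarrow> u l \<in> l \<and> u l \<in> L \<and> u l \<notin> scale_set p L \<and> u l \<noteq> 0" by metis
    have "\<exists>c. f l = c *s u l" if l: "l \<in> T" for l
    proof -
      have "l \<in> lines" using l T A by blast
      then obtain k where "f l = k *s u l"
        using lines_proportional[of l "u l" "f l"] u[OF l] f(1)[OF l] by blast
      then show ?thesis ..
    qed
    then obtain c where c: "\<And>l. l \<in> T \<Longrightarrow> f l = c l *s u l" by metis
    obtain ls where ls: "distinct ls" "set ls = T" using finite_distinct_list[OF T(1)] by blast
    have "ls \<noteq> []" using ls(2) f(3) by auto
    then obtain m where m: "length ls = Suc m" by (cases ls) auto
    define a where "a i = u (ls ! i)" for i
    have mem: "ls ! i \<in> T" if "i \<le> m" for i using ls(2) m that nth_mem[of i ls] by auto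
    have span: "vec.span {a i} = ls ! i" if "i \<le> m" for i
      using line_eq_span[of "ls ! i" "u (ls ! i)"] u[OF mem[OF that]] mem[OF that] T A by (auto simp: a_def)
    have map: "map (\<lambda>i. vec.span {a i}) [0..<Suc m] = ls"
      by (rule nth_equalityI) (use m span in \<open>auto simp del: upt_Suc\<close>)
    have bij: "bij_betw ((!) ls) {..m} T"
      using bij_betw_nth[OF ls(1), of "{..m}" T] ls(2) m by (auto simp: lessThan_Suc_atMost)
    have "(\<Sum>i\<le>m. c (ls ! i) *s a i) = (\<Sum>i\<le>m. f (ls ! i))"
      by (intro sum.cong refl) (use c mem in \<open>auto simp: a_def\<close>)
    also have "\<dots> = (\<Sum>l\<in>T. f l)" by (rule sum.reindex_bij_betw[OF bij])
    finally have sumL: "(\<Sum>i\<le>m. c (ls ! i) *s a i) \<in> L" using f(2) by simp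
    obtain j0 where j0: "j0 \<le> m" "ls ! j0 = l0"
      using f(3) ls(2) m by (metis in_set_conv_nth less_Suc_eq_le)
    have "c (ls ! j0) *s a j0 \<notin> L" using f(4) c[OF f(3)] j0(2) by (simp add: a_def)
    then have dep: "dependent_mod v p L m a"
      using u mem by (intro dependent_mod_if_dependent[OF L(1) _ sumL j0(1)]) (auto simp: a_def)
    have "\<forall>i\<le>m. a i \<in> L - scale_set p L \<and> vec.span {a i} \<in> A"
      using u mem span T(2) by (auto simp: a_def)
    then have "(ext_der (ext_prod A ls) :: ('k^'n) set set \<Rightarrow> 'r) \<in> ?G"
      unfolding standard_generators_def using map L dep by (intro CollectI exI[of _ L] exI[of _ m] exI[of _ a]) simp
    moreover obtain n where "(ext_prod A ls :: ('k^'n) set set \<Rightarrow> 'r) = ext_mon T (signed n 1)"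
      using ext_prod_eq_ext_mon[of A ls] ls by auto
    ultimately show ?thesis by (intro exI[of _ n]) simp
  qed
  ultimately show ?thesis unfolding vertex_ideal_def by (rule genideal_eq_dep_ideal)
qed

lemma simplex_ideal_eq:
  fixes A :: "('k^'n) set set"
  assumes A: "A \<subseteq> lines" and \<sigma>: "\<sigma> \<in> simplices"
  shows "(simplex_ideal v p A \<sigma> :: (('k^'n) set set \<Rightarrow> 'r::{comm_ring, comm_monoid_mult}) set) =
    dep_ideal A (\<lambda>T. \<exists>x\<in>\<sigma>. dependent_at x T)"
proof -
  have "finite \<sigma>" using \<sigma> by (simp add: simplices_def)
  have "(\<Pi> x\<in>\<sigma>. vertex_ideal v p A x :: (('k^'n) set set \<Rightarrow> 'r) set) = (\<Pi> x\<in>\<sigma>. dep_ideal A (dependent_at x))"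
  proof -
    have "vertex_ideal v p A x = (dep_ideal A (dependent_at x) :: (('k^'n) set set \<Rightarrow> 'r) set)" if "x \<in> \<sigma>" for x
      by (rule vertex_ideal_eq[OF A simplices_memD(1)[OF \<sigma> that]])
    then show ?thesis unfolding Pi_def by auto
  qed
  then show ?thesis
    unfolding simplex_ideal_def sum_of_dep_ideals[OF \<open>finite \<sigma>\<close>, symmetric] by (simp only:)
qed

end


section \<open>Acyclicity\<close>

lemma set_add_eq_add_sets:
  assumes "add R = (+)" shows "set_add R C D = add_sets C D"
  unfolding set_add_def set_mult_def add_sets_def by (auto simp: assms)

text \<open>Only addition enters, so the record of \<open>ext_alg A\<close> with its carrier cut
  down to \<open>ext_im A\<close> is covered as well.\<close>

lemma add_monoid_Quot_eq_quotient_group: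
  fixes R :: "'m::ab_group_add ring"
  assumes "add R = (+)" shows "add_monoid (R Quot I) = quotient_group (carrier R) I"
proof -
  have "a_rcosets\<^bsub>R\<^esub> I = coset I ` carrier R"
    unfolding A_RCOSETS_def RCOSETS_def r_coset_def coset_def by (auto simp: assms)
  moreover have "set_add R = add_sets" by (intro ext set_add_eq_add_sets assms)
  ultimately show ?thesis by (simp add: FactRing_def quotient_group_def)
qed

lemma add_ext_alg: "add (ext_alg A) = (+)" "add ((ext_alg A)\<lparr>carrier := B\<rparr>) = (+)"
  by (simp_all add: ext_alg_def fun_eq_iff)

context local_field
begin

context
  fixes A :: "('k^'n) set set" and lab :: "('k^'n) set set \<Rightarrow> nat"
  assumes A: "A \<subseteq> lines" and lab: "type_labelling v p lab"
begin

abbreviation simplex_dep :: "('k^'n) set set set \<Rightarrow> ('k^'n) set set \<Rightarrow> bool" where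
  "simplex_dep \<sigma> T \<equiv> \<exists>x\<in>\<sigma>. dependent_at x T"

lemma simplex_finite: "\<sigma> \<in> simplices \<Longrightarrow> finite \<sigma>"
  by (simp add: simplices_def)

lemma simplex_inj_lab:
  fixes \<sigma> :: "('k^'n) set set set"
  assumes "\<sigma> \<in> simplices" shows "inj_on lab \<sigma>"
proof (cases "\<sigma> = {}")
  case False
  then obtain k where "card \<sigma> = Suc k" using simplex_finite[OF assms] by (metis card_eq_0_iff not0_implies_Suc)
  then have "\<sigma> \<in> building v p k" using assms by (simp add: building_eq)
  then show ?thesis using lab unfolding type_labelling_def by blast
qed simp

lemma simplex_sign_rule:
  fixes \<sigma> :: "('k^'n) set set set"
  shows "\<sigma> \<in> simplices \<Longrightarrow> sign_rule (label_sign lab) \<sigma>"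
  by (intro sign_rule_label_sign simplex_finite simplex_inj_lab)

definition link_of :: "('k^'n) set set \<Rightarrow> ('k^'n) set set set set" where
  "link_of z = {\<tau>. z \<notin> \<tau> \<and> insert z \<tau> \<in> simplices \<and> (\<forall>y\<in>\<tau>. height y < height z)}"

text \<open>Circuits are broken at their smallest line, and \<open>b\<close> may lie in
  \<open>S\<close>: for the least line of a non-empty \<open>S\<close> inside \<open>A\<close>, the
  condition says that \<open>S\<close> itself is independent at \<open>y\<close>.\<close>

definition nbc :: "(('k^'n) set \<Rightarrow> ('k^'n) set \<Rightarrow> bool) \<Rightarrow> ('k^'n) set set \<Rightarrow> ('k^'n) set set \<Rightarrow> bool" where
  "nbc prec S y \<longleftrightarrow> (\<forall>b\<in>A. \<not> dependent_at y (insert b {s \<in> S. prec b s}))"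

lemma nbc_nr:
  assumes "y \<in> vertices" "S \<subseteq> A"
  shows "nbc prec S y \<longleftrightarrow> (\<forall>b\<in>A. indep (nr y) (insert b {s \<in> S. prec b s}))"
proof -
  have "insert b {s \<in> S. prec b s} \<subseteq> lines" if "b \<in> A" for b using that assms(2) A by auto
  then show ?thesis unfolding nbc_def using dependent_at_nr[OF assms(1)] by blast
qed

text \<open>Reduction needs one vertex with a broken circuit, whereas the argument on leading terms
  uses the lattices of all vertices of \<open>insert z \<tau>\<close> at once. The vertex
  \<open>z\<close> takes part in every condition, although only \<tau> varies.\<close>

lemma filtered_link_of:
  assumes "monomial_order prec"
  shows "filtered_link prec A (link_of z) (\<lambda>\<tau>. label_sign lab (insert z \<tau>))
    (\<lambda>\<tau>. dep_ideal A (simplex_dep (insert z \<tau>)) :: (('k^'n) set set \<Rightarrow> 'r::{comm_ring, comm_monoid_mult}) set)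
    (\<lambda>S \<tau>. \<forall>y\<in>insert z \<tau>. nbc prec S y)"
proof -
  interpret monomial_order prec by fact
  have simp: "insert z \<tau> \<in> simplices" "z \<notin> \<tau>" "y \<in> \<tau> \<Longrightarrow> height y < height z" if "\<tau> \<in> link_of z" for \<tau> y
    using that by (auto simp: link_of_def)
  show ?thesis
  proof (unfold_locales)
    show "finite (link_of z)"
    proof (cases "z \<in> vertices")
      case True
      have "\<tau> \<subseteq> {y \<in> vertices. nr y \<subseteq> nr z}" if \<tau>: "\<tau> \<in> link_of z" for \<tau>
      proof
        fix y assume y: "y \<in> \<tau>"
        then have "nr y \<subset> nr z" using simp(3)[OF \<tau> y] simplex_height(1)[OF simp(1)[OF \<tau>], of y z] by auto
        moreover have "y \<in> vertices" using simp(1)[OF \<tau>] y by (auto simp: simplices_def)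
        ultimately show "y \<in> {y \<in> vertices. nr y \<subseteq> nr z}" by blast
      qed
      then have "link_of z \<subseteq> Pow {y \<in> vertices. nr y \<subseteq> nr z}" by blast
      then show ?thesis by (rule finite_subset) (simp add: finite_lower_vertices[OF True])
    next
      case False
      then have "link_of z = {}" by (auto simp: link_of_def simplices_def)
      then show ?thesis by simp
    qed
  next
    fix \<tau> assume \<tau>: "\<tau> \<in> link_of z"
    note \<sigma> = simp[OF \<tau>]
    show "finite \<tau>" using simplex_finite[OF \<sigma>(1)] by simp
    show "sign_rule (\<lambda>\<tau>. label_sign lab (insert z \<tau>)) \<tau>"
      unfolding sign_rule_def
    proof (intro ballI impI)
      fix x y assume xy: "x \<in> \<tau>" "y \<in> \<tau>" "x \<noteq> y"
      then have "insert z (\<tau> - {x}) = insert z \<tau> - {x}" "insert z (\<tau> - {y}) = insert z \<tau> - {y}"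
        using \<sigma>(2) by auto
      then show "even (label_sign lab (insert z \<tau>) x + label_sign lab (insert z (\<tau> - {x})) y) \<noteq>
          even (label_sign lab (insert z \<tau>) y + label_sign lab (insert z (\<tau> - {y})) x)"
        using simplex_sign_rule[OF \<sigma>(1)] xy unfolding sign_rule_def by simp
    qed
    show "0 \<in> (dep_ideal A (simplex_dep (insert z \<tau>)) :: (('k^'n) set set \<Rightarrow> 'r) set)" by (rule dep_ideal_zero)
    show "f + g \<in> dep_ideal A (simplex_dep (insert z \<tau>))"
      if "f \<in> dep_ideal A (simplex_dep (insert z \<tau>))" "g \<in> dep_ideal A (simplex_dep (insert z \<tau>))"
      for f g :: "('k^'n) set set \<Rightarrow> 'r" using that by (rule dep_ideal_add)
    show "- f \<in> dep_ideal A (simplex_dep (insert z \<tau>))" if "f \<in> dep_ideal A (simplex_dep (insert z \<tau>))"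
      for f :: "('k^'n) set set \<Rightarrow> 'r" using that by (rule dep_ideal_uminus)
    fix \<rho> assume \<rho>: "\<rho> \<subseteq> \<tau>"
    have "insert z \<rho> \<in> simplices" by (rule simplices_subset[OF \<sigma>(1)]) (use \<rho> in auto)
    then show "\<rho> \<in> link_of z" using \<sigma>(2,3) \<rho> by (auto simp: link_of_def)
    show "dep_ideal A (simplex_dep (insert z \<rho>)) \<subseteq> (dep_ideal A (simplex_dep (insert z \<tau>)) :: (('k^'n) set set \<Rightarrow> 'r) set)"
      by (rule dep_ideal_mono) (use \<rho> in auto)
    show "\<forall>y\<in>insert z \<rho>. nbc prec S y" if "\<forall>y\<in>insert z \<tau>. nbc prec S y" for S
      using that \<rho> by auto
  next
    fix \<tau> S and r :: 'r
    assume \<tau>: "\<tau> \<in> link_of z" and S: "finite S" "S \<subseteq> A" and "\<not> (\<forall>y\<in>insert z \<tau>. nbc prec S y)"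
    then obtain y b where y: "y \<in> insert z \<tau>" and b: "b \<in> A" "dependent_at y (insert b {s \<in> S. prec b s})"
      by (auto simp: nbc_def)
    interpret ordered_dependence A "dependent_at y" prec
      by (intro ordered_dependence.intro dependence_dependent_at A assms)
    obtain h :: "('k^'n) set set \<Rightarrow> 'r" where h: "h \<in> carrier (ext_alg A)" "\<And>T. h T \<noteq> 0 \<Longrightarrow> colex T S"
      "ext_mon S r - h \<in> dep_ideal A (dependent_at y)"
      using broken_circuit_reduction[OF S b, of r] by blast
    have "dep_ideal A (dependent_at y) \<subseteq> (dep_ideal A (simplex_dep (insert z \<tau>)) :: (('k^'n) set set \<Rightarrow> 'r) set)"
      by (rule dep_ideal_mono) (use y in blast)
    then show "\<exists>h\<in>carrier (ext_alg A). (\<forall>T. h T \<noteq> 0 \<longrightarrow> colex T S) \<and>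
        ext_mon S r - h \<in> dep_ideal A (simplex_dep (insert z \<tau>))"
      using h by blast
  next
    fix \<tau> S and f :: "('k^'n) set set \<Rightarrow> 'r"
    assume \<tau>: "\<tau> \<in> link_of z" and S: "finite S" "S \<subseteq> A" and n: "\<forall>y\<in>insert z \<tau>. nbc prec S y"
      and f: "f \<in> dep_ideal A (simplex_dep (insert z \<tau>))" and lead: "\<And>T. f T \<noteq> 0 \<Longrightarrow> T = S \<or> colex T S"
    have "lattice_chain (\<Union>(insert z \<tau>))" by (rule lattice_chain_Union_simplex[OF simp(1)[OF \<tau>]]) simp
    then interpret ordered_lattice_chain "\<Union>(insert z \<tau>)" prec
      using assms by (intro ordered_lattice_chain.intro)
    show "f S = 0"
    proof (rule no_leading_nbc_monomial[OF A S _ _ f lead])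
      show "simplex_dep (insert z \<tau>) T \<longleftrightarrow> (\<exists>L\<in>\<Union>(insert z \<tau>). \<not> indep L T)" for T
        unfolding dependent_at_def by blast
      show "indep L (insert b {s \<in> S. prec b s})" if "b \<in> A" "L \<in> \<Union>(insert z \<tau>)" for b L
        using n that unfolding nbc_def dependent_at_def by blast
    qed
  next
    fix \<tau>0 S assume \<tau>0: "\<tau>0 \<in> link_of z" "\<tau>0 \<noteq> {}" and S: "finite S" "S \<subseteq> A" and n: "\<forall>y\<in>insert z \<tau>0. nbc prec S y"
    obtain y where y: "y \<in> \<tau>0" using \<tau>0(2) by blast
    note \<sigma>0 = simp[OF \<tau>0(1)]
    have z: "z \<in> vertices" and yv: "y \<in> vertices" using \<sigma>0(1) y by (auto simp: simplices_def)
    \<comment> \<open>The condition on \<open>S\<close> at a vertex, as a property of a lattice that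
      passes to intersections; this is what the apex requires.\<close>
    let ?Q = "\<lambda>L. \<forall>b\<in>A. indep L (insert b {s \<in> S. prec b s})"
    have yz: "nr y \<subset> nr z" using simplex_height(1)[OF \<sigma>0(1), of y z] \<sigma>0(3)[OF y] y by auto
    have pz: "scale_set p (nr z) \<subseteq> nr y" using simplices_adj[OF \<sigma>0(1), of z y] y by (auto simp: adj_def)
    have Qy: "?Q (nr y)" using n y nbc_nr[OF yv S(2)] by blast
    have Q_Int: "?Q (L \<inter> M)" if "?Q L" "?Q M" for L M
      using that indep_Int by blast
    show "\<exists>m. \<forall>\<tau>\<in>link_of z. (\<forall>y\<in>insert z \<tau>. nbc prec S y) \<longrightarrow>
        insert m \<tau> \<in> link_of z \<and> (\<forall>y\<in>insert z (insert m \<tau>). nbc prec S y)"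
    proof (rule descending_link_apex[where Q = ?Q, OF z Q_Int yv yz pz Qy])
      fix m assume m: "m \<in> vertices" "?Q (nr m)" "height m < height z"
        "\<And>\<tau>. \<lbrakk>insert z \<tau> \<in> simplices; \<And>x. x \<in> \<tau> \<Longrightarrow> height x < height z \<and> ?Q (nr x)\<rbrakk>
          \<Longrightarrow> insert z (insert m \<tau>) \<in> simplices"
      have nm: "nbc prec S m" using nbc_nr[OF m(1) S(2)] m(2) by blast
      have "insert m \<tau> \<in> link_of z \<and> (\<forall>y\<in>insert z (insert m \<tau>). nbc prec S y)"
        if \<tau>: "\<tau> \<in> link_of z" "\<forall>y\<in>insert z \<tau>. nbc prec S y" for \<tau>
      proof -
        note \<sigma> = simp[OF \<tau>(1)]
        have "insert z (insert m \<tau>) \<in> simplices"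
        proof (rule m(4)[OF \<sigma>(1)])
          fix x assume x: "x \<in> \<tau>"
          then have "x \<in> vertices" using \<sigma>(1) by (auto simp: simplices_def)
          then show "height x < height z \<and> ?Q (nr x)" using \<sigma>(3)[OF x] \<tau>(2) x nbc_nr[OF _ S(2)] by blast
        qed
        moreover have "m \<noteq> z" using m(3) by auto
        ultimately show ?thesis using \<sigma>(2,3) m(3) \<tau>(2) nm by (auto simp: link_of_def)
      qed
      then show "\<exists>m. \<forall>\<tau>\<in>link_of z. (\<forall>y\<in>insert z \<tau>. nbc prec S y) \<longrightarrow>
          insert m \<tau> \<in> link_of z \<and> (\<forall>y\<in>insert z (insert m \<tau>). nbc prec S y)" by blast
    qed
  qed
qed

text \<open>Positive degree enters through the links: for \<open>k = 0\<close> the cochain on a link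
  would live on the empty simplex, which has no faces to bound it.\<close>

lemma cochain_is_coboundary_mod_ideal:
  fixes c :: "('k^'n) set set set \<Rightarrow> ('k^'n) set set \<Rightarrow> 'r::{comm_ring, comm_monoid_mult}"
  assumes k: "k \<ge> 1" and c: "\<And>\<rho>. c \<rho> \<in> carrier (ext_alg A)"
    and cocycle: "\<And>\<sigma>. \<lbrakk>\<sigma> \<in> simplices; card \<sigma> = Suc (Suc k)\<rbrakk> \<Longrightarrow> cob (label_sign lab) c \<sigma> \<in> dep_ideal A (simplex_dep \<sigma>)"
  shows "\<exists>b. (\<forall>\<rho>. b \<rho> \<in> carrier (ext_alg A)) \<and>
    (\<forall>\<sigma>\<in>simplices. card \<sigma> = Suc k \<longrightarrow> c \<sigma> - cob (label_sign lab) b \<sigma> \<in> dep_ideal A (simplex_dep \<sigma>))"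
proof -
  interpret H: height_complex simplices height "label_sign lab" "\<lambda>\<sigma>. dep_ideal A (simplex_dep \<sigma>) :: (('k^'n) set set \<Rightarrow> 'r) set"
    "carrier (ext_alg A) :: (('k^'n) set set \<Rightarrow> 'r) set"
  proof
    fix \<sigma> \<tau> :: "('k^'n) set set set" assume \<sigma>: "\<sigma> \<in> simplices"
    show "finite \<sigma>" by (rule simplex_finite[OF \<sigma>])
    show "\<tau> \<subseteq> \<sigma> \<Longrightarrow> \<tau> \<in> simplices" by (rule simplices_subset[OF \<sigma>])
    show "x = y" if "x \<in> \<sigma>" "y \<in> \<sigma>" "height x = height y" for x y
      using simplex_height(2)[OF \<sigma> that(1,2)] that(3) by blast
    show "sign_rule (label_sign lab) \<sigma>" by (rule simplex_sign_rule[OF \<sigma>])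
    show "dep_ideal A (simplex_dep \<tau>) \<subseteq> (dep_ideal A (simplex_dep \<sigma>) :: (('k^'n) set set \<Rightarrow> 'r) set)" if "\<tau> \<subseteq> \<sigma>"
      by (rule dep_ideal_mono) (use that in blast)
  qed (simp_all only: dep_ideal_add dep_ideal_uminus zero_in_carrier add_in_carrier uminus_in_carrier)
  obtain prec :: "('k^'n) set \<Rightarrow> ('k^'n) set \<Rightarrow> bool" where prec: "monomial_order prec"
    using monomial_order_exists by blast
  show ?thesis
  proof (rule H.cochain_is_coboundary[OF _ c cocycle])
    fix z and g :: "('k^'n) set set set \<Rightarrow> ('k^'n) set set \<Rightarrow> 'r"
    assume g: "\<And>\<rho>. g \<rho> \<in> carrier (ext_alg A)"
      "\<And>\<tau>. \<lbrakk>\<tau> \<in> H.link z; card \<tau> = Suc k\<rbrakk> \<Longrightarrow>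
        cob (\<lambda>\<tau>. label_sign lab (insert z \<tau>)) g \<tau> \<in> dep_ideal A (simplex_dep (insert z \<tau>))"
    have link: "H.link z = link_of z" unfolding H.link_def link_of_def ..
    interpret L: filtered_link prec A "link_of z" "\<lambda>\<tau>. label_sign lab (insert z \<tau>)"
      "\<lambda>\<tau>. dep_ideal A (simplex_dep (insert z \<tau>)) :: (('k^'n) set set \<Rightarrow> 'r) set"
      "\<lambda>S \<tau>. \<forall>y\<in>insert z \<tau>. nbc prec S y"
      by (rule filtered_link_of[OF prec])
    have "L.cocycle k g" unfolding L.cocycle_def using g link by blast
    then have "L.bounding k g" by (rule L.cocycle_bounding[OF k])
    then show "\<exists>u. (\<forall>\<rho>. u \<rho> \<in> carrier (ext_alg A)) \<and> (\<forall>\<tau>\<in>H.link z. card \<tau> = k \<longrightarrow>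
        g \<tau> - cob (\<lambda>\<tau>. label_sign lab (insert z \<tau>)) u \<tau> \<in> dep_ideal A (simplex_dep (insert z \<tau>)))"
      unfolding L.bounding_def link .
  qed
qed

lemma add_subgroup_dep_ideal: "add_subgroup (dep_ideal A Dep)"
  unfolding add_subgroup_def by (auto intro: dep_ideal_zero dep_ideal_add dep_ideal_uminus)

lemma add_subgroup_carrier: "add_subgroup (carrier (ext_alg A))"
  unfolding add_subgroup_def by (auto intro: zero_in_carrier add_in_carrier uminus_in_carrier)

lemma add_subgroup_ext_im: "add_subgroup (ext_im A :: (('k^'n) set set \<Rightarrow> 'r::{comm_ring, comm_monoid_mult}) set)"
  unfolding add_subgroup_def
proof (intro conjI ballI)
  have "0 = ext_der (0 :: ('k^'n) set set \<Rightarrow> 'r)" by (simp only: ext_der_contr contr_0)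
  then show "0 \<in> (ext_im A :: (('k^'n) set set \<Rightarrow> 'r) set)" unfolding ext_im_def using zero_in_carrier by blast
  fix f :: "('k^'n) set set \<Rightarrow> 'r" assume "f \<in> ext_im A"
  then obtain f' where f: "f = ext_der f'" "f' \<in> carrier (ext_alg A)" by (auto simp: ext_im_def)
  have "- f = ext_der (- f')" unfolding f(1) ext_der_contr contr_uminus ..
  then show "- f \<in> ext_im A" unfolding ext_im_def using uminus_in_carrier[OF f(2)] by blast
  fix g :: "('k^'n) set set \<Rightarrow> 'r" assume "g \<in> ext_im A"
  then obtain g' where g: "g = ext_der g'" "g' \<in> carrier (ext_alg A)" by (auto simp: ext_im_def)
  have "f + g = ext_der (f' + g')" unfolding f(1) g(1) ext_der_contr by (rule contr_add[OF f(2) g(2), symmetric])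
  then show "f + g \<in> ext_im A" unfolding ext_im_def using add_in_carrier[OF f(2) g(2)] by blast
qed

lemma faces_of_simplex:
  fixes \<sigma> :: "('k^'n) set set set"
  assumes "\<sigma> \<in> building v p (Suc k)"
  shows "{\<tau> \<in> building v p k. \<tau> \<subseteq> \<sigma>} = (\<lambda>x. \<sigma> - {x}) ` \<sigma>"
proof
  have \<sigma>: "\<sigma> \<in> simplices" "card \<sigma> = Suc (Suc k)" using assms by (simp_all add: building_eq)
  have fin: "finite \<sigma>" by (rule simplex_finite[OF \<sigma>(1)])
  show "{\<tau> \<in> building v p k. \<tau> \<subseteq> \<sigma>} \<subseteq> (\<lambda>x. \<sigma> - {x}) ` \<sigma>"
  proof
    fix \<tau> assume "\<tau> \<in> {\<tau> \<in> building v p k. \<tau> \<subseteq> \<sigma>}"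
    then have \<tau>: "\<tau> \<subseteq> \<sigma>" "card \<tau> = Suc k" by (auto simp: building_eq)
    then have "card (\<sigma> - \<tau>) = 1" using card_Diff_subset[OF finite_subset[OF \<tau>(1) fin] \<tau>(1)] \<sigma>(2) by simp
    then obtain x where "\<sigma> - \<tau> = {x}" by (rule card_1_singletonE)
    then have "\<tau> = \<sigma> - {x}" "x \<in> \<sigma>" using \<tau>(1) by auto
    then show "\<tau> \<in> (\<lambda>x. \<sigma> - {x}) ` \<sigma>" by blast
  qed
  show "(\<lambda>x. \<sigma> - {x}) ` \<sigma> \<subseteq> {\<tau> \<in> building v p k. \<tau> \<subseteq> \<sigma>}"
    using simplices_subset[OF \<sigma>(1)] \<sigma>(2) fin by (auto simp: building_eq)
qed

lemma quotient_system_building: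
  fixes F :: "(('k^'n) set set, (('k^'n) set set \<Rightarrow> 'r::{comm_ring, comm_monoid_mult}) set) ccs"
  assumes E: "add_subgroup E" "E \<subseteq> carrier (ext_alg A)"
    and F: "\<And>\<sigma>. \<sigma> \<in> simplices \<Longrightarrow> ccs_group F \<sigma> = quotient_group E (E \<inter> dep_ideal A (simplex_dep \<sigma>))"
    "\<And>\<tau> \<sigma> C. \<sigma> \<in> simplices \<Longrightarrow> ccs_map F \<tau> \<sigma> C = add_sets (E \<inter> dep_ideal A (simplex_dep \<sigma>)) C"
  shows "quotient_system (building v p) lab F E (\<lambda>\<sigma>. E \<inter> dep_ideal A (simplex_dep \<sigma>))"
proof
  show "add_subgroup E" by fact
  fix \<sigma> :: "('k^'n) set set set" and k assume "\<sigma> \<in> building v p k"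
  then have \<sigma>: "\<sigma> \<in> simplices" by (simp add: building_eq)
  show "add_subgroup (E \<inter> dep_ideal A (simplex_dep \<sigma>))"
    using E(1) add_subgroup_dep_ideal[of "simplex_dep \<sigma>", where 'a = 'r] unfolding add_subgroup_def by blast
  show "ccs_group F \<sigma> = quotient_group E (E \<inter> dep_ideal A (simplex_dep \<sigma>))" by (rule F(1)[OF \<sigma>])
  show "finite \<sigma>" by (rule simplex_finite[OF \<sigma>])
  show "inj_on lab \<sigma>" by (rule simplex_inj_lab[OF \<sigma>])
next
  fix \<sigma> :: "('k^'n) set set set" and k x assume "\<sigma> \<in> building v p (Suc k)"
  then have \<sigma>: "\<sigma> \<in> simplices" by (simp add: building_eq)
  have "dep_ideal A (simplex_dep (\<sigma> - {x})) \<subseteq> (dep_ideal A (simplex_dep \<sigma>) :: (('k^'n) set set \<Rightarrow> 'r) set)"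
    by (rule dep_ideal_mono) blast
  then show "E \<inter> dep_ideal A (simplex_dep (\<sigma> - {x})) \<subseteq> E \<inter> dep_ideal A (simplex_dep \<sigma>)" by blast
  show "ccs_map F (\<sigma> - {x}) \<sigma> C = add_sets (E \<inter> dep_ideal A (simplex_dep \<sigma>)) C" for C
    by (rule F(2)[OF \<sigma>])
qed (auto simp: faces_of_simplex)

lemma carrier_Int_dep_ideal: "carrier (ext_alg A) \<inter> dep_ideal A Dep = dep_ideal A Dep"
  using dep_ideal_carrier by blast

lemma trivial_cohomology_Atilde:
  assumes "k \<ge> 1"
  shows "trivial_group (cohomology (building v p) lab
    (ccs_Atilde v p A :: (_, (('k^'n) set set \<Rightarrow> 'r::{comm_ring, comm_monoid_mult}) set) ccs) k)"
proof -
  let ?E = "carrier (ext_alg A) :: (('k^'n) set set \<Rightarrow> 'r) set"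
  obtain j where j: "k = Suc j" using assms by (cases k) auto
  interpret quotient_system "building v p" lab "ccs_Atilde v p A" ?E "\<lambda>\<sigma>. ?E \<inter> dep_ideal A (simplex_dep \<sigma>)"
  proof (rule quotient_system_building[OF add_subgroup_carrier subset_refl])
    fix \<sigma> \<tau> :: "('k^'n) set set set" and C :: "(('k^'n) set set \<Rightarrow> 'r) set" assume \<sigma>: "\<sigma> \<in> simplices"
    show "ccs_group (ccs_Atilde v p A) \<sigma> = quotient_group ?E (?E \<inter> dep_ideal A (simplex_dep \<sigma>))"
    proof -
      have "ccs_group (ccs_Atilde v p A) \<sigma> = add_monoid ((ext_alg A :: (('k^'n) set set \<Rightarrow> 'r) ring) Quot simplex_ideal v p A \<sigma>)"
        by (simp add: ccs_Atilde_def)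
      also have "\<dots> = quotient_group ?E (simplex_ideal v p A \<sigma>)"
        by (rule add_monoid_Quot_eq_quotient_group[OF add_ext_alg(1)])
      finally show ?thesis unfolding carrier_Int_dep_ideal unfolding simplex_ideal_eq[OF A \<sigma>] .
    qed
    show "ccs_map (ccs_Atilde v p A) \<tau> \<sigma> C = add_sets (?E \<inter> dep_ideal A (simplex_dep \<sigma>)) C"
      unfolding carrier_Int_dep_ideal unfolding simplex_ideal_eq[OF A \<sigma>, symmetric]
      by (simp add: ccs_Atilde_def set_add_eq_add_sets add_ext_alg)
  qed
  show ?thesis
    unfolding j
  proof (rule trivial_cohomology)
    fix c :: "('k^'n) set set set \<Rightarrow> ('k^'n) set set \<Rightarrow> 'r"
    assume c: "\<And>\<rho>. c \<rho> \<in> ?E" "\<And>\<sigma>. \<sigma> \<in> building v p (Suc (Suc j)) \<Longrightarrow>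
      cob (label_sign lab) c \<sigma> \<in> ?E \<inter> dep_ideal A (simplex_dep \<sigma>)"
    show "\<exists>b. (\<forall>\<rho>. b \<rho> \<in> ?E) \<and> (\<forall>\<sigma>\<in>building v p (Suc j).
        c \<sigma> - cob (label_sign lab) b \<sigma> \<in> ?E \<inter> dep_ideal A (simplex_dep \<sigma>))"
      using cochain_is_coboundary_mod_ideal[of "Suc j" c] c unfolding carrier_Int_dep_ideal
      by (auto simp: building_eq)
  qed
qed

lemma trivial_cohomology_A:
  assumes "k \<ge> 1" and "A \<noteq> {}"
  shows "trivial_group (cohomology (building v p) lab
    (ccs_A v p A :: (_, (('k^'n) set set \<Rightarrow> 'r::{comm_ring, comm_monoid_mult}) set) ccs) k)"
proof -
  let ?E = "ext_im A :: (('k^'n) set set \<Rightarrow> 'r) set"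
  obtain j where j: "k = Suc j" using assms(1) by (cases k) auto
  obtain l where l: "l \<in> A" using assms(2) by blast
  interpret quotient_system "building v p" lab "ccs_A v p A" ?E "\<lambda>\<sigma>. ?E \<inter> dep_ideal A (simplex_dep \<sigma>)"
  proof (rule quotient_system_building[OF add_subgroup_ext_im])
    show "?E \<subseteq> carrier (ext_alg A)" using ext_im_carrier by blast
    fix \<sigma> \<tau> :: "('k^'n) set set set" and C :: "(('k^'n) set set \<Rightarrow> 'r) set" assume \<sigma>: "\<sigma> \<in> simplices"
    show "ccs_group (ccs_A v p A) \<sigma> = quotient_group ?E (?E \<inter> dep_ideal A (simplex_dep \<sigma>))"
    proof -
      have "ccs_group (ccs_A v p A) \<sigma> =
          add_monoid ((ext_alg A)\<lparr>carrier := ?E\<rparr> Quot (?E \<inter> simplex_ideal v p A \<sigma>))"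
        by (simp add: ccs_A_def)
      also have "\<dots> = quotient_group (carrier ((ext_alg A)\<lparr>carrier := ?E\<rparr>)) (?E \<inter> simplex_ideal v p A \<sigma>)"
        by (rule add_monoid_Quot_eq_quotient_group[OF add_ext_alg(2)])
      finally show ?thesis unfolding simplex_ideal_eq[OF A \<sigma>] by simp
    qed
    show "ccs_map (ccs_A v p A) \<tau> \<sigma> C = add_sets (?E \<inter> dep_ideal A (simplex_dep \<sigma>)) C"
      unfolding simplex_ideal_eq[OF A \<sigma>, symmetric]
      by (simp add: ccs_A_def set_add_eq_add_sets add_ext_alg)
  qed
  show ?thesis
    unfolding j
  proof (rule trivial_cohomology)
    fix c :: "('k^'n) set set set \<Rightarrow> ('k^'n) set set \<Rightarrow> 'r"
    assume c: "\<And>\<rho>. c \<rho> \<in> ?E" "\<And>\<sigma>. \<sigma> \<in> building v p (Suc (Suc j)) \<Longrightarrow>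
      cob (label_sign lab) c \<sigma> \<in> ?E \<inter> dep_ideal A (simplex_dep \<sigma>)"
    have cE: "c \<rho> \<in> carrier (ext_alg A)" for \<rho> by (rule ext_im_carrier[OF c(1)])
    have "\<exists>b. (\<forall>\<rho>. b \<rho> \<in> carrier (ext_alg A)) \<and> (\<forall>\<sigma>\<in>building v p (Suc j).
        c \<sigma> - cob (label_sign lab) b \<sigma> \<in> dep_ideal A (simplex_dep \<sigma>))"
      using cochain_is_coboundary_mod_ideal[of "Suc j" c] cE c(2) by (auto simp: building_eq)
    then obtain b where b: "\<And>\<rho>. b \<rho> \<in> carrier (ext_alg A)"
      "\<And>\<sigma>. \<sigma> \<in> building v p (Suc j) \<Longrightarrow> c \<sigma> - cob (label_sign lab) b \<sigma> \<in> dep_ideal A (simplex_dep \<sigma>)"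
      by blast
    \<comment> \<open>\<open>retract l\<close> is additive, fixes the values of \<open>c\<close> and
      preserves each ideal, so it carries the equation for \<open>b\<close> to one for
      \<open>b'\<close>.\<close>
    define b' where "b' \<rho> = retract l (b \<rho>)" for \<rho>
    have b'E: "b' \<rho> \<in> ?E" for \<rho> unfolding b'_def by (rule retract_in_ext_im[OF l b(1)])
    have signed: "retract l (signed n f) = signed n (retract l f)" for n and f :: "('k^'n) set set \<Rightarrow> 'r"
      by (cases "even n") (simp_all only: signed_def retract_uminus if_True if_False)
    have sum: "retract l (\<Sum>i\<in>I. f i) = (\<Sum>i\<in>I. retract l (f i))"
      if "finite I" "\<And>i. i \<in> I \<Longrightarrow> f i \<in> carrier (ext_alg A)" for I and f :: "('k^'n) set set \<Rightarrow> ('k^'n) set set \<Rightarrow> 'r"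
      using that
    proof (induction I rule: finite_induct)
      case empty
      have "retract l (0 :: ('k^'n) set set \<Rightarrow> 'r) = 0" using retract_ext_im[OF add_subgroupD(1)[OF add_subgroup_ext_im]] .
      then show ?case by (simp only: sum.empty)
    next
      case (insert i I)
      have "retract l (f i + sum f I) = retract l (f i) + retract l (sum f I)"
        by (rule retract_add[OF l]) (use insert in \<open>auto intro: sum_in_carrier\<close>)
      also have "retract l (sum f I) = (\<Sum>i\<in>I. retract l (f i))" by (rule insert.IH) (rule insert.prems, rule insertI2)
      finally show ?case unfolding sum.insert[OF insert.hyps] .
    qed
    have "c \<sigma> - cob (label_sign lab) b' \<sigma> \<in> ?E \<inter> dep_ideal A (simplex_dep \<sigma>)" if \<sigma>: "\<sigma> \<in> building v p (Suc j)" for \<sigma>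
    proof
      show "c \<sigma> - cob (label_sign lab) b' \<sigma> \<in> ?E"
        by (intro add_subgroupD(4)[OF add_subgroup_ext_im] c(1) add_subgroup_cob[OF add_subgroup_ext_im] b'E)
      have fin: "finite \<sigma>" by (rule finite_X[OF \<sigma>])
      have cob_c: "cob (label_sign lab) b \<sigma> \<in> carrier (ext_alg A)"
        by (rule add_subgroup_cob[OF add_subgroup_carrier b(1)])
      have "retract l (cob (label_sign lab) b \<sigma>) = cob (label_sign lab) b' \<sigma>"
        unfolding cob_def by (subst sum[OF fin]) (use b(1) in \<open>simp_all only: signed_in_carrier signed b'_def\<close>)
      moreover have "retract l (c \<sigma> - cob (label_sign lab) b \<sigma>) = retract l (c \<sigma>) - retract l (cob (label_sign lab) b \<sigma>)"
        using retract_add[OF l ext_im_carrier[OF c(1)] uminus_in_carrier[OF cob_c]]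
        unfolding retract_uminus diff_conv_add_uminus .
      ultimately have "retract l (c \<sigma> - cob (label_sign lab) b \<sigma>) = c \<sigma> - cob (label_sign lab) b' \<sigma>"
        using retract_ext_im[OF c(1)] by metis
      \<comment> \<open>Dependence at a simplex is dependence at the union of its classes, so the
        lemma for a set of lattices applies to it.\<close>
      moreover have "simplex_dep \<sigma> = (\<lambda>T. \<exists>L\<in>\<Union>\<sigma>. \<not> indep L T)" unfolding dependent_at_def by blast
      then have "dependence A (simplex_dep \<sigma>)"
        using dependence_dependent_at[OF A, of "\<Union>\<sigma>"] unfolding dependent_at_def by simp
      then have "retract l (c \<sigma> - cob (label_sign lab) b \<sigma>) \<in> dep_ideal A (simplex_dep \<sigma>)"
        by (rule dependence.retract_dep_ideal[OF _ l b(2)[OF \<sigma>]])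
      ultimately show "c \<sigma> - cob (label_sign lab) b' \<sigma> \<in> dep_ideal A (simplex_dep \<sigma>)" by metis
    qed
    then show "\<exists>b. (\<forall>\<rho>. b \<rho> \<in> ?E) \<and> (\<forall>\<sigma>\<in>building v p (Suc j).
        c \<sigma> - cob (label_sign lab) b \<sigma> \<in> ?E \<inter> dep_ideal A (simplex_dep \<sigma>))"
      using b'E by blast
  qed
qed

end

end

theorem corollary2p7:
  fixes v :: "'k::field \<Rightarrow> real"
    and p :: 'k
    and A :: "('k^'n) set set"
    and lab :: "('k^'n) set set \<Rightarrow> nat"
    and d k :: nat
  assumes "nonarch_locally_compact_field v"
    and "prime_element v p"
    and "d \<ge> 1" and "CARD('n) = d + 1"
    and "type_labelling v p lab"
    and "A \<subseteq> lines" and "A \<noteq> {}"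
    and "k \<ge> 1"
  shows "trivial_group (cohomology (building v p) lab
           (ccs_A v p A
             :: (_, (('k^'n) set set \<Rightarrow> 'r::{comm_ring, comm_monoid_mult}) set) ccs) k) \<and>
         trivial_group (cohomology (building v p) lab
           (ccs_Atilde v p A
             :: (_, (('k^'n) set set \<Rightarrow> 'r) set) ccs) k)"
proof -
  interpret local_field v p
    using assms(1,2) by unfold_locales (auto simp: nonarch_locally_compact_field_def)
  show ?thesis
    using trivial_cohomology_A[OF assms(6,5,8,7)] trivial_cohomology_Atilde[OF assms(6,5,8)] by blast
qed

end
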